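(* Let $q$ be a prime power, let $S$ be a nonempty finite subset of $\{2,3,4,\ldots\}$, put $h=|S|$, and let $K$ be an integer with $K\ge\max S+1$. For every integer $n\ge20K^2$, the matroid $M=M(q,S,K,n)$ defined in the context is simple, $3$-connected and $\mathbb F_q$-representable, of rank $$R=K+n\left(1+\binom{h+2}{3}\right).$$ Its inverse Kazhdan–Lusztig polynomial $Q_M(t)=\sum_jc_jt^j$ has degree exactly $K$ and $$c_0>c_1>\cdots>c_K>0.$$ With $\Delta_j=c_j^2-c_{j-1}c_{j+1}$, for every $1\le j<K$ one has $$\Delta_j<0\iff j\in S,\qquad\text{and}\qquad \Delta_j>0\ \text{ if } j\notin S.$$ Finally, for fixed $q,S,K$ and for all $j\in S$ simultaneously, $c_j^2/(c_{j-1}c_{j+1})\to0$ as $n\to\infty$.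
   Context: Construction of $M(q,S,K,n)$. Write $S=\{s_1<\cdots<s_h\}$ and put $\ell_a=s_a-2$ and $\lambda_a=\binom{h-a+2}{2}$ for $1\le a\le h$. Let $W=\mathbb F_q^K$ with basis $e_1,\ldots,e_K$, $L_a=\langle e_1,\ldots,e_{\ell_a}\rangle$ (zero if $\ell_a=0$), $w_0=e_K$. Let $V=W\oplus X_0\oplus X_1\oplus\cdots\oplus X_h$ with $\dim X_0=n$ and $\dim X_a=\lambda_an$ for $1\le a\le h$. For a vector space $U$, $\mathbb P(U)$ denotes its set of projective points (one-dimensional subspaces). Then $M(q,S,K,n)$ is the matroid on the ground set $$\bigl(\mathbb P(V)\setminus\mathbb P(W)\bigr)\setminus\bigcup_{a=1}^hC_a,\qquad C_a=\{\langle w_0+l+x\rangle:l\in L_a,\ x\in X_a\},$$ where the rank of a subset is the dimension of its linear span (i.e. one uses one representative vector of each remaining projective point as a matrix column). A matroid $M$ with ground set $E$ and rank function $r$ is $3$-connected if it has no $1$- or $2$-separation: for $k\in\{1,2\}$ there is no partition $(A,E\setminus A)$ with $|A|,|E\setminus A|\ge k$ and $r(A)+r(E\setminus A)-r(E)<k$. Matroid polynomials: for a loopless matroid $M$ of rank $r$, let $L(M)$ be its lattice of flats, $M|F$ the restriction to a flat $F$, $M/F$ the contraction, $\mu$ the Möbius function of $L(M)$, and $\chi_M(t)=\sum_{F\in L(M)}\mu(\varnothing,F)t^{r-\operatorname{rk}F}$. The Kazhdan–Lusztig polynomial $P_M$ is determined by: $P_M=1$ if $r=0$; $\deg P_M<r/2$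 if $r>0$; and $t^rP_M(t^{-1})=\sum_{F\in L(M)}\chi_{M|F}(t)P_{M/F}(t)$. The (ordinary, unnormalized) inverse Kazhdan–Lusztig polynomial $Q_M$ is determined by $Q_M=1$ if $r=0$, and for $r>0$, $$Q_M=\sum_{\varnothing\ne F\in L(M)}(-1)^{\operatorname{rk}F+1}P_{M|F}\,Q_{M/F}.$$ *)

theory Defs
  imports Complex_Main "HOL-Library.Function_Algebras"
    "HOL-Computational_Algebra.Polynomial"
begin

section \<open>Matroids\<close>

text \<open>Only the values of \<open>rk\<close> on subsets of \<open>ground\<close> matter.\<close>

datatype 'e pre_matroid = Pre_Matroid (ground: "'e set") (rk: "'e set \<Rightarrow> nat")

definition matroid :: "'e pre_matroid \<Rightarrow> bool" where
  "matroid M \<longleftrightarrow> finite (ground M) \<and>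
     (\<forall>A. A \<subseteq> ground M \<longrightarrow> rk M A \<le> card A) \<and>
     (\<forall>A B. A \<subseteq> B \<and> B \<subseteq> ground M \<longrightarrow> rk M A \<le> rk M B) \<and>
     (\<forall>A B. A \<subseteq> ground M \<and> B \<subseteq> ground M \<longrightarrow>
        rk M (A \<union> B) + rk M (A \<inter> B) \<le> rk M A + rk M B)"

abbreviation matroid_rank :: "'e pre_matroid \<Rightarrow> nat" where
  "matroid_rank M \<equiv> rk M (ground M)"

definition simple_matroid :: "'e pre_matroid \<Rightarrow> bool" where
  "simple_matroid M \<longleftrightarrow>
     (\<forall>e\<in>ground M. rk M {e} = 1) \<and>
     (\<forall>e\<in>ground M. \<forall>f\<in>ground M. e \<noteq> f \<longrightarrow> rk M {e, f} = 2)"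

text \<open>The inequality is \<open>r(A) + r(E - A) - r(E) < k\<close>, rearranged to avoid truncated subtraction.\<close>

definition separation :: "nat \<Rightarrow> 'e pre_matroid \<Rightarrow> 'e set \<Rightarrow> bool" where
  "separation k M A \<longleftrightarrow> A \<subseteq> ground M \<and> k \<le> card A \<and> k \<le> card (ground M - A) \<and>
     rk M A + rk M (ground M - A) < matroid_rank M + k"

definition three_connected :: "'e pre_matroid \<Rightarrow> bool" where
  "three_connected M \<longleftrightarrow> (\<forall>k\<in>{1, 2}. \<nexists>A. separation k M A)"

definition restriction :: "'e pre_matroid \<Rightarrow> 'e set \<Rightarrow> 'e pre_matroid" where
  "restriction M F = Pre_Matroid F (rk M)"

definition contraction :: "'e pre_matroid \<Rightarrow> 'e set \<Rightarrow> 'e pre_matroid" where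
  "contraction M F = Pre_Matroid (ground M - F) (\<lambda>A. rk M (A \<union> F) - rk M F)"

definition flats :: "'e pre_matroid \<Rightarrow> 'e set set" where
  "flats M = {F. F \<subseteq> ground M \<and> (\<forall>e \<in> ground M - F. rk M F < rk M (insert e F))}"


section \<open>Characteristic and Kazhdan--Lusztig polynomials\<close>

text \<open>The Moebius function of a family \<open>L\<close> of finite sets, ordered by inclusion.\<close>

function moebius :: "'e set set \<Rightarrow> 'e set \<Rightarrow> 'e set \<Rightarrow> int" where
  "moebius L X Y =
     (if X = Y then 1
      else if finite Y \<and> X \<subset> Y then - (\<Sum>Z\<in>{Z \<in> L. X \<subseteq> Z \<and> Z \<subset> Y}. moebius L X Z)
      else 0)"
  by auto
termination
  by (relation "measure (\<lambda>(L, X, Y). card Y)") (auto simp: psubset_card_mono)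

declare moebius.simps [simp del]

definition char_poly :: "'e pre_matroid \<Rightarrow> int poly" where
  "char_poly M =
     (\<Sum>F\<in>flats M. monom (moebius (flats M) {} F) (matroid_rank M - rk M F))"

text \<open>\<open>rev_poly r p\<close> is \<open>t^r * p(1/t)\<close>, for \<open>degree p \<le> r\<close>.\<close>

definition rev_poly :: "nat \<Rightarrow> int poly \<Rightarrow> int poly" where
  "rev_poly r p = (\<Sum>i\<le>r. monom (coeff p i) (r - i))"

text \<open>
  The polynomials below are meaningful for loopless matroids. In the sum defining the
  Kazhdan--Lusztig polynomial, the summand for the empty flat involves the polynomial
  \<open>p\<close> being determined, as \<open>contraction M {}\<close> is \<open>M\<close>. The value \<open>0\<close> for infinite ground sets
  only serves termination.
\<close>

function kl_poly :: "'e pre_matroid \<Rightarrow> int poly" where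
  "kl_poly M =
     (if matroid_rank M = 0 then 1
      else if finite (ground M) then
        (THE p. 2 * degree p < matroid_rank M \<and>
           rev_poly (matroid_rank M) p =
             (\<Sum>F\<in>flats M. char_poly (restriction M F) *
                (if F = {} then p else kl_poly (contraction M F))))
      else 0)"
  by auto
termination
proof (relation "measure (\<lambda>M. card (ground M))")
qed (auto simp: contraction_def flats_def intro!: psubset_card_mono)

declare kl_poly.simps [simp del]

function inv_kl_poly :: "'e pre_matroid \<Rightarrow> int poly" where
  "inv_kl_poly M =
     (if matroid_rank M = 0 then 1
      else if finite (ground M) then
        (\<Sum>F\<in>flats M - {{}}. (-1) ^ (rk M F + 1) *
           kl_poly (restriction M F) * inv_kl_poly (contraction M F))
      else 0)"
  by auto
termination
proof (relation "measure (\<lambda>M. card (ground M))")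
qed (auto simp: contraction_def flats_def intro!: psubset_card_mono)

declare inv_kl_poly.simps [simp del]


section \<open>Coordinate vector spaces and representability\<close>

definition scale_fun :: "'f::field \<Rightarrow> ('i \<Rightarrow> 'f) \<Rightarrow> 'i \<Rightarrow> 'f" where
  "scale_fun c v = (\<lambda>i. c * v i)"

interpretation fvec: vector_space scale_fun
  by unfold_locales (auto simp: scale_fun_def fun_eq_iff algebra_simps)

definition unit_fun :: "'i \<Rightarrow> 'i \<Rightarrow> 'f::field" where
  "unit_fun i = (\<lambda>j. if j = i then 1 else 0)"

text \<open>\<open>\<phi> e\<close> is the column indexed by \<open>e\<close> of a matrix with \<open>m\<close> rows.\<close>

definition representable_over :: "'f::field itself \<Rightarrow> 'e pre_matroid \<Rightarrow> bool" where
  "representable_over _ M \<longleftrightarrow>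
     (\<exists>m. \<exists>\<phi> :: 'e \<Rightarrow> nat \<Rightarrow> 'f.
        (\<forall>e\<in>ground M. \<forall>i\<ge>m. \<phi> e i = 0) \<and>
        (\<forall>A. A \<subseteq> ground M \<longrightarrow> rk M A = fvec.dim (\<phi> ` A)))"

definition proj_points :: "('i \<Rightarrow> 'f::field) set \<Rightarrow> ('i \<Rightarrow> 'f) set set" where
  "proj_points U = {fvec.span {v} | v. v \<in> U \<and> v \<noteq> 0}"


section \<open>The construction\<close>

text \<open>
  The ambient space is a space of functions on the coordinate labels: \<open>WI i\<close> labels the basis
  vector \<open>e\<^sub>i\<close> of \<open>W\<close>, and \<open>XI a j\<close> labels the \<open>j\<close>-th basis vector of \<open>X\<^sub>a\<close>. The sum of the
  subspaces spanned by disjoint sets of unit vectors is direct.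
\<close>

datatype label = WI nat | XI nat nat

definition s_elem :: "nat set \<Rightarrow> nat \<Rightarrow> nat" where
  "s_elem S a = sorted_list_of_set S ! (a - 1)"

definition ell :: "nat set \<Rightarrow> nat \<Rightarrow> nat" where
  "ell S a = s_elem S a - 2"

definition lam :: "nat set \<Rightarrow> nat \<Rightarrow> nat" where
  "lam S a = (card S - a + 2) choose 2"

definition dim_X :: "nat set \<Rightarrow> nat \<Rightarrow> nat \<Rightarrow> nat" where
  "dim_X S n a = (if a = 0 then n else lam S a * n)"

definition space_W :: "nat \<Rightarrow> (label \<Rightarrow> 'f::field) set" where
  "space_W K = fvec.span {unit_fun (WI i) | i. i \<in> {1..K}}"

definition space_L :: "nat set \<Rightarrow> nat \<Rightarrow> (label \<Rightarrow> 'f::field) set" where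
  "space_L S a = fvec.span {unit_fun (WI i) | i. i \<in> {1..ell S a}}"

definition vec_w0 :: "nat \<Rightarrow> label \<Rightarrow> 'f::field" where
  "vec_w0 K = unit_fun (WI K)"

definition space_X :: "nat set \<Rightarrow> nat \<Rightarrow> nat \<Rightarrow> (label \<Rightarrow> 'f::field) set" where
  "space_X S n a = fvec.span {unit_fun (XI a j) | j. j \<in> {1..dim_X S n a}}"

definition space_V :: "nat set \<Rightarrow> nat \<Rightarrow> nat \<Rightarrow> (label \<Rightarrow> 'f::field) set" where
  "space_V S K n = fvec.span (space_W K \<union> (\<Union>a\<in>{0..card S}. space_X S n a))"

definition deleted :: "nat set \<Rightarrow> nat \<Rightarrow> nat \<Rightarrow> nat \<Rightarrow> (label \<Rightarrow> 'f::field) set set" where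
  "deleted S K n a =
     {fvec.span {vec_w0 K + l + x} | l x. l \<in> space_L S a \<and> x \<in> space_X S n a}"

text \<open>The prime power \<open>q\<close> is \<open>CARD('f)\<close>. The elements are lines, so \<open>\<Union>A\<close> has the linear span of \<open>A\<close>
  as its span.\<close>

definition matroid_M ::
    "nat set \<Rightarrow> nat \<Rightarrow> nat \<Rightarrow> (label \<Rightarrow> 'f::{field, finite}) set pre_matroid" where
  "matroid_M S K n =
     Pre_Matroid
       ((proj_points (space_V S K n) - proj_points (space_W K)) -
          (\<Union>a\<in>{1..card S}. deleted S K n a))
       (\<lambda>A. fvec.dim (\<Union>A))"

end

theory Submission
  imports Defs
begin

text \<open>
  Regard a flat as the subspace it spans, and call a subspace missing if it contains no element
  of the matroid. For a subspace \<open>T\<close> let \<open>int T\<close> be the span of the elements in \<open>T\<close>, and let \<open>q F\<close> be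
  \<open>(-1)\<^sup>r\<close> times the inverse Kazhdan--Lusztig polynomial of the restriction to the flat \<open>F\<close> of rank
  \<open>r\<close>. The polynomial \<open>a T\<close>, the sum of \<open>t ^ (dim T' - dim (int T')) * q (int T')\<close> over \<open>T' \<subseteq> T\<close>, is
  palindromic of degree \<open>dim T\<close>: this combines the self-duality of the inverse Kazhdan--Lusztig
  polynomials with the symmetry of the lattice of subspaces. As the degree of \<open>q F\<close> is less than
  half the rank of \<open>F\<close> and \<open>dim T - dim (int T) \<le> 1\<close> unless \<open>int T = 0\<close>, the upper half of \<open>a T\<close> just
  counts the missing subspaces of \<open>T\<close>, up to a correction of the middle coefficient. Moebius
  inversion over all subspaces then expresses the \<open>i\<close>-th coefficient of the inverse
  Kazhdan--Lusztig polynomial as \<open>N\<^sub>i * q ^ ((R - 2 * i) choose 2) * [R - i - 1, i]\<close> up to a relatively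
  tiny error, where \<open>N\<^sub>i\<close> is the number of missing \<open>i\<close>-dimensional subspaces. The factor of \<open>N\<^sub>i\<close> is
  log-linear in \<open>i\<close> up to a bounded factor, so that \<open>N\<^sub>i\<close> decides about log-concavity. The missing
  subspaces outside of \<open>W\<close> are spanned by a subspace of some \<open>L\<^sub>a\<close> and a point of \<open>C\<^sub>a\<close>, hence
  \<open>N\<^sub>i\<close> has order \<open>q ^ (\<lambda>\<^sub>a * n)\<close> when \<open>s\<^sub>a\<close> is the least element of \<open>S\<close> greater than \<open>i\<close>; the second
  difference \<open>1\<close> of \<open>\<lambda>\<close> makes log-concavity fail exactly at the elements of \<open>S\<close>.
\<close>

section \<open>Gaussian binomial coefficients\<close>

text \<open>Everything rests on room in the exponents. The summand X_0 meets no deleted family and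
  makes R exceed K + lambda_1 n by at least n. Both sources of error lose against this surplus.
  Passing from m = 2i to m = 2i + 1 in the coefficient formula costs a factor of about q^(R - 2i -
  1), while no N_i exceeds q^(2 K^2 + lambda_1 n). A subspace with a middle correction lies in U + W
  + X_b for some missing U of dimension i, so there are about N_i q^(i (K + lambda_1 n)) of them,
  against the size q^(i (R - 2i - 1)) of the Gaussian binomial. The bound 20 K^2 lets n swallow all
  exponents quadratic in K together with the numerical constants. The obstacle is the field with two
  elements, over which lines through an element have only two further points; the two structure
  lemmas show that even then the elements in T span at least a hyperplane of T, and that T is
  confined as above. The choice of lambda is forced: the missing subspaces of W contribute exponent
  0, and continuing 0, 0 downwards in a with second difference 1 gives 1, 3, 6 and so on.\<close>

fun gbin :: "nat \<Rightarrow> nat \<Rightarrow> nat \<Rightarrow> nat" where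
  "gbin q n 0 = 1"
| "gbin q 0 (Suc k) = 0"
| "gbin q (Suc n) (Suc k) = gbin q n k + q ^ Suc k * gbin q n (Suc k)"

lemma gbin_eq_0: "n < k \<Longrightarrow> gbin q n k = 0"
  by (induction q n k rule: gbin.induct) auto

lemma gbin_self [simp]: "gbin q n n = 1"
  by (induction n) (auto simp: gbin_eq_0)

lemma gbin_mono: "q \<ge> 1 \<Longrightarrow> m \<le> n \<Longrightarrow> gbin q m k \<le> gbin q n k"
proof (induction n)
  case (Suc n)
  have "gbin q n k \<le> gbin q (Suc n) k"
  proof (cases k)
    case (Suc l)
    have "1 * gbin q n (Suc l) \<le> q ^ Suc l * gbin q n (Suc l)"
      using Suc.prems by (intro mult_right_mono) auto
    then have "gbin q n (Suc l) \<le> q ^ Suc l * gbin q n (Suc l)" by (simp only: mult_1)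
    then show ?thesis unfolding Suc gbin.simps by (rule trans_le_add2)
  qed simp
  then show ?case using Suc by (cases "m = Suc n") auto
qed simp

text \<open>The number of ordered linearly independent k-tuples in an n-dimensional space over a
  field with q elements.\<close>

definition qfalling :: "nat \<Rightarrow> nat \<Rightarrow> nat \<Rightarrow> int" where
  "qfalling q n k = (\<Prod>i<k. int q ^ n - int q ^ i)"

lemma qfalling_Suc_Suc:
  "qfalling q (Suc n) (Suc k) = (int q ^ Suc n - 1) * int q ^ k * qfalling q n k"
proof -
  have "qfalling q (Suc n) (Suc k) = (int q ^ Suc n - 1) * (\<Prod>i<k. int q ^ Suc n - int q ^ Suc i)"
    unfolding qfalling_def by (subst prod.lessThan_Suc_shift) simp
  also have "(\<Prod>i<k. int q ^ Suc n - int q ^ Suc i) = (\<Prod>i<k. int q * (int q ^ n - int q ^ i))"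
    by (simp add: algebra_simps)
  also have "\<dots> = int q ^ k * qfalling q n k"
    unfolding qfalling_def prod.distrib by simp
  finally show ?thesis by (simp add: algebra_simps)
qed

text \<open>Groups independent tuples by their span. The recursion proves it for arbitrary
  \<open>q\<close>, before any vector space is present.\<close>

lemma gbin_qfalling: "int (gbin q n k) * qfalling q k k = qfalling q n k"
proof (induction q n k rule: gbin.induct)
  case (1 q n)
  show ?case by (simp add: qfalling_def)
next
  case (2 q k)
  have "(\<Prod>i<Suc k. int q ^ 0 - int q ^ i) = 0"
    by (rule prod_zero) (auto intro: bexI[of _ 0])
  then show ?case by (simp add: qfalling_def)
next
  case (3 q n k)
  have s: "qfalling q n (Suc k) = qfalling q n k * (int q ^ n - int q ^ k)"
    by (simp add: qfalling_def)
  have "int (gbin q (Suc n) (Suc k)) * qfalling q (Suc k) (Suc k) =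
     (int (gbin q n k) * qfalling q k k) * (int q ^ Suc k - 1) * int q ^ k +
     int q ^ Suc k * (int (gbin q n (Suc k)) * qfalling q (Suc k) (Suc k))"
    by (simp add: qfalling_Suc_Suc algebra_simps)
  also have "\<dots> = qfalling q n k * (int q ^ Suc k - 1) * int q ^ k + int q ^ Suc k * qfalling q n (Suc k)"
    using 3 by simp
  also have "\<dots> = qfalling q (Suc n) (Suc k)"
    unfolding s qfalling_Suc_Suc by (simp add: algebra_simps)
  finally show ?case .
qed

lemma qfalling_pos: "2 \<le> q \<Longrightarrow> k \<le> n \<Longrightarrow> 0 < qfalling q n k"
  unfolding qfalling_def by (intro prod_pos) (auto intro!: power_strict_increasing)

lemma gbin_le_power:
  assumes "2 \<le> q" shows "gbin q n k \<le> q ^ (n * k)"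
proof (cases "k \<le> n")
  case True
  have "int (gbin q n k) * 1 \<le> int (gbin q n k) * qfalling q k k"
    using qfalling_pos[OF assms, of k k] by (intro mult_left_mono) auto
  also have "\<dots> = qfalling q n k" by (rule gbin_qfalling)
  also have "\<dots> \<le> (\<Prod>i<k. int q ^ n)"
    unfolding qfalling_def using True assms by (intro prod_mono) (auto intro!: power_increasing)
  also have "\<dots> = int (q ^ (n * k))" by (simp add: power_mult)
  finally show ?thesis by simp
qed (simp add: gbin_eq_0)

lemma power_le_gbin: "1 \<le> q \<Longrightarrow> k \<le> n \<Longrightarrow> q ^ (k * (n - k)) \<le> gbin q n k"
proof (induction q n k rule: gbin.induct)
  case (3 q n k)
  show ?case
  proof (cases "Suc k \<le> n")
    case True
    have "Suc k * (Suc n - Suc k) = Suc k + Suc k * (n - Suc k)"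
      using True by (metis Suc_diff_Suc Suc_le_eq diff_Suc_Suc mult_Suc_right)
    then have "q ^ (Suc k * (Suc n - Suc k)) = q ^ Suc k * q ^ (Suc k * (n - Suc k))"
      by (simp add: power_add)
    also have "\<dots> \<le> q ^ Suc k * gbin q n (Suc k)"
      by (intro mult_left_mono 3 True) auto
    finally show ?thesis by simp
  next
    case False
    then show ?thesis using 3 by (simp add: gbin_eq_0)
  qed
qed auto

lemma gbin_pos: "1 \<le> q \<Longrightarrow> k \<le> n \<Longrightarrow> 0 < gbin q n k"
  using power_le_gbin[of q k n] by (metis gr0I le_zero_eq not_one_le_zero power_eq_0_iff)

text \<open>The q-factorial without its denominators q - 1. The quotient formula exhibits the
  symmetry in k and n - k, which the recursion of \<open>gbin\<close> hides.\<close>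

definition qfactorial :: "nat \<Rightarrow> nat \<Rightarrow> int" where
  "qfactorial q n = (\<Prod>i<n. int q ^ Suc i - 1)"

lemma qfactorial_Suc: "qfactorial q (Suc n) = qfactorial q n * (int q ^ Suc n - 1)"
  by (simp add: qfactorial_def)

lemma qfactorial_pos: "2 \<le> q \<Longrightarrow> 0 < qfactorial q n"
proof (induction n)
  case (Suc n)
  have "(1::int) < int q ^ Suc n" using Suc.prems by (intro one_less_power) auto
  then show ?case using Suc by (simp add: qfactorial_Suc)
qed (simp add: qfactorial_def)

lemma gbin_qfactorial:
  "k \<le> n \<Longrightarrow> int (gbin q n k) * qfactorial q k * qfactorial q (n - k) = qfactorial q n"
proof (induction q n k rule: gbin.induct)
  case (3 q n k)
  have f1: "int (gbin q n k) * qfactorial q k * qfactorial q (n - k) = qfactorial q n"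
    using 3 by simp
  show ?case
  proof (cases "Suc k \<le> n")
    case True
    then have "n - k = Suc (n - Suc k)" by simp
    then have f2: "qfactorial q (n - k) = qfactorial q (n - Suc k) * (int q ^ (n - k) - 1)"
      using qfactorial_Suc by metis
    have f3: "int (gbin q n (Suc k)) * qfactorial q (Suc k) * qfactorial q (n - Suc k) = qfactorial q n"
      using 3 True by simp
    have p: "int q ^ Suc k * int q ^ (n - k) = int q ^ Suc n"
      using True by (simp flip: power_Suc power_add)
    have "int (gbin q (Suc n) (Suc k)) * qfactorial q (Suc k) * qfactorial q (Suc n - Suc k) =
       (int (gbin q n k) * qfactorial q k * qfactorial q (n - k)) * (int q ^ Suc k - 1) +
       int q ^ Suc k * ((int (gbin q n (Suc k)) * qfactorial q (Suc k) * qfactorial q (n - Suc k)) * (int q ^ (n - k) - 1))"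
      by (simp add: f2 qfactorial_Suc[of q k] algebra_simps)
    also have "\<dots> = qfactorial q n * (int q ^ Suc k * int q ^ (n - k) - 1)"
      unfolding f1 f3 by (simp only: algebra_simps)
    finally show ?thesis unfolding p by (simp only: qfactorial_Suc)
  next
    case False
    then have "n = k" using 3 by simp
    then show ?thesis by (simp add: gbin_eq_0 qfactorial_def)
  qed
qed (auto simp: qfactorial_def)

lemma gbin_symmetric:
  assumes "2 \<le> q" "k \<le> n" shows "gbin q n (n - k) = gbin q n k"
proof -
  have "int (gbin q n (n - k)) * qfactorial q (n - k) * qfactorial q k =
        int (gbin q n k) * qfactorial q k * qfactorial q (n - k)"
    using gbin_qfactorial[of k n q] gbin_qfactorial[of "n - k" n q] assms by simp
  then show ?thesis
    using qfactorial_pos[OF assms(1), of k] qfactorial_pos[OF assms(1), of "n - k"] by (simp add: mult.assoc mult.commute)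
qed

lemma gbin_absorb:
  assumes "2 \<le> q" "k \<le> n"
  shows "int (gbin q n (Suc k)) * (int q ^ Suc k - 1) = int (gbin q n k) * (int q ^ (n - k) - 1)"
proof (cases "Suc k \<le> n")
  case True
  then have "n - k = Suc (n - Suc k)" by simp
  then have f2: "qfactorial q (n - k) = qfactorial q (n - Suc k) * (int q ^ (n - k) - 1)"
    using qfactorial_Suc by metis
  have "(int (gbin q n (Suc k)) * (int q ^ Suc k - 1)) * (qfactorial q k * qfactorial q (n - Suc k)) =
        (int (gbin q n k) * (int q ^ (n - k) - 1)) * (qfactorial q k * qfactorial q (n - Suc k))"
    using gbin_qfactorial[of k n q] gbin_qfactorial[of "Suc k" n q] True
    by (simp add: f2 qfactorial_Suc[of q k] algebra_simps)
  then show ?thesis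
    using qfactorial_pos[OF assms(1), of k] qfactorial_pos[OF assms(1), of "n - Suc k"] by simp
qed (use assms in \<open>simp add: gbin_eq_0 not_le le_antisym less_Suc_eq_le\<close>)

text \<open>By \<open>gbin_absorb\<close> two consecutive quotients differ by (q^(k+2) - 1)/(q^(k+1)
  - 1) times (q^(n-k) - 1)/(q^(n-k-1) - 1), and either fraction is at least q. The constant 4 leaves
  room for the perturbation in \<open>num_missing_log_concave\<close>.\<close>

lemma gbin_strongly_log_concave:
  assumes "2 \<le> q"
  shows "4 * (gbin q n k * gbin q n (Suc (Suc k))) \<le> gbin q n (Suc k) * gbin q n (Suc k)"
proof (cases "Suc (Suc k) \<le> n")
  case True
  define a b c where "a = int (gbin q n k)" and "b = int (gbin q n (Suc k))"
    and "c = int (gbin q n (Suc (Suc k)))"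
  define x where "x = int q ^ Suc k - 1"
  define y where "y = int q ^ (n - Suc k) - 1"
  have nk: "n - k = Suc (n - Suc k)" using True by simp
  have e1: "b * x = a * (int q ^ (n - k) - 1)"
    unfolding a_def b_def x_def using gbin_absorb[OF assms, of k n] True by simp
  have e2: "c * (int q ^ Suc (Suc k) - 1) = b * y"
    unfolding c_def b_def y_def using gbin_absorb[OF assms, of "Suc k" n] True by simp
  have pos: "a > 0" "b > 0" "c > 0" unfolding a_def b_def c_def
    using gbin_pos[of q k n] gbin_pos[of q "Suc k" n] gbin_pos[of q "Suc (Suc k)" n] assms True by auto
  have "(1::int) < int q ^ Suc k" using assms by (intro one_less_power) auto
  then have xp: "x > 0" by (simp add: x_def)
  have "(1::int) < int q ^ (n - Suc k)" using assms True by (intro one_less_power) auto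
  then have yp: "y > 0" by (simp add: y_def)
  have h1: "int q ^ Suc (Suc k) - 1 \<ge> 2 * x"
  proof -
    have "int q * int q ^ Suc k \<ge> 2 * int q ^ Suc k" using assms by (intro mult_right_mono) auto
    then show ?thesis by (simp add: x_def)
  qed
  have h2: "int q ^ (n - k) - 1 \<ge> 2 * y"
  proof -
    have "int q * int q ^ (n - Suc k) \<ge> 2 * int q ^ (n - Suc k)" using assms by (intro mult_right_mono) auto
    then show ?thesis by (simp add: y_def nk)
  qed
  have "a * (2 * y) \<le> b * x" unfolding e1 using pos h2 by (intro mult_left_mono) auto
  moreover have "c * (2 * x) \<le> b * y" unfolding e2[symmetric] using pos h1 by (intro mult_left_mono) auto
  ultimately have "(a * (2 * y)) * (c * (2 * x)) \<le> (b * x) * (b * y)"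
    using pos xp yp by (intro mult_mono[of "a * (2 * y)" "b * x" "c * (2 * x)" "b * y"]) simp_all
  then have "(4 * (a * c)) * (x * y) \<le> (b * b) * (x * y)" by (simp add: algebra_simps)
  then have "4 * (a * c) \<le> b * b" using xp yp by (simp add: mult_le_cancel_right)
  then show ?thesis unfolding a_def b_def c_def by (metis of_nat_le_iff of_nat_mult of_nat_numeral)
qed (simp add: gbin_eq_0)

section \<open>Alternating sums of Gaussian binomials\<close>

lemma choose_two_Suc: "Suc n choose 2 = n + (n choose 2)"
  by (simp add: numeral_2_eq_2)

text \<open>The sum telescopes once each \<open>gbin q (Suc s) j\<close> is split by the recursion,
  since q^(j choose 2) * q^j = q^((j+1) choose 2).\<close>

lemma gbin_alternating_partial_sum:
  "(\<Sum>j\<le>L. (-1) ^ j * int q ^ (j choose 2) * int (gbin q (Suc s) j)) =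
     (-1) ^ L * int q ^ (Suc L choose 2) * int (gbin q s L)"
proof (induction L)
  case (Suc L)
  then show ?case
    by (simp add: choose_two_Suc power_add algebra_simps)
qed (simp add: numeral_2_eq_2)

lemma gbin_alternating_sum:
  "(\<Sum>j\<le>n. (-1) ^ j * int q ^ (j choose 2) * int (gbin q n j)) = (if n = 0 then 1 else 0)"
proof (cases n)
  case (Suc s)
  then show ?thesis
    using gbin_alternating_partial_sum[of q s "Suc s"] by (simp add: gbin_eq_0)
qed (simp add: numeral_2_eq_2)

lemma gbin_alternating_sum_reflected:
  assumes "2 \<le> q"
  shows "(\<Sum>j\<le>n. (-1) ^ (n - j) * int q ^ ((n - j) choose 2) * int (gbin q n j)) = (if n = 0 then 1 else 0)"
proof -
  have "(\<Sum>j\<le>n. (-1) ^ (n - j) * int q ^ ((n - j) choose 2) * int (gbin q n j)) =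
        (\<Sum>j\<le>n. (-1) ^ (n - j) * int q ^ ((n - j) choose 2) * int (gbin q n (n - j)))"
    using gbin_symmetric[OF assms] by (intro sum.cong) auto
  also have "\<dots> = (\<Sum>j\<le>n. (-1) ^ j * int q ^ (j choose 2) * int (gbin q n j))"
    by (rule sum.nat_diff_reindex[of "\<lambda>j. (-1) ^ j * int q ^ (j choose 2) * int (gbin q n j)" "Suc n", simplified lessThan_Suc_atMost, simplified])
  finally show ?thesis by (simp add: gbin_alternating_sum)
qed

text \<open>The weights now decrease with l, so telescoping needs the other q-Pascal rule, which
  puts the power of q on the term with the smaller lower index; it is fact \<open>a\<close> below,
  obtained from the recursion by symmetry. This closed form becomes the Gaussian binomial of the
  main term.\<close>

lemma gbin_alternating_lower_sum:
  assumes "2 \<le> q" "i < s"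
  shows "(\<Sum>l\<le>i. (-1) ^ l * int q ^ ((s - l) choose 2) * int (gbin q s l)) =
     (-1) ^ i * int q ^ ((s - i) choose 2) * int (gbin q (s - 1) i)"
  using assms(2)
proof (induction i)
  case 0
  then show ?case by simp
next
  case (Suc i)
  obtain d where "s = Suc (Suc i + d)" using less_imp_Suc_add[OF Suc.prems] by blast
  then have s: "s = Suc (i + Suc d)" by simp
  define t where "t = i + Suc d"
  have st: "s = Suc t" by (simp add: s t_def)
  have "gbin q s (Suc i) = gbin q s (Suc d)"
    using gbin_symmetric[OF assms(1), of "Suc i" s] by (simp add: s)
  also have "\<dots> = gbin q t d + q ^ Suc d * gbin q t (Suc d)"
    by (simp add: st)
  also have "gbin q t d = gbin q t (Suc i)"
    using gbin_symmetric[OF assms(1), of "Suc i" t] by (simp add: t_def)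
  also have "gbin q t (Suc d) = gbin q t i"
    using gbin_symmetric[OF assms(1), of "i" t] by (simp add: t_def)
  finally have a: "gbin q s (Suc i) = gbin q t (Suc i) + q ^ Suc d * gbin q t i" .
  have b: "s - i = Suc (Suc d)" "s - Suc i = Suc d" by (simp_all add: s)
  have IH: "(\<Sum>l\<le>i. (-1) ^ l * int q ^ ((s - l) choose 2) * int (gbin q s l)) =
     (-1) ^ i * int q ^ (Suc (Suc d) choose 2) * int (gbin q t i)"
    using Suc b st by simp
  show ?case
    unfolding sum.atMost_Suc IH a b using st choose_two_Suc[of "Suc d"]
    by (simp add: power_add algebra_simps)
qed

section \<open>Binomial identities and the limiting shape of Gaussian binomials\<close>

lemma less_power_nat: "m < q ^ m" if "2 \<le> q" for q m :: nat
  using less_exp[of m] power_mono[OF that, of m] by linarith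

lemma hockey_stick: "(\<Sum>b\<in>{1..m}. Suc b choose 2) = (m + 2) choose 3"
proof (induction m)
  case (Suc m)
  have "(Suc m + 2) choose 3 = (Suc (Suc m) choose 2) + ((m + 2) choose 3)"
    by (simp add: numeral_3_eq_3 numeral_2_eq_2)
  then show ?case using Suc by simp
qed (simp add: numeral_3_eq_3)

text \<open>The first two summands are the exponents of q in the main term of the i-th coefficient:
  one from the Moebius function, one from the leading power of the Gaussian binomial. Their sum is
  thus linear in i.\<close>

lemma choose_two_shift:
  assumes "2 * i < R"
  shows "((R - 2 * i) choose 2) + i * (R - 2 * i - 1) + i * R = R choose 2"
proof -
  obtain d where R: "R = 2 * i + 1 + d" using assms less_imp_Suc_add by (metis Suc_eq_plus1 add.assoc add.commute)
  have dd: "2 * (Suc m choose 2) = Suc m * m" for m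
    by (induction m) (simp_all add: choose_two_Suc)
  have "2 * (((R - 2 * i) choose 2) + i * (R - 2 * i - 1) + i * R) = 2 * (R choose 2)"
    using dd[of d] dd[of "2 * i + d"] by (simp add: R algebra_simps)
  then show ?thesis by simp
qed

text \<open>The finite Pochhammer product (1/Q; 1/Q)_i.\<close>

definition qprod :: "real \<Rightarrow> nat \<Rightarrow> real" where
  "qprod Q i = (\<Prod>t<i. 1 - 1 / Q ^ Suc t)"

lemma qprod_Suc: "qprod Q (Suc i) = qprod Q i * (1 - 1 / Q ^ Suc i)"
  by (simp add: qprod_def)

lemma real_qfalling:
  assumes "1 \<le> q" "k \<le> n"
  shows "real_of_int (qfalling q n k) = real q ^ (n * k) * (\<Prod>i<k. 1 - 1 / real q ^ (n - i))"
proof -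
  have "real_of_int (qfalling q n k) = (\<Prod>i<k. real q ^ n - real q ^ i)"
    by (simp add: qfalling_def)
  also have "\<dots> = (\<Prod>i<k. real q ^ n * (1 - 1 / real q ^ (n - i)))"
  proof (intro prod.cong refl)
    fix i assume "i \<in> {..<k}"
    then have "real q ^ n = real q ^ i * real q ^ (n - i)" using assms by (simp flip: power_add)
    then show "real q ^ n - real q ^ i = real q ^ n * (1 - 1 / real q ^ (n - i))"
      using assms by (simp add: field_simps)
  qed
  finally show ?thesis by (simp add: prod.distrib power_mult)
qed

text \<open>Extracts the leading powers from \<open>gbin_qfalling\<close>. The product on the right
  is close to 1 when n is large compared with k, so only \<open>qprod\<close> keeps
  \<open>gbin\<close> from being a pure power.\<close>

lemma gbin_qprod:
  assumes "2 \<le> q" "k \<le> n"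
  shows "real (gbin q n k) * qprod (real q) k = real q ^ (k * (n - k)) * (\<Prod>i<k. 1 - 1 / real q ^ (n - i))"
proof -
  have "(\<Prod>i<k. 1 - 1 / real q ^ (k - i)) = qprod (real q) k"
  proof -
    have "(\<Prod>i<k. 1 - 1 / real q ^ (k - i)) = (\<Prod>i<k. 1 - 1 / real q ^ Suc (k - Suc i))"
      by (intro prod.cong) (auto simp: Suc_diff_Suc simp del: power_Suc)
    also have "\<dots> = qprod (real q) k"
      unfolding qprod_def by (rule prod.nat_diff_reindex)
    finally show ?thesis .
  qed
  then have "real (gbin q n k) * (real q ^ (k * k) * qprod (real q) k) =
      real q ^ (n * k) * (\<Prod>i<k. 1 - 1 / real q ^ (n - i))"
    using arg_cong[OF gbin_qfalling[of q n k], of real_of_int] assms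
    by (simp add: real_qfalling)
  moreover have "real q ^ (n * k) = real q ^ (k * k) * real q ^ (k * (n - k))"
    using assms by (simp add: algebra_simps diff_mult_distrib2 flip: power_add)
  ultimately have "real q ^ (k * k) * (real (gbin q n k) * qprod (real q) k) =
     real q ^ (k * k) * (real q ^ (k * (n - k)) * (\<Prod>i<k. 1 - 1 / real q ^ (n - i)))"
    by (simp only: mult_ac)
  then show ?thesis using assms by simp
qed

lemma prod_one_minus_bounds:
  assumes "2 \<le> q" "k \<le> n"
  shows "1 - real k / real q ^ (n - k + 1) \<le> (\<Prod>i<k. 1 - 1 / real q ^ (n - i))"
    and "(\<Prod>i<k. 1 - 1 / real q ^ (n - i)) \<le> 1"
proof -
  define y where "y = 1 / real q ^ (n - k + 1)"
  have "1 \<le> real q ^ (n - k + 1)" using assms by (intro one_le_power) simp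
  then have y: "0 \<le> y" "y \<le> 1" by (auto simp: y_def)
  have f: "1 - y \<le> 1 - 1 / real q ^ (n - i)" "1 - 1 / real q ^ (n - i) \<le> 1" if "i < k" for i
  proof -
    have "real q ^ (n - k + 1) \<le> real q ^ (n - i)" using assms that by (intro power_increasing) auto
    then show "1 - y \<le> 1 - 1 / real q ^ (n - i)" using assms by (simp add: y_def frac_le)
  qed simp
  have "1 - real k * y \<le> (1 - y) ^ k" using Bernoulli_inequality[of "- y" k] y by simp
  also have "\<dots> = (\<Prod>i<k. 1 - y)" by simp
  also have "\<dots> \<le> (\<Prod>i<k. 1 - 1 / real q ^ (n - i))" using f y by (intro prod_mono) auto
  finally show "1 - real k / real q ^ (n - k + 1) \<le> (\<Prod>i<k. 1 - 1 / real q ^ (n - i))" by (simp add: y_def)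
  show "(\<Prod>i<k. 1 - 1 / real q ^ (n - i)) \<le> 1"
  proof (rule prod_le_1)
    fix i assume "i \<in> {..<k}"
    then show "0 \<le> 1 - 1 / real q ^ (n - i) \<and> 1 - 1 / real q ^ (n - i) \<le> 1" using f[of i] y by simp
  qed
qed

lemma gbin_Suc_Suc_absorb:
  assumes "2 \<le> q"
  shows "int (gbin q (Suc n) (Suc k)) * (int q ^ Suc k - 1) = (int q ^ Suc n - 1) * int (gbin q n k)"
proof (cases "k \<le> n")
  case True
  have "(int (gbin q (Suc n) (Suc k)) * (int q ^ Suc k - 1)) * (int q ^ k * qfalling q k k) =
        int (gbin q (Suc n) (Suc k)) * qfalling q (Suc k) (Suc k)"
    by (simp only: qfalling_Suc_Suc mult_ac)
  also have "\<dots> = (int q ^ Suc n - 1) * int q ^ k * (int (gbin q n k) * qfalling q k k)"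
    unfolding gbin_qfalling by (simp only: qfalling_Suc_Suc)
  finally have "(int (gbin q (Suc n) (Suc k)) * (int q ^ Suc k - 1)) * (int q ^ k * qfalling q k k) =
        ((int q ^ Suc n - 1) * int (gbin q n k)) * (int q ^ k * qfalling q k k)"
    by (simp only: mult_ac)
  moreover have "int q ^ k * qfalling q k k \<noteq> 0"
    using qfalling_pos[OF assms, of k k] assms by simp
  ultimately show ?thesis by (simp only: mult_cancel_right simp_thms)
qed (simp add: gbin_eq_0)

section \<open>Incidence algebras\<close>

definition iconv :: "'a::order set \<Rightarrow> ('a \<Rightarrow> 'a \<Rightarrow> 'r::comm_ring_1) \<Rightarrow> ('a \<Rightarrow> 'a \<Rightarrow> 'r) \<Rightarrow> 'a \<Rightarrow> 'a \<Rightarrow> 'r" where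
  "iconv L f g x y = (\<Sum>z\<in>{z\<in>L. x \<le> z \<and> z \<le> y}. f x z * g z y)"

definition idelta :: "'a \<Rightarrow> 'a \<Rightarrow> 'r::comm_ring_1" where
  "idelta x y = (if x = y then 1 else 0)"

text \<open>Functions on all pairs represent elements of the incidence algebra; only their values on
  intervals of L carry meaning.\<close>

definition ieq :: "'a::order set \<Rightarrow> ('a \<Rightarrow> 'a \<Rightarrow> 'r::comm_ring_1) \<Rightarrow> ('a \<Rightarrow> 'a \<Rightarrow> 'r) \<Rightarrow> bool" where
  "ieq L f g \<longleftrightarrow> (\<forall>x\<in>L. \<forall>y\<in>L. x \<le> y \<longrightarrow> f x y = g x y)"

lemma ieqD: "ieq L f g \<Longrightarrow> x \<in> L \<Longrightarrow> y \<in> L \<Longrightarrow> x \<le> y \<Longrightarrow> f x y = g x y"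
  by (simp add: ieq_def)

lemma ieq_trans [trans]: "ieq L f g \<Longrightarrow> ieq L g h \<Longrightarrow> ieq L f h"
  by (simp add: ieq_def)

lemma ieq_sym: "ieq L f g \<Longrightarrow> ieq L g f"
  by (simp add: ieq_def)

lemma iconv_cong:
  assumes "\<And>z. z \<in> L \<Longrightarrow> x \<le> z \<Longrightarrow> z \<le> y \<Longrightarrow> f x z * g z y = f' x z * g' z y"
  shows "iconv L f g x y = iconv L f' g' x y"
  unfolding iconv_def using assms by (intro sum.cong) auto

lemma iconv_ieq: "ieq L f f' \<Longrightarrow> ieq L g g' \<Longrightarrow> ieq L (iconv L f g) (iconv L f' g')"
  by (auto simp: ieq_def intro!: iconv_cong)

lemma iconv_assoc:
  assumes "finite L"
  shows "iconv L (iconv L f g) h x y = iconv L f (iconv L g h) x y"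
proof -
  have fin: "finite {z \<in> L. P z}" for P using assms by simp
  have "iconv L (iconv L f g) h x y =
      (\<Sum>(w, z)\<in>(SIGMA w:{w\<in>L. x \<le> w \<and> w \<le> y}. {z\<in>L. x \<le> z \<and> z \<le> w}). f x z * g z w * h w y)"
    unfolding iconv_def by (simp add: sum_distrib_right sum.Sigma fin)
  also have "\<dots> = (\<Sum>(z, w)\<in>(SIGMA z:{z\<in>L. x \<le> z \<and> z \<le> y}. {w\<in>L. z \<le> w \<and> w \<le> y}). f x z * (g z w * h w y))"
    by (rule sum.reindex_bij_witness[of _ "\<lambda>(z, w). (w, z)" "\<lambda>(z, w). (w, z)"]) (auto simp: mult.assoc)
  also have "\<dots> = iconv L f (iconv L g h) x y"
    unfolding iconv_def by (simp add: sum_distrib_left sum.Sigma fin)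
  finally show ?thesis .
qed

lemma iconv_idelta_left: 
  assumes "finite L" "x \<in> L" "x \<le> y" shows "iconv L idelta f x y = f x y"
proof -
  have "iconv L idelta f x y = (\<Sum>z\<in>{z\<in>L. x \<le> z \<and> z \<le> y}. if x = z then f z y else 0)"
    unfolding iconv_def idelta_def by (intro sum.cong) auto
  then show ?thesis using assms by simp
qed

lemma iconv_idelta_right: 
  assumes "finite L" "y \<in> L" "x \<le> y" shows "iconv L f idelta x y = f x y"
proof -
  have "iconv L f idelta x y = (\<Sum>z\<in>{z\<in>L. x \<le> z \<and> z \<le> y}. if z = y then f x z else 0)"
    unfolding iconv_def idelta_def by (intro sum.cong) auto
  then show ?thesis using assms by simp
qed

lemma iconv_split_left:
  assumes "finite L" "x \<in> L" "x \<le> y"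
  shows "iconv L f g x y = f x x * g x y + (\<Sum>z\<in>{z\<in>L. x < z \<and> z \<le> y}. f x z * g z y)"
proof -
  have "{z\<in>L. x \<le> z \<and> z \<le> y} = insert x {z\<in>L. x < z \<and> z \<le> y}"
    using assms by auto
  then show ?thesis unfolding iconv_def using assms by simp
qed

text \<open>Unitriangularity: splitting off z = x isolates \<open>g x y\<close> from values on the
  shorter intervals from z to y.\<close>

lemma iconv_left_cancel:
  assumes fin: "finite L" and unit: "\<And>x. x \<in> L \<Longrightarrow> f x x = 1"
    and eq: "ieq L (iconv L f g) (iconv L f h)"
  shows "ieq L g h"
proof -
  have "g x y = h x y" if "x \<in> L" "y \<in> L" "x \<le> y" for x y
    using that
  proof (induction "card {z\<in>L. x \<le> z \<and> z \<le> y}" arbitrary: x rule: less_induct)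
    case less
    have "(\<Sum>z\<in>{z\<in>L. x < z \<and> z \<le> y}. f x z * g z y) = (\<Sum>z\<in>{z\<in>L. x < z \<and> z \<le> y}. f x z * h z y)"
    proof (intro sum.cong refl)
      fix z assume z: "z \<in> {z\<in>L. x < z \<and> z \<le> y}"
      have "x \<in> {w\<in>L. x \<le> w \<and> w \<le> y}" "x \<notin> {w\<in>L. z \<le> w \<and> w \<le> y}"
        "{w\<in>L. z \<le> w \<and> w \<le> y} \<subseteq> {w\<in>L. x \<le> w \<and> w \<le> y}"
        using z less.prems by (auto intro: order_trans)
      then have "{w\<in>L. z \<le> w \<and> w \<le> y} \<subset> {w\<in>L. x \<le> w \<and> w \<le> y}" by blast
      then have "g z y = h z y"
        using z less.prems fin by (intro less.hyps psubset_card_mono) auto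
      then show "f x z * g z y = f x z * h z y" by simp
    qed
    moreover have "iconv L f g x y = iconv L f h x y" using eq less.prems by (auto dest: ieqD)
    ultimately show ?case
      using less.prems by (simp add: iconv_split_left fin unit)
  qed
  then show ?thesis by (simp add: ieq_def)
qed

text \<open>Cancels f on the left in f * (g * f) = f.\<close>

lemma iconv_inverse_commute:
  assumes fin: "finite L" and unit: "\<And>x. x \<in> L \<Longrightarrow> f x x = 1"
    and inv: "ieq L (iconv L f g) idelta"
  shows "ieq L (iconv L g f) idelta"
proof (rule iconv_left_cancel[OF fin unit])
  have refl: "ieq L h h" for h :: "'a \<Rightarrow> 'a \<Rightarrow> 'b" by (simp add: ieq_def)
  have "ieq L (iconv L f (iconv L g f)) (iconv L (iconv L f g) f)"
    by (simp add: ieq_def iconv_assoc fin)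
  also have "ieq L \<dots> (iconv L idelta f)" by (rule iconv_ieq[OF inv refl])
  also have "ieq L \<dots> (iconv L f idelta)"
    by (simp add: ieq_def iconv_idelta_left iconv_idelta_right fin)
  finally show "ieq L (iconv L f (iconv L g f)) (iconv L f idelta)" .
qed

section \<open>Reversal of polynomials\<close>

lemma coeff_rev_poly: "coeff (rev_poly r p) i = (if i \<le> r then coeff p (r - i) else 0)"
proof -
  have "coeff (rev_poly r p) i = (\<Sum>j\<le>r. if r - j = i then coeff p j else 0)"
    unfolding rev_poly_def by (simp add: coeff_sum)
  also have "\<dots> = (\<Sum>j\<le>r. if j = r - i then (if i \<le> r then coeff p j else 0) else 0)"
    by (intro sum.cong) auto
  also have "\<dots> = (if i \<le> r then coeff p (r - i) else 0)" by simp
  finally show ?thesis .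
qed

lemma degree_rev_poly_le: "degree (rev_poly r p) \<le> r"
  by (rule degree_le) (simp add: coeff_rev_poly)

lemma rev_poly_sum: "rev_poly r (sum f A) = (\<Sum>a\<in>A. rev_poly r (f a))"
  by (simp add: poly_eq_iff coeff_rev_poly coeff_sum)

lemma rev_poly_monom: "k \<le> r \<Longrightarrow> rev_poly r (monom c k) = monom c (r - k)"
  by (auto simp: poly_eq_iff coeff_rev_poly)

lemma rev_poly_0_left: "rev_poly 0 p = [:coeff p 0:]"
  by (auto simp: rev_poly_def monom_0)

lemma rev_poly_one: "rev_poly r 1 = monom 1 r"
  using rev_poly_monom[of 0 r 1] by simp

lemma rev_poly_eq_reflect_poly:
  "degree p \<le> r \<Longrightarrow> rev_poly r p = monom 1 (r - degree p) * reflect_poly p"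
  by (auto simp: poly_eq_iff coeff_rev_poly coeff_monom_mult coeff_reflect_poly coeff_eq_0)

lemma rev_poly_mult:
  assumes "degree p \<le> a" "degree q \<le> b"
  shows "rev_poly (a + b) (p * q) = rev_poly a p * rev_poly b q"
proof (cases "p = 0 \<or> q = 0")
  case True
  then show ?thesis by (auto simp: rev_poly_def)
next
  case False
  have d: "degree (p * q) = degree p + degree q" using False by (simp add: degree_mult_eq)
  have "rev_poly (a + b) (p * q) = monom 1 (a + b - (degree p + degree q)) * (reflect_poly p * reflect_poly q)"
    using assms d by (simp add: rev_poly_eq_reflect_poly reflect_poly_mult)
  also have "monom 1 (a + b - (degree p + degree q)) = monom 1 (a - degree p) * (monom 1 (b - degree q) :: int poly)"
    using assms by (simp add: mult_monom)
  finally show ?thesis using assms by (simp add: rev_poly_eq_reflect_poly mult_ac)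
qed

lemma degree_iconv_le:
  assumes "x \<in> L" "y \<in> L" "finite L"
    and "\<And>z. z \<in> L \<Longrightarrow> x \<le> z \<Longrightarrow> z \<le> y \<Longrightarrow> degree (f x z) + degree (g z y) \<le> (n::nat)"
  shows "degree (iconv L f g x y) \<le> n"
  unfolding iconv_def using assms
  by (intro degree_sum_le) (auto intro: order_trans[OF degree_mult_le])

text \<open>Below r/2 the left side of the equation vanishes, so p must be minus the lower half of
  S. Antisymmetry makes its reversal the upper half, and kills the middle coefficient, which would
  belong to neither. This is what makes the definite description in \<open>kl_poly\<close>
  meaningful.\<close>

lemma ex1_half_degree:
  assumes r: "0 < r" and rev: "rev_poly r S = - S" and deg: "degree S \<le> r"
  shows "\<exists>!p. 2 * degree p < r \<and> rev_poly r p = p + S"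
proof -
  have anti: "coeff S (r - i) = - coeff S i" if "i \<le> r" for i
    using arg_cong[OF rev, of "\<lambda>p. coeff p i"] that by (simp add: coeff_rev_poly)
  define p where "p = (\<Sum>i\<in>{i. 2 * i < r}. monom (- coeff S i) i)"
  have fin: "finite {i. 2 * i < r}" by (rule finite_subset[of _ "{..r}"]) auto
  have cp: "coeff p i = (if 2 * i < r then - coeff S i else 0)" for i
    unfolding p_def by (simp add: coeff_sum fin)
  have "degree p \<le> (r - 1) div 2" by (rule degree_le) (auto simp: cp)
  then have d: "2 * degree p < r" using r by auto
  have e: "rev_poly r p = p + S"
  proof (rule poly_eqI)
    fix i
    consider "i > r" | "i \<le> r" "2 * i < r" | "i \<le> r" "2 * i = r" | "i \<le> r" "2 * i > r" by linarith
    then show "coeff (rev_poly r p) i = coeff (p + S) i"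
    proof cases
      case 1
      then show ?thesis using deg by (simp add: coeff_rev_poly cp coeff_eq_0)
    next
      case 3
      then have "r - i = i" by simp
      then have "coeff S i = 0" using anti[of i] 3 by simp
      then show ?thesis using 3 by (simp add: coeff_rev_poly cp)
    next
      case 4
      then show ?thesis using anti[of i] by (simp add: coeff_rev_poly cp)
    qed (simp add: coeff_rev_poly cp)
  qed
  show ?thesis
  proof (rule ex1I[of _ p], use d e in simp)
    fix p' assume p': "2 * degree p' < r \<and> rev_poly r p' = p' + S"
    show "p' = p"
    proof (rule poly_eqI)
      fix i
      show "coeff p' i = coeff p i"
      proof (cases "2 * i < r")
        case True
        have "coeff p' i + coeff S i = coeff p' (r - i)"
          using arg_cong[OF conjunct2[OF p'], of "\<lambda>p. coeff p i"] True by (simp add: coeff_rev_poly)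
        also have "\<dots> = 0" using p' True by (intro coeff_eq_0) auto
        finally show ?thesis using True by (simp add: cp)
      next
        case False
        then show ?thesis using p' by (auto simp: cp intro!: coeff_eq_0)
      qed
    qed
  qed
qed

section \<open>Self-duality of inverse Kazhdan--Lusztig polynomials\<close>

text \<open>The restriction to G contracted by F. The recursions for both kinds of Kazhdan-Lusztig
  polynomials stay within such minors, so they become statements about all intervals of one
  lattice.\<close>

definition minor :: "'e pre_matroid \<Rightarrow> 'e set \<Rightarrow> 'e set \<Rightarrow> 'e pre_matroid" where
  "minor M F G = Pre_Matroid (G - F) (\<lambda>A. rk M (A \<union> F) - rk M F)"

lemma moebius_refl [simp]: "moebius L X X = 1"
  by (subst moebius.simps) simp

locale loopless_matroid =
  fixes M :: "'e pre_matroid"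
  assumes M: "matroid M" and loopless: "e \<in> ground M \<Longrightarrow> 0 < rk M {e}"
begin

abbreviation "E \<equiv> ground M"
abbreviation "r \<equiv> rk M"
abbreviation "L \<equiv> flats M"

lemma finite_E: "finite E"
  using M unfolding matroid_def by (elim conjE)

lemma r_mono: "A \<subseteq> B \<Longrightarrow> B \<subseteq> E \<Longrightarrow> r A \<le> r B"
proof -
  have "\<forall>A B. A \<subseteq> B \<and> B \<subseteq> E \<longrightarrow> r A \<le> r B" using M unfolding matroid_def by (elim conjE)
  then show "A \<subseteq> B \<Longrightarrow> B \<subseteq> E \<Longrightarrow> r A \<le> r B" by (elim allE[of _ A] allE[of _ B] impE conjI)
qed

lemma r_empty: "r {} = 0"
proof -
  have "\<forall>A. A \<subseteq> E \<longrightarrow> r A \<le> card A" using M unfolding matroid_def by (elim conjE)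
  then have "r {} \<le> card ({} :: 'e set)" by (elim allE[of _ "{}"] impE) simp
  then show ?thesis by simp
qed

lemma r_submodular: "A \<subseteq> E \<Longrightarrow> B \<subseteq> E \<Longrightarrow> r (A \<union> B) + r (A \<inter> B) \<le> r A + r B"
proof -
  have "\<forall>A B. A \<subseteq> E \<and> B \<subseteq> E \<longrightarrow> r (A \<union> B) + r (A \<inter> B) \<le> r A + r B"
    using M unfolding matroid_def by (elim conjE)
  then show "A \<subseteq> E \<Longrightarrow> B \<subseteq> E \<Longrightarrow> r (A \<union> B) + r (A \<inter> B) \<le> r A + r B"
    by (elim allE[of _ A] allE[of _ B] impE conjI)
qed

lemma flatD: "F \<in> L \<Longrightarrow> F \<subseteq> E"
  by (simp add: flats_def)

lemma finite_L: "finite L"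
  by (rule finite_subset[of _ "Pow E"]) (use finite_E in \<open>auto simp: flats_def\<close>)

lemma empty_flat: "{} \<in> L"
  by (simp add: flats_def r_empty loopless)

text \<open>Submodularity: an element raises the rank of A at least as much as that of the larger
  set F.\<close>

lemma flat_insert_less:
  assumes F: "F \<in> L" and e: "e \<in> E - F" and A: "A \<subseteq> F"
  shows "r A < r (insert e A)"
proof -
  have "insert e A \<union> F = insert e F" "insert e A \<inter> F = A" using e A by auto
  then have "r (insert e F) + r A \<le> r (insert e A) + r F"
    using r_submodular[of "insert e A" F] flatD[OF F] e A by auto
  moreover have "r F < r (insert e F)" using F e by (simp add: flats_def)
  ultimately show ?thesis by simp
qed

lemma flat_strict_mono:
  assumes "F \<in> L" "F \<subset> G" "G \<subseteq> E" shows "r F < r G"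
proof -
  obtain e where e: "e \<in> G - F" using assms by auto
  have "r F < r (insert e F)" using flat_insert_less[of F e F] e assms by auto
  also have "\<dots> \<le> r G" using e assms by (intro r_mono) auto
  finally show ?thesis .
qed

lemma flat_mono: "F \<in> L \<Longrightarrow> G \<in> L \<Longrightarrow> F \<subseteq> G \<Longrightarrow> r F \<le> r G"
  by (intro r_mono flatD)

lemma rk_minor: "rk (minor M F G) A = r (A \<union> F) - r F"
  and ground_minor: "ground (minor M F G) = G - F"
  by (simp_all add: minor_def)

section \<open>Intervals of the lattice of flats\<close>

lemma flats_minor:
  assumes F: "F \<in> L" and G: "G \<in> L" and FG: "F \<subseteq> G"
  shows "flats (minor M F G) = (\<lambda>H. H - F) ` {H\<in>L. F \<subseteq> H \<and> H \<subseteq> G}"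
proof (intro equalityI subsetI)
  fix A assume A: "A \<in> flats (minor M F G)"
  then have AG: "A \<subseteq> G - F" by (simp add: flats_def ground_minor)
  have "r (A \<union> F) < r (insert e (A \<union> F))" if e: "e \<in> E - (A \<union> F)" for e
  proof (cases "e \<in> G")
    case True
    then have "r (A \<union> F) - r F < r (insert e A \<union> F) - r F"
      using A e unfolding flats_def ground_minor rk_minor by auto
    then show ?thesis by simp
  next
    case False
    then show ?thesis using e AG FG by (intro flat_insert_less[OF G]) auto
  qed
  then have "A \<union> F \<in> L" using flatD[OF G] FG AG unfolding flats_def by auto
  moreover have "A = (A \<union> F) - F" using AG by auto
  ultimately show "A \<in> (\<lambda>H. H - F) ` {H\<in>L. F \<subseteq> H \<and> H \<subseteq> G}" using AG FG by blast
next
  fix A assume "A \<in> (\<lambda>H. H - F) ` {H\<in>L. F \<subseteq> H \<and> H \<subseteq> G}"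
  then obtain H where H: "A = H - F" "H \<in> L" "F \<subseteq> H" "H \<subseteq> G" by auto
  have HF: "H - F \<union> F = H" using H by auto
  have "r H - r F < r (insert e (H - F) \<union> F) - r F" if "e \<in> G - F - (H - F)" for e
  proof -
    have "r H < r (insert e H)" using H that flatD[OF G] by (intro flat_insert_less[OF H(2)]) auto
    moreover have "r F \<le> r H" using flat_mono[OF F H(2,3)] .
    moreover have "insert e (H - F) \<union> F = insert e H" using H by auto
    ultimately show ?thesis by simp
  qed
  then show "A \<in> flats (minor M F G)" using H HF by (auto simp: flats_def ground_minor rk_minor)
qed

lemma restriction_minor: "restriction (minor M F G) (H - F) = minor M F H"
  by (simp add: restriction_def minor_def)

lemma contraction_minor:
  assumes "F \<in> L" "H \<in> L" "F \<subseteq> H"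
  shows "contraction (minor M F G) (H - F) = minor M H G"
proof -
  have HF: "H - F \<union> F = H" "A \<union> (H - F) \<union> F = A \<union> H" for A using assms by auto
  have "r F \<le> r H" using flat_mono assms by simp
  then have "(\<lambda>A. r (A \<union> (H - F) \<union> F) - r F - (r (H - F \<union> F) - r F)) = (\<lambda>A. r (A \<union> H) - r H)"
    unfolding HF by auto
  moreover have "G - F - (H - F) = G - H" using assms by auto
  ultimately show ?thesis by (simp add: contraction_def minor_def)
qed

lemma moebius_minor:
  assumes F: "F \<in> L" and G: "G \<in> L" and H: "H \<in> L" "F \<subseteq> H" "H \<subseteq> G"
  shows "moebius (flats (minor M F G)) {} (H - F) = moebius L F H"
  using H
proof (induction "card H" arbitrary: H rule: less_induct)
  case less
  have fin: "finite H" using flatD less.prems finite_E finite_subset by blast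
  have FG: "F \<subseteq> G" using less.prems by simp
  show ?case
  proof (cases "F = H")
    case True
    then show ?thesis by simp
  next
    case False
    then have sub: "F \<subset> H" "{} \<subset> H - F" using less.prems by auto
    have im: "{Z \<in> flats (minor M F G). {} \<subseteq> Z \<and> Z \<subset> H - F} = (\<lambda>Z. Z - F) ` {Z\<in>L. F \<subseteq> Z \<and> Z \<subset> H}"
      unfolding flats_minor[OF F G FG]
    proof (intro equalityI subsetI)
      fix A assume "A \<in> {Z \<in> (\<lambda>H. H - F) ` {H \<in> L. F \<subseteq> H \<and> H \<subseteq> G}. {} \<subseteq> Z \<and> Z \<subset> H - F}"
      then obtain Z where Z: "A = Z - F" "Z \<in> L" "F \<subseteq> Z" "Z - F \<subset> H - F" by blast
      then have "Z \<subset> H" using less.prems by blast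
      then show "A \<in> (\<lambda>Z. Z - F) ` {Z\<in>L. F \<subseteq> Z \<and> Z \<subset> H}" using Z by blast
    next
      fix A assume "A \<in> (\<lambda>Z. Z - F) ` {Z\<in>L. F \<subseteq> Z \<and> Z \<subset> H}"
      then obtain Z where Z: "A = Z - F" "Z \<in> L" "F \<subseteq> Z" "Z \<subset> H" by blast
      then have "Z - F \<subset> H - F" "Z \<subseteq> G" using less.prems by blast+
      then show "A \<in> {Z \<in> (\<lambda>H. H - F) ` {H \<in> L. F \<subseteq> H \<and> H \<subseteq> G}. {} \<subseteq> Z \<and> Z \<subset> H - F}"
        using Z by blast
    qed
    have inj: "inj_on (\<lambda>Z. Z - F) {Z\<in>L. F \<subseteq> Z \<and> Z \<subset> H}" by (auto simp: inj_on_def)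
    have "(\<Sum>Z\<in>{Z \<in> flats (minor M F G). {} \<subseteq> Z \<and> Z \<subset> H - F}. moebius (flats (minor M F G)) {} Z) =
        (\<Sum>Z\<in>{Z\<in>L. F \<subseteq> Z \<and> Z \<subset> H}. moebius (flats (minor M F G)) {} (Z - F))"
      unfolding im by (subst sum.reindex[OF inj]) simp
    also have "\<dots> = (\<Sum>Z\<in>{Z\<in>L. F \<subseteq> Z \<and> Z \<subset> H}. moebius L F Z)"
      using less.prems fin by (intro sum.cong refl less.hyps psubset_card_mono) auto
    finally have sums: "(\<Sum>Z\<in>{Z \<in> flats (minor M F G). {} \<subseteq> Z \<and> Z \<subset> H - F}. moebius (flats (minor M F G)) {} Z) =
        (\<Sum>Z\<in>{Z\<in>L. F \<subseteq> Z \<and> Z \<subset> H}. moebius L F Z)" .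
    have "{} \<noteq> H - F" "finite (H - F) \<and> {} \<subset> H - F" "F \<noteq> H" "finite H \<and> F \<subset> H" using sub fin by auto
    then show ?thesis
      unfolding moebius.simps[of _ "{}" "H - F"] moebius.simps[of L F H] sums
      by (simp only: if_False if_True simp_thms)
  qed
qed

section \<open>The incidence algebra of the lattice of flats\<close>

definition mu :: "'e set \<Rightarrow> 'e set \<Rightarrow> int poly" where "mu F G = [:moebius L F G:]"
definition zt :: "'e set \<Rightarrow> 'e set \<Rightarrow> int poly" where "zt F G = 1"
text \<open>The reversal of the zeta function, see \<open>bar_zt\<close>; hence \<open>chi\<close>
  is mu times reversed zeta.\<close>

definition ztb :: "'e set \<Rightarrow> 'e set \<Rightarrow> int poly" where "ztb F G = monom 1 (r G - r F)"
definition chi :: "'e set \<Rightarrow> 'e set \<Rightarrow> int poly" where "chi = iconv L mu ztb"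
definition kl :: "'e set \<Rightarrow> 'e set \<Rightarrow> int poly" where "kl F G = kl_poly (minor M F G)"
text \<open>The sign turns the recursion for inverse Kazhdan-Lusztig polynomials into the statement
  that \<open>ikl\<close> is inverse to \<open>kl\<close>.\<close>

definition ikl :: "'e set \<Rightarrow> 'e set \<Rightarrow> int poly" where
  "ikl F G = (-1) ^ (r G - r F) * inv_kl_poly (minor M F G)"
definition bar :: "('e set \<Rightarrow> 'e set \<Rightarrow> int poly) \<Rightarrow> 'e set \<Rightarrow> 'e set \<Rightarrow> int poly" where
  "bar f F G = rev_poly (r G - r F) (f F G)"
definition rank_bounded :: "('e set \<Rightarrow> 'e set \<Rightarrow> int poly) \<Rightarrow> bool" where
  "rank_bounded f \<longleftrightarrow> (\<forall>F\<in>L. \<forall>G\<in>L. F \<subseteq> G \<longrightarrow> degree (f F G) \<le> r G - r F)"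

lemma rank_boundedD: "rank_bounded f \<Longrightarrow> F \<in> L \<Longrightarrow> G \<in> L \<Longrightarrow> F \<subseteq> G \<Longrightarrow> degree (f F G) \<le> r G - r F"
  by (simp add: rank_bounded_def)

lemma rank_bounded_iconv:
  assumes "rank_bounded f" "rank_bounded g" shows "rank_bounded (iconv L f g)"
proof -
  have "degree (f F H) + degree (g H G) \<le> r G - r F"
    if "F \<in> L" "G \<in> L" "H \<in> L" "F \<subseteq> H" "H \<subseteq> G" for F G H
    using rank_boundedD[OF assms(1) that(1,3,4)] rank_boundedD[OF assms(2) that(3,2,5)]
      flat_mono[OF that(1,3,4)] flat_mono[OF that(3,2,5)] by linarith
  then show ?thesis unfolding rank_bounded_def using finite_L by (auto intro!: degree_iconv_le)
qed

lemma bar_iconv: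
  assumes f: "rank_bounded f" and g: "rank_bounded g"
  shows "ieq L (bar (iconv L f g)) (iconv L (bar f) (bar g))"
proof -
  have "rev_poly (r G - r F) (f F H * g H G) = rev_poly (r H - r F) (f F H) * rev_poly (r G - r H) (g H G)"
    if "F \<in> L" "G \<in> L" "H \<in> L" "F \<subseteq> H" "H \<subseteq> G" for F G H
  proof -
    have "r G - r F = (r H - r F) + (r G - r H)"
      using flat_mono[OF that(1,3,4)] flat_mono[OF that(3,2,5)] by simp
    then show ?thesis
      using rank_boundedD[OF f that(1,3,4)] rank_boundedD[OF g that(3,2,5)] by (simp add: rev_poly_mult)
  qed
  then show ?thesis unfolding ieq_def bar_def iconv_def by (auto simp: rev_poly_sum intro!: sum.cong)
qed

lemma rank_bounded_mu: "rank_bounded mu" and rank_bounded_ztb: "rank_bounded ztb"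
  by (auto simp: rank_bounded_def mu_def ztb_def degree_monom_le)

lemma mu_refl: "mu F F = 1"
  by (simp add: mu_def one_pCons)

lemma mu_zt: "ieq L (iconv L mu zt) idelta"
proof -
  have "(\<Sum>H\<in>{H\<in>L. F \<subseteq> H \<and> H \<subseteq> G}. moebius L F H) = (if F = G then 1 else 0)"
    if FG: "F \<in> L" "G \<in> L" "F \<subseteq> G" for F G
  proof (cases "F = G")
    case True
    then have "{H\<in>L. F \<subseteq> H \<and> H \<subseteq> G} = {F}" using FG by auto
    then show ?thesis using True by simp
  next
    case False
    have fin: "finite G" "finite L" using FG flatD finite_E finite_subset finite_L by blast+
    have "{H\<in>L. F \<subseteq> H \<and> H \<subseteq> G} = insert G {H\<in>L. F \<subseteq> H \<and> H \<subset> G}" using FG by auto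
    then have "(\<Sum>H\<in>{H\<in>L. F \<subseteq> H \<and> H \<subseteq> G}. moebius L F H) =
        moebius L F G + (\<Sum>H\<in>{H\<in>L. F \<subseteq> H \<and> H \<subset> G}. moebius L F H)"
      using fin by simp
    also have "moebius L F G = - (\<Sum>H\<in>{H\<in>L. F \<subseteq> H \<and> H \<subset> G}. moebius L F H)"
      using False FG fin by (subst moebius.simps) auto
    finally show ?thesis using False by simp
  qed
  moreover have "(\<Sum>H\<in>A. [:f H:]) = [:\<Sum>H\<in>A. f H:]" for A and f :: "'e set \<Rightarrow> int"
    by (simp add: poly_eq_iff coeff_sum coeff_pCons split: nat.split)
  ultimately show ?thesis
    unfolding ieq_def iconv_def mu_def zt_def idelta_def by (auto simp: one_pCons)
qed

lemma zt_mu: "ieq L (iconv L zt mu) idelta"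
proof -
  have "ieq L (iconv L mu zt) idelta" by (rule mu_zt)
  then show ?thesis by (intro iconv_inverse_commute[OF finite_L mu_refl])
qed

lemma ieq_refl: "ieq L f f" by (simp add: ieq_def)
lemma iconv_assoc': "ieq L (iconv L (iconv L f g) h) (iconv L f (iconv L g h))"
  by (simp add: ieq_def iconv_assoc[OF finite_L])
lemma idelta_iconv: "ieq L (iconv L idelta f) f" and iconv_idelta: "ieq L (iconv L f idelta) f"
  by (simp_all add: ieq_def iconv_idelta_left iconv_idelta_right finite_L)

lemma rank_bounded_chi: "rank_bounded chi"
  unfolding chi_def by (intro rank_bounded_iconv rank_bounded_mu rank_bounded_ztb)

lemma bar_ztb: "ieq L (bar ztb) zt"
  by (simp add: ieq_def bar_def ztb_def zt_def rev_poly_monom)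

lemma bar_ieq: "ieq L f g \<Longrightarrow> ieq L (bar f) (bar g)"
  by (simp add: ieq_def bar_def)

lemma bar_idelta: "ieq L (bar idelta) idelta"
  by (auto simp: ieq_def bar_def idelta_def rev_poly_0_left one_pCons rev_poly_def)

lemma rank_bounded_zt: "rank_bounded zt"
  by (simp add: rank_bounded_def zt_def)

lemma bar_zt: "ieq L (bar zt) ztb"
  by (simp add: ieq_def bar_def zt_def ztb_def rev_poly_one)

text \<open>From chi = mu * bar zeta follows bar chi = bar mu * zeta. In the product, zeta * mu
  cancels, leaving bar mu * bar zeta = bar (mu * zeta). In Stanley's terminology \<open>chi\<close>
  is a kernel.\<close>

lemma bar_chi_chi: "ieq L (iconv L (bar chi) chi) idelta"
proof -
  have "ieq L (bar chi) (iconv L (bar mu) zt)"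
    unfolding chi_def using bar_iconv[OF rank_bounded_mu rank_bounded_ztb] iconv_ieq[OF ieq_refl bar_ztb]
    by (rule ieq_trans)
  then have "ieq L (iconv L (bar chi) chi) (iconv L (iconv L (bar mu) zt) (iconv L mu ztb))"
    unfolding chi_def[symmetric] by (rule iconv_ieq[OF _ ieq_refl])
  also have "ieq L \<dots> (iconv L (bar mu) (iconv L (iconv L zt mu) ztb))"
    using iconv_assoc' iconv_ieq[OF ieq_refl ieq_sym[OF iconv_assoc']] by (rule ieq_trans)
  also have "ieq L \<dots> (iconv L (bar mu) ztb)"
    using iconv_ieq[OF zt_mu ieq_refl] idelta_iconv by (intro iconv_ieq[OF ieq_refl]) (rule ieq_trans)
  also have "ieq L \<dots> (iconv L (bar mu) (bar zt))"
    by (intro iconv_ieq[OF ieq_refl] ieq_sym[OF bar_zt])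
  also have "ieq L \<dots> (bar (iconv L mu zt))"
    by (intro ieq_sym[OF bar_iconv] rank_bounded_mu rank_bounded_zt)
  also have "ieq L \<dots> (bar idelta)" by (intro bar_ieq mu_zt)
  also have "ieq L \<dots> idelta" by (rule bar_idelta)
  finally show ?thesis .
qed

lemma char_poly_minor:
  assumes "F \<in> L" "G \<in> L" "F \<subseteq> G" shows "char_poly (minor M F G) = chi F G"
proof -
  have inj: "inj_on (\<lambda>Z. Z - F) {H\<in>L. F \<subseteq> H \<and> H \<subseteq> G}" by (auto simp: inj_on_def)
  have "char_poly (minor M F G) = (\<Sum>H\<in>{H\<in>L. F \<subseteq> H \<and> H \<subseteq> G}.
      monom (moebius (flats (minor M F G)) {} (H - F)) (r (G - F \<union> F) - r F - (r (H - F \<union> F) - r F)))"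
    unfolding char_poly_def unfolding flats_minor[OF assms]
    by (subst sum.reindex[OF inj]) (simp add: rk_minor ground_minor)
  also have "\<dots> = (\<Sum>H\<in>{H\<in>L. F \<subseteq> H \<and> H \<subseteq> G}. mu F H * ztb H G)"
  proof (intro sum.cong refl)
    fix H assume H: "H \<in> {H\<in>L. F \<subseteq> H \<and> H \<subseteq> G}"
    then have e: "G - F \<union> F = G" "H - F \<union> F = H" using assms by auto
    have d: "r G - r F - (r H - r F) = r G - r H" using H flat_mono[of F H] assms by auto
    show "monom (moebius (flats (minor M F G)) {} (H - F)) (r (G - F \<union> F) - r F - (r (H - F \<union> F) - r F)) = mu F H * ztb H G"
      unfolding e d using H assms by (simp add: moebius_minor mu_def ztb_def smult_monom)
  qed
  finally show ?thesis by (simp add: chi_def iconv_def)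
qed

lemma chi_refl: "F \<in> L \<Longrightarrow> chi F F = 1"
proof -
  assume "F \<in> L"
  then have "{H\<in>L. F \<le> H \<and> H \<le> F} = {F}" by auto
  then show ?thesis by (simp add: chi_def iconv_def mu_refl ztb_def)
qed

lemma finite_ground_minor: "G \<in> L \<Longrightarrow> finite (ground (minor M F G))"
  using flatD[of G] finite_E finite_subset by (auto simp: ground_minor)

lemma rank_minor: 
  assumes "F \<subseteq> G" shows "matroid_rank (minor M F G) = r G - r F"
proof -
  have "G - F \<union> F = G" using assms by auto
  then show ?thesis by (simp add: rk_minor ground_minor)
qed

lemma kl_refl: "kl F F = 1"
  unfolding kl_def by (subst kl_poly.simps) (simp add: rank_minor)

lemma sum_flats_minor:
  assumes "F \<in> L" "G \<in> L" "F \<subseteq> G"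
  shows "(\<Sum>A\<in>flats (minor M F G). f A) = (\<Sum>H\<in>{H\<in>L. F \<subseteq> H \<and> H \<subseteq> G}. f (H - F))"
proof -
  have inj: "inj_on (\<lambda>Z. Z - F) {H\<in>L. F \<subseteq> H \<and> H \<subseteq> G}" by (auto simp: inj_on_def)
  show ?thesis unfolding flats_minor[OF assms] by (subst sum.reindex[OF inj]) simp
qed

text \<open>The task is to show that the known part S of the defining sum is antisymmetric, so that
  \<open>ex1_half_degree\<close> applies. By induction the relation holds on all intervals from H to
  G with H above F, which lets the reversal of S be rewritten through the kernel property of
  \<open>chi\<close>.\<close>

lemma kl_spec:
  assumes "F \<in> L" "G \<in> L" "F \<subset> G"
  shows "2 * degree (kl F G) < r G - r F \<and> bar kl F G = iconv L chi kl F G"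
  using assms
proof (induction "card (G - F)" arbitrary: F rule: less_induct)
  case less
  note FG = less.prems
  have FG': "F \<subseteq> G" using FG by auto
  have pos: "0 < r G - r F" using flat_strict_mono[OF FG(1,3) flatD[OF FG(2)]] by simp
  have finG: "finite (G - F)" using flatD[OF FG(2)] finite_E finite_subset by blast
  have IH: "degree (kl H G) \<le> r G - r H \<and> bar kl H G = iconv L chi kl H G"
    if H: "H \<in> L" "F \<subset> H" "H \<subseteq> G" for H
  proof (cases "H = G")
    case True
    then have "{Z\<in>L. H \<le> Z \<and> Z \<le> G} = {G}" using H by auto
    then show ?thesis using True FG by (simp add: kl_refl bar_def iconv_def chi_refl rev_poly_one)
  next
    case False
    have "G - H \<subset> G - F" using H FG by auto
    then have "card (G - H) < card (G - F)" using finG by (intro psubset_card_mono)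
    moreover have "H \<subset> G" using H False by blast
    ultimately show ?thesis using less.hyps[of H] H FG by auto
  qed
  define J where "J = {H\<in>L. F \<subset> H \<and> H \<subseteq> G}"
  define S where "S = (\<Sum>H\<in>J. chi F H * kl H G)"
  have finJ: "finite J" using finite_L by (simp add: J_def)
  have ins: "{H\<in>L. F \<subseteq> H \<and> H \<subseteq> G} = insert F J" "F \<notin> J" using FG by (auto simp: J_def)
  have conv: "iconv L f g F G = f F F * g F G + (\<Sum>H\<in>J. f F H * g H G)" for f g :: "'e set \<Rightarrow> 'e set \<Rightarrow> int poly"
    using iconv_split_left[OF finite_L FG(1), of G f g] FG' by (simp add: J_def less_eq_set_def[symmetric])
  have chikl: "iconv L chi kl F G = kl F G + S"
    unfolding conv S_def using chi_refl FG by simp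
  \<comment> \<open>\<open>c0\<close> is bar chi minus the identity: the omitted diagonal term is
    the one that the induction does not reach. The kernel property then reads c0 * chi = identity -
    chi.\<close>
  define c0 where "c0 = (\<lambda>A B. if A = B then 0 else bar chi A B)"
  have rev: "rev_poly (r G - r F) S = - S"
  proof -
    have "rev_poly (r G - r F) S = (\<Sum>H\<in>J. c0 F H * iconv L chi kl H G)"
      unfolding S_def rev_poly_sum
    proof (intro sum.cong refl)
      fix H assume "H \<in> J"
      then have H: "H \<in> L" "F \<subset> H" "F \<subseteq> H" "H \<subseteq> G" by (auto simp: J_def)
      have "r G - r F = (r H - r F) + (r G - r H)"
        using flat_mono[OF FG(1) H(1,3)] flat_mono[OF H(1) FG(2) H(4)] by simp
      then have "rev_poly (r G - r F) (chi F H * kl H G) = bar chi F H * bar kl H G"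
        unfolding bar_def using IH[OF H(1,2,4)] rank_boundedD[OF rank_bounded_chi FG(1) H(1,3)]
        by (simp add: rev_poly_mult)
      then show "rev_poly (r G - r F) (chi F H * kl H G) = c0 F H * iconv L chi kl H G"
        using IH[OF H(1,2,4)] H by (auto simp: c0_def)
    qed
    also have "\<dots> = iconv L c0 (iconv L chi kl) F G"
      unfolding conv by (simp add: c0_def)
    also have "\<dots> = iconv L (iconv L c0 chi) kl F G"
      by (simp add: iconv_assoc[OF finite_L])
    also have "\<dots> = iconv L (\<lambda>A B. idelta A B - chi A B) kl F G"
    proof (rule iconv_cong)
      fix H assume H: "H \<in> L" "F \<le> H" "H \<le> G"
      have "(\<Sum>Z\<in>{Z\<in>L. F < Z \<and> Z \<le> H}. c0 F Z * chi Z H) = (\<Sum>Z\<in>{Z\<in>L. F < Z \<and> Z \<le> H}. bar chi F Z * chi Z H)"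
        by (intro sum.cong) (auto simp: c0_def)
      moreover have "bar chi F F = 1" "c0 F F = 0" using chi_refl[OF FG(1)]
        by (simp_all add: bar_def c0_def rev_poly_one)
      ultimately have "iconv L (bar chi) chi F H = iconv L c0 chi F H + chi F H"
        unfolding iconv_split_left[OF finite_L FG(1) H(2)] by simp
      moreover have "iconv L (bar chi) chi F H = idelta F H"
        using bar_chi_chi FG(1) H by (simp add: ieq_def)
      ultimately show "iconv L c0 chi F H * kl H G = (idelta F H - chi F H) * kl H G" by simp
    qed
    also have "\<dots> = iconv L idelta kl F G - iconv L chi kl F G"
      by (simp add: iconv_def left_diff_distrib sum_subtractf)
    \<comment> \<open>The value \<open>kl F G\<close> being determined occurs in both convolutions
      and cancels.\<close>
    also have "\<dots> = - S"
      using FG' FG by (simp add: chikl iconv_idelta_left finite_L)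
    finally show ?thesis .
  qed
  have degS: "degree S \<le> r G - r F"
  proof -
    have "S = - rev_poly (r G - r F) S" using rev by simp
    then show ?thesis using degree_rev_poly_le[of "r G - r F" S] by (metis degree_minus)
  qed
  have kl_eq: "kl F G = (THE p. 2 * degree p < r G - r F \<and> rev_poly (r G - r F) p = p + S)"
  proof -
    have "(\<Sum>A\<in>flats (minor M F G). char_poly (restriction (minor M F G) A) *
                (if A = {} then p else kl_poly (contraction (minor M F G) A))) = p + S" for p
    proof -
      have "(\<Sum>A\<in>flats (minor M F G). char_poly (restriction (minor M F G) A) *
                (if A = {} then p else kl_poly (contraction (minor M F G) A))) =
            (\<Sum>H\<in>insert F J. chi F H * (if H = F then p else kl H G))"
        unfolding sum_flats_minor[OF FG(1,2) FG'] ins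
      proof (intro sum.cong refl)
        fix H assume "H \<in> insert F J"
        then have H: "H \<in> L" "F \<subseteq> H" "H \<subseteq> G" using FG by (auto simp: J_def)
        then have "H - F = {} \<longleftrightarrow> H = F" by auto
        then show "char_poly (restriction (minor M F G) (H - F)) *
            (if H - F = {} then p else kl_poly (contraction (minor M F G) (H - F))) =
            chi F H * (if H = F then p else kl H G)"
          using H FG by (simp add: restriction_minor contraction_minor char_poly_minor kl_def)
      qed
      also have "\<dots> = chi F F * p + (\<Sum>H\<in>J. chi F H * (if H = F then p else kl H G))"
        using finJ ins(2) by simp
      also have "(\<Sum>H\<in>J. chi F H * (if H = F then p else kl H G)) = S"
        unfolding S_def using ins(2) by (intro sum.cong) auto
      finally show ?thesis using FG by (simp add: chi_refl)
    qed
    then show ?thesis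
      unfolding kl_def using pos by (subst kl_poly.simps) (simp add: rank_minor[OF FG'] finite_ground_minor[OF FG(2)])
  qed
  have "2 * degree (kl F G) < r G - r F \<and> rev_poly (r G - r F) (kl F G) = kl F G + S"
    unfolding kl_eq by (rule theI') (rule ex1_half_degree[OF pos rev degS])
  then show ?case by (simp add: bar_def chikl)
qed

lemma ikl_refl: "ikl F F = 1"
  unfolding ikl_def by (subst inv_kl_poly.simps) (simp add: rank_minor)

lemma kl_ikl: "ieq L (iconv L kl ikl) idelta"
proof -
  have "iconv L kl ikl F G = idelta F G" if FG: "F \<in> L" "G \<in> L" "F \<subseteq> G" for F G
  proof (cases "F = G")
    case True
    then have "{H\<in>L. F \<le> H \<and> H \<le> G} = {F}" using FG by auto
    then show ?thesis using True by (simp add: iconv_def kl_refl ikl_refl idelta_def)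
  next
    case False
    then have sub: "F \<subset> G" using FG by auto
    have pos: "0 < r G - r F" using flat_strict_mono[OF FG(1) sub flatD[OF FG(2)]] by simp
    define J where "J = {H\<in>L. F < H \<and> H \<le> G}"
    have "flats (minor M F G) - {{}} = (\<lambda>H. H - F) ` J"
      unfolding flats_minor[OF FG] J_def by auto
    moreover have "inj_on (\<lambda>H. H - F) J" by (auto simp: inj_on_def J_def)
    ultimately have reidx: "(\<Sum>A\<in>flats (minor M F G) - {{}}. f A) = (\<Sum>H\<in>J. f (H - F))" for f :: "'e set \<Rightarrow> int poly"
      by (simp add: sum.reindex)
    have "ikl F G = (-1) ^ (r G - r F) * (\<Sum>H\<in>J. (-1) ^ (rk (minor M F G) (H - F) + 1) *
           kl_poly (restriction (minor M F G) (H - F)) * inv_kl_poly (contraction (minor M F G) (H - F)))"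
      unfolding ikl_def using pos
      by (subst inv_kl_poly.simps) (simp add: rank_minor[OF FG(3)] finite_ground_minor[OF FG(2)] reidx)
    also have "\<dots> = (\<Sum>H\<in>J. - (kl F H * ikl H G))"
      unfolding sum_distrib_left
    proof (intro sum.cong refl)
      fix H assume "H \<in> J"
      then have H: "H \<in> L" "F \<subseteq> H" "H \<subseteq> G" by (auto simp: J_def)
      have e: "H \<union> F = H" using H by auto
      have "r G - r F = (r H - r F) + (r G - r H)"
        using flat_mono[OF FG(1) H(1,2)] flat_mono[OF H(1) FG(2) H(3)] by simp
      then show "(-1) ^ (r G - r F) * ((-1) ^ (rk (minor M F G) (H - F) + 1) *
           kl_poly (restriction (minor M F G) (H - F)) * inv_kl_poly (contraction (minor M F G) (H - F))) = - (kl F H * ikl H G)"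
        using H FG by (simp add: rk_minor e restriction_minor contraction_minor kl_def ikl_def power_add)
    qed
    finally show ?thesis
      using iconv_split_left[OF finite_L FG(1), of G kl ikl] FG False
      by (simp add: J_def kl_refl idelta_def sum_negf)
  qed
  then show ?thesis by (simp add: ieq_def)
qed

lemma rank_bounded_kl: "rank_bounded kl"
  unfolding rank_bounded_def
proof (intro ballI impI)
  fix F G assume FG: "F \<in> L" "G \<in> L" "F \<subseteq> G"
  show "degree (kl F G) \<le> r G - r F"
    using kl_spec[OF FG(1,2) psubsetI[OF FG(3)]] by (cases "F = G") (auto simp: kl_refl)
qed

text \<open>In each term of the recursion the factor \<open>kl F H\<close> with H above F supplies
  the strict inequality. This also covers H = G, where \<open>ikl G G = 1\<close> satisfies only the
  weak one.\<close>

lemma degree_ikl: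
  assumes "F \<in> L" "G \<in> L" "F \<subset> G" shows "2 * degree (ikl F G) < r G - r F"
  using assms
proof (induction "card (G - F)" arbitrary: F rule: less_induct)
  case less
  note FG = less.prems
  have pos: "0 < r G - r F" using flat_strict_mono[OF FG(1,3) flatD[OF FG(2)]] by simp
  have finG: "finite (G - F)" using flatD[OF FG(2)] finite_E finite_subset by blast
  define J where "J = {H\<in>L. F < H \<and> H \<le> G}"
  have "iconv L kl ikl F G = 0" using kl_ikl FG by (auto simp: ieq_def idelta_def)
  then have "ikl F G = - (\<Sum>H\<in>J. kl F H * ikl H G)"
    using iconv_split_left[OF finite_L FG(1), of G kl ikl] FG
    by (simp add: J_def kl_refl eq_neg_iff_add_eq_0)
  moreover have "degree (\<Sum>H\<in>J. kl F H * ikl H G) \<le> (r G - r F - 1) div 2"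
  proof (intro degree_sum_le)
    show "finite J" using finite_L by (simp add: J_def)
  next
    fix H assume "H \<in> J"
    then have H: "H \<in> L" "F \<subset> H" "F \<subseteq> H" "H \<subseteq> G" by (auto simp: J_def)
    have mono: "r F \<le> r H" "r H \<le> r G"
      using flat_mono[OF FG(1) H(1,3)] flat_mono[OF H(1) FG(2) H(4)] by auto
    have d1: "2 * degree (kl F H) < r H - r F" using kl_spec[OF FG(1) H(1,2)] by simp
    have d2: "2 * degree (ikl H G) \<le> r G - r H"
    proof (cases "H = G")
      case False
      have "G - H \<subset> G - F" using H FG by auto
      then have "card (G - H) < card (G - F)" using finG by (intro psubset_card_mono)
      then show ?thesis using less.hyps[of H] H FG False by fastforce
    qed (simp add: ikl_refl)
    have "degree (kl F H * ikl H G) \<le> degree (kl F H) + degree (ikl H G)" by (rule degree_mult_le)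
    then show "degree (kl F H * ikl H G) \<le> (r G - r F - 1) div 2" using d1 d2 mono by linarith
  qed
  ultimately have "degree (ikl F G) \<le> (r G - r F - 1) div 2" by simp
  then show ?case using pos by linarith
qed

text \<open>Inverts the relation bar kl = chi * kl: multiplied by \<open>kl\<close> on the right,
  both sides become the identity.\<close>

lemma bar_ikl_chi: "ieq L (iconv L (bar ikl) chi) ikl"
proof -
  have rb: "rank_bounded ikl"
    unfolding rank_bounded_def
  proof (intro ballI impI)
    fix F G assume FG: "F \<in> L" "G \<in> L" "F \<subseteq> G"
    show "degree (ikl F G) \<le> r G - r F"
      using degree_ikl[OF FG(1,2) psubsetI[OF FG(3)]] by (cases "F = G") (auto simp: ikl_refl)
  qed
  have bkl: "ieq L (bar kl) (iconv L chi kl)"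
    unfolding ieq_def
  proof (intro ballI impI)
    fix F G assume FG: "F \<in> L" "G \<in> L" "F \<le> G"
    show "bar kl F G = iconv L chi kl F G"
    proof (cases "F = G")
      case True
      then have "{H\<in>L. F \<le> H \<and> H \<le> G} = {F}" using FG by auto
      then show ?thesis using True FG by (simp add: iconv_def kl_refl chi_refl bar_def rev_poly_one)
    qed (use kl_spec[OF FG(1,2)] FG in auto)
  qed
  have ikl_kl: "ieq L (iconv L ikl kl) idelta"
  proof -
    have "ieq L (iconv L kl ikl) idelta" by (rule kl_ikl)
    then show ?thesis by (intro iconv_inverse_commute[OF finite_L kl_refl])
  qed
  have "ieq L (iconv L (iconv L (bar ikl) chi) kl) (iconv L (bar ikl) (iconv L chi kl))"
    by (rule iconv_assoc')
  also have "ieq L \<dots> (iconv L (bar ikl) (bar kl))"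
    by (intro iconv_ieq[OF ieq_refl] ieq_sym[OF bkl])
  also have "ieq L \<dots> (bar (iconv L ikl kl))"
    by (intro ieq_sym[OF bar_iconv] rb rank_bounded_kl)
  also have "ieq L \<dots> (bar idelta)" by (intro bar_ieq ikl_kl)
  also have "ieq L \<dots> idelta" by (rule bar_idelta)
  finally have a: "ieq L (iconv L (iconv L (bar ikl) chi) kl) idelta" .
  have "ieq L (iconv L (bar ikl) chi) (iconv L (iconv L (bar ikl) chi) (iconv L kl ikl))"
    using ieq_sym[OF iconv_idelta] iconv_ieq[OF ieq_refl ieq_sym[OF kl_ikl]] by (rule ieq_trans)
  also have "ieq L \<dots> (iconv L (iconv L (iconv L (bar ikl) chi) kl) ikl)"
    by (rule ieq_sym[OF iconv_assoc'])
  also have "ieq L \<dots> (iconv L idelta ikl)" by (intro iconv_ieq[OF a ieq_refl])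
  also have "ieq L \<dots> ikl" by (rule idelta_iconv)
  finally show ?thesis .
qed

definition signed_ikl :: "'e set \<Rightarrow> int poly" where
  "signed_ikl F = (-1) ^ r F * inv_kl_poly (restriction M F)"

lemma signed_ikl_eq: "signed_ikl F = ikl {} F"
  by (simp add: signed_ikl_def ikl_def minor_def restriction_def r_empty)

lemma signed_ikl_empty: "signed_ikl {} = 1"
  by (simp add: signed_ikl_eq ikl_refl)

lemma degree_signed_ikl: "F \<in> L \<Longrightarrow> F \<noteq> {} \<Longrightarrow> 2 * degree (signed_ikl F) < r F"
  using degree_ikl[OF empty_flat, of F] by (auto simp: signed_ikl_eq r_empty)

text \<open>The witness is \<open>y = bar ikl * mu\<close>; the two equations say \<open>bar ikl = y * zt\<close> and \<open>ikl = y * ztb\<close>.\<close>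

lemma signed_ikl_duality:
  obtains y where
    "\<And>G. G \<in> L \<Longrightarrow> rev_poly (r G) (signed_ikl G) = (\<Sum>H\<in>{H\<in>L. H \<subseteq> G}. y H)"
    "\<And>G. G \<in> L \<Longrightarrow> signed_ikl G = (\<Sum>H\<in>{H\<in>L. H \<subseteq> G}. monom 1 (r G - r H) * y H)"
proof
  define y where "y = (\<lambda>H. iconv L (bar ikl) mu {} H)"
  fix G assume G: "G \<in> L"
  have "ieq L (bar ikl) (iconv L (bar ikl) (iconv L mu zt))"
    using ieq_sym[OF iconv_idelta] iconv_ieq[OF ieq_refl ieq_sym[OF mu_zt]] by (rule ieq_trans)
  also have "ieq L \<dots> (iconv L (iconv L (bar ikl) mu) zt)"
    by (rule ieq_sym[OF iconv_assoc'])
  finally have "bar ikl {} G = iconv L (iconv L (bar ikl) mu) zt {} G"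
    using ieqD[OF _ empty_flat G] by auto
  then show "rev_poly (r G) (signed_ikl G) = (\<Sum>H\<in>{H\<in>L. H \<subseteq> G}. y H)"
    by (simp add: bar_def signed_ikl_eq r_empty y_def zt_def iconv_def[of L "iconv L (bar ikl) mu"])
  have "ieq L ikl (iconv L (bar ikl) (iconv L mu ztb))"
    using ieq_sym[OF bar_ikl_chi] unfolding chi_def .
  also have "ieq L \<dots> (iconv L (iconv L (bar ikl) mu) ztb)"
    by (rule ieq_sym[OF iconv_assoc'])
  finally have "ikl {} G = iconv L (iconv L (bar ikl) mu) ztb {} G"
    using ieqD[OF _ empty_flat G] by auto
  then show "signed_ikl G = (\<Sum>H\<in>{H\<in>L. H \<subseteq> G}. monom 1 (r G - r H) * y H)"
    by (simp add: signed_ikl_eq y_def ztb_def iconv_def[of L "iconv L (bar ikl) mu"] mult.commute)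
qed

end

section \<open>Subspaces over a finite field\<close>

locale finite_scalars = vector_space scale
  for scale :: "'f::{field,finite} \<Rightarrow> 'v::ab_group_add \<Rightarrow> 'v"
begin

definition q :: nat where "q = card (UNIV :: 'f set)"

lemma q_ge_2: "2 \<le> q"
proof -
  have "card {0, 1 :: 'f} \<le> q" unfolding q_def by (intro card_mono) auto
  then show ?thesis by simp
qed

section \<open>Dimension by counting vectors\<close>

lemma bij_betw_span_insert:
  assumes "b \<notin> span S"
  shows "bij_betw (\<lambda>(c, v). scale c b + v) (UNIV \<times> span S) (span (insert b S))"
  unfolding bij_betw_def
proof
  show "inj_on (\<lambda>(c, v). scale c b + v) (UNIV \<times> span S)"
  proof (rule inj_onI, clarify)
    fix c v c' v' assume v: "v \<in> span S" "v' \<in> span S" and eq: "scale c b + v = scale c' b + v'"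
    have d: "scale (c - c') b = v' - v" using eq by (simp add: scale_left_diff_distrib algebra_simps)
    have "c = c'"
    proof (rule ccontr)
      assume "c \<noteq> c'"
      then have "b = scale (inverse (c - c')) (v' - v)" by (simp add: d[symmetric])
      then show False using assms v by (metis span_scale span_diff)
    qed
    then show "c = c' \<and> v = v'" using d by simp
  qed
  show "(\<lambda>(c, v). scale c b + v) ` (UNIV \<times> span S) = span (insert b S)"
  proof (intro equalityI subsetI)
    fix x assume "x \<in> (\<lambda>(c, v). scale c b + v) ` (UNIV \<times> span S)"
    then obtain c v where "x = scale c b + v" "v \<in> span S" by auto
    then have "x - scale c b \<in> span S" by simp
    then show "x \<in> span (insert b S)" by (auto simp: span_insert)
  next
    fix x assume "x \<in> span (insert b S)"
    then obtain k where "x - scale k b \<in> span S" by (auto simp: span_insert)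
    then have "(k, x - scale k b) \<in> UNIV \<times> span S" "x = (\<lambda>(c, v). scale c b + v) (k, x - scale k b)" by auto
    then show "x \<in> (\<lambda>(c, v). scale c b + v) ` (UNIV \<times> span S)" by blast
  qed
qed

lemma card_span_insert: "b \<notin> span S \<Longrightarrow> card (span (insert b S)) = q * card (span S)"
  using bij_betw_same_card[OF bij_betw_span_insert, of b S] by (simp add: card_cartesian_product q_def)

lemma card_span_independent: "finite B \<Longrightarrow> independent B \<Longrightarrow> card (span B) = q ^ card B"
proof (induction B rule: finite_induct)
  case (insert b B)
  then have "b \<notin> span B" "independent B" by (auto simp: independent_insert)
  then show ?case using insert by (simp add: card_span_insert)
qed simp

text \<open>Functions on the infinite type of labels form an infinite-dimensional space, so the
  dimensions of its finite subspaces are compared through their cardinalities.\<close>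

lemma card_span: assumes "finite (span S)" shows "card (span S) = q ^ dim S"
proof -
  obtain B where B: "B \<subseteq> S" "independent B" "S \<subseteq> span B" "card B = dim S"
    using basis_exists by blast
  have "span B = span S" using span_mono[OF B(1)] span_minimal[OF B(3) subspace_span] by blast
  moreover have "finite B" using finite_subset[OF subset_trans[OF B(1) span_superset] assms] .
  ultimately show ?thesis using card_span_independent[of B] B by simp
qed

lemma span_subspace': "subspace T \<Longrightarrow> span T = T"
  by (simp only: span_eq_iff)

lemma card_subspace: assumes "subspace T" "finite T" shows "card T = q ^ dim T"
  using card_span[of T] assms(2) unfolding span_subspace'[OF assms(1)] by simp

lemma span_subset_iff: "subspace U \<Longrightarrow> span S \<subseteq> U \<longleftrightarrow> S \<subseteq> U"
  using span_superset[of S] span_minimal[of S U] by blast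

lemma power_q_le_iff: "q ^ a \<le> q ^ b \<longleftrightarrow> a \<le> b"
  using q_ge_2 by (simp add: power_increasing_iff)

lemma power_q_inject: "q ^ a = q ^ b \<longleftrightarrow> a = b"
  using q_ge_2 by (simp add: power_inject_exp)

lemma dim_subspace_mono: "subspace T \<Longrightarrow> subspace U \<Longrightarrow> finite U \<Longrightarrow> T \<subseteq> U \<Longrightarrow> dim T \<le> dim U"
  using card_mono[of U T] card_subspace[of T] card_subspace[of U] finite_subset[of T U]
  by (simp add: power_q_le_iff)

lemma subspace_dim_eq: "subspace T \<Longrightarrow> subspace U \<Longrightarrow> finite U \<Longrightarrow> T \<subseteq> U \<Longrightarrow> dim U \<le> dim T \<Longrightarrow> T = U"
  using card_subset_eq[of U T] card_subspace[of T] card_subspace[of U] finite_subset[of T U]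
    dim_subspace_mono[of T U] by simp

lemma subspace_dim_less: "subspace T \<Longrightarrow> subspace U \<Longrightarrow> finite U \<Longrightarrow> T \<subset> U \<Longrightarrow> dim T < dim U"
  using subspace_dim_eq[of T U] by (metis linorder_not_le psubsetE)

lemma dim_zero_subspace: "dim {0} = 0"
  using card_subspace[OF subspace_single_0] power_q_inject[of "dim {0}" 0] by simp

lemma subspace_dim_0: "subspace T \<Longrightarrow> finite T \<Longrightarrow> dim T = 0 \<Longrightarrow> T = {0}"
  using subspace_dim_eq[of "{0}" T] subspace_0[of T] by (auto simp: subspace_single_0 dim_zero_subspace)

lemma dim_span_insert:
  assumes "finite (span S)" "v \<notin> span S" shows "dim (span (insert v S)) = Suc (dim (span S))"
proof -
  have "finite ((UNIV :: 'f set) \<times> span S)" using assms by simp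
  then have fin: "finite (span (insert v S))"
    using bij_betw_finite[OF bij_betw_span_insert[OF assms(2)]] by simp
  have "q ^ dim (insert v S) = q ^ Suc (dim S)"
    using card_span_insert[OF assms(2)] card_span[OF assms(1)] card_span[OF fin] by simp
  then show ?thesis using q_ge_2 by (simp add: power_inject_exp del: power_Suc)
qed

text \<open>The fibre of addition on T x U over x + y is the set of all (x + z, y - z) with z in the
  intersection, so all fibres have equal size.\<close>

lemma card_sum_Int:
  assumes T: "subspace T" "finite T" and U: "subspace U" "finite U"
  shows "card {x + y |x y. x \<in> T \<and> y \<in> U} * card (T \<inter> U) = card T * card U"
proof -
  let ?S = "{x + y |x y. x \<in> T \<and> y \<in> U}"
  have S: "?S = (\<lambda>(x, y). x + y) ` (T \<times> U)" by auto
  have "card {p \<in> T \<times> U. fst p + snd p = w} = card (T \<inter> U)" if "w \<in> ?S" for w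
  proof -
    obtain x y where xy: "w = x + y" "x \<in> T" "y \<in> U" using \<open>w \<in> ?S\<close> by auto
    have "bij_betw (\<lambda>z. (x + z, y - z)) (T \<inter> U) {p \<in> T \<times> U. fst p + snd p = w}"
    proof (rule bij_betw_byWitness[where f' = "\<lambda>p. fst p - x"])
      show "(\<lambda>z. (x + z, y - z)) ` (T \<inter> U) \<subseteq> {p \<in> T \<times> U. fst p + snd p = w}"
        using T U xy by (auto intro: subspace_add subspace_diff)
      show "(\<lambda>p. fst p - x) ` {p \<in> T \<times> U. fst p + snd p = w} \<subseteq> T \<inter> U"
      proof (rule image_subsetI)
        fix p assume p: "p \<in> {p \<in> T \<times> U. fst p + snd p = w}"
        define a b where "a = fst p" and "b = snd p"
        have ab: "a \<in> T" "b \<in> U" "a + b = w" using p by (auto simp: a_def b_def)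
        then have "a - x = y - b" using xy by (simp add: algebra_simps)
        moreover have "a - x \<in> T" "y - b \<in> U" using ab T U xy by (auto intro: subspace_diff)
        ultimately show "fst p - x \<in> T \<inter> U" by (simp add: a_def)
      qed
    qed (use xy in \<open>auto simp: algebra_simps\<close>)
    then show ?thesis by (simp add: bij_betw_same_card)
  qed
  moreover have "(\<Sum>p\<in>T \<times> U. card {w\<in>?S. fst p + snd p = w}) = (\<Sum>w\<in>?S. card {p \<in> T \<times> U. fst p + snd p = w})"
    using T U by (intro sum_multicount_gen) (auto simp: S)
  moreover have "card {w\<in>?S. fst p + snd p = w} = 1" if "p \<in> T \<times> U" for p
  proof -
    have single: "card {w\<in>S. c = w} = 1" if "c \<in> S" for c and S :: "'v set"
    proof -
      have "{w\<in>S. c = w} = {c}" using that by auto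
      then show ?thesis by simp
    qed
    have "fst p + snd p \<in> ?S" using that by (cases p) auto
    then show ?thesis by (rule single)
  qed
  ultimately show ?thesis using T U by (simp add: card_cartesian_product)
qed

lemma dim_sum_Int:
  assumes "subspace T" "finite T" "subspace U" "finite U"
  shows "dim (span (T \<union> U)) + dim (T \<inter> U) = dim T + dim U"
proof -
  have S: "span (T \<union> U) = {x + y |x y. x \<in> T \<and> y \<in> U}"
    unfolding span_Un using assms by (simp add: span_subspace')
  have "finite ((\<lambda>(x, y). x + y) ` (T \<times> U))" using assms by simp
  moreover have "(\<lambda>(x, y). x + y) ` (T \<times> U) = span (T \<union> U)" unfolding S by auto
  ultimately have fin: "finite (span (T \<union> U))" by simp
  have "q ^ (dim (span (T \<union> U)) + dim (T \<inter> U)) = q ^ (dim T + dim U)"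
    using card_sum_Int[OF assms] card_subspace[of "T \<inter> U"] card_subspace[of T] card_subspace[of U] card_span[OF fin]
      assms by (simp add: S[symmetric] power_add subspace_inter)
  then show ?thesis using q_ge_2 by (simp add: power_inject_exp)
qed

section \<open>Intervals in the lattice of subspaces\<close>

definition subspaces_between :: "'v set \<Rightarrow> 'v set \<Rightarrow> 'v set set" where
  "subspaces_between A B = {U. subspace U \<and> A \<subseteq> U \<and> U \<subseteq> B}"

lemma finite_subspaces_between: "finite B \<Longrightarrow> finite (subspaces_between A B)"
  by (rule finite_subset[of _ "Pow B"]) (auto simp: subspaces_between_def)

text \<open>Double counting of pairs of a subspace U and a vector v in U outside A: the subspaces
  through v are those above the span of A and v, whose number is known by induction on k. Comparison
  with \<open>gbin_Suc_Suc_absorb\<close> finishes.\<close>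

lemma card_subspaces_between:
  assumes "subspace A" "subspace B" "finite B" "A \<subseteq> B"
  shows "card {U \<in> subspaces_between A B. dim U = dim A + k} = gbin q (dim B - dim A) k"
  using assms
proof (induction k arbitrary: A)
  case 0
  have finA: "finite A" using 0 finite_subset by blast
  have "{U \<in> subspaces_between A B. dim U = dim A + 0} = {A}"
  proof (intro equalityI subsetI)
    fix U assume "U \<in> {U \<in> subspaces_between A B. dim U = dim A + 0}"
    then have "A = U"
      using subspace_dim_eq[of A U] 0 finite_subset[of U B] by (simp add: subspaces_between_def)
    then show "U \<in> {A}" by simp
  qed (use 0 in \<open>auto simp: subspaces_between_def\<close>)
  then show ?case by simp
next
  case (Suc k)
  note [simp] = Suc.prems
  have finA: "finite A" using Suc.prems finite_subset by blast
  have spA: "span A = A" by (simp add: span_subspace')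
  define G where "G = {U \<in> subspaces_between A B. dim U = dim A + Suc k}"
  have finG: "finite G" by (simp add: G_def finite_subspaces_between)
  have dAB: "dim A \<le> dim B" using dim_subspace_mono[of A B] by simp
  have c1: "card {U\<in>G. v \<in> U} = gbin q (dim B - Suc (dim A)) k" if v: "v \<in> B - A" for v
  proof -
    have sub: "span (insert v A) \<subseteq> B" using v by (intro span_minimal) auto
    have d: "dim (span (insert v A)) = Suc (dim A)"
      using dim_span_insert[of A v] v finA by (simp add: spA)
    then have d': "dim (insert v A) = Suc (dim A)" by simp
    have "{U\<in>G. v \<in> U} = {U \<in> subspaces_between (span (insert v A)) B. dim U = dim (span (insert v A)) + k}"
    proof -
      have "span (insert v A) \<subseteq> U \<longleftrightarrow> v \<in> U \<and> A \<subseteq> U" if "subspace U" for U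
        using span_subset_iff[OF that, of "insert v A"] by simp
      then have "U \<in> {U\<in>G. v \<in> U} \<longleftrightarrow>
          U \<in> {U \<in> subspaces_between (span (insert v A)) B. dim U = Suc (dim A) + k}" for U
        unfolding G_def subspaces_between_def mem_Collect_eq add_Suc_shift by meson
      then show ?thesis unfolding d by (rule set_eqI)
    qed
    then show ?thesis
      using Suc.IH[of "span (insert v A)"] sub by (simp add: d d' subspace_span)
  qed
  have c2: "card {v\<in>B - A. v \<in> U} = q ^ (dim A + Suc k) - q ^ dim A" if U: "U \<in> G" for U
  proof -
    have "{v\<in>B - A. v \<in> U} = U - A" "A \<subseteq> U" "subspace U" "finite U" "dim U = dim A + Suc k"
      using U finite_subset[of U B] by (auto simp: G_def subspaces_between_def)
    then show ?thesis using card_subspace[of U] card_subspace[of A] finA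
      by (simp add: card_Diff_subset)
  qed
  have "(\<Sum>v\<in>B - A. card {U\<in>G. v \<in> U}) = (\<Sum>U\<in>G. q ^ (dim A + Suc k) - q ^ dim A)"
    by (rule sum_multicount_gen) (use finG c2 in auto)
  then have "(q ^ dim B - q ^ dim A) * gbin q (dim B - Suc (dim A)) k = card G * (q ^ (dim A + Suc k) - q ^ dim A)"
    using c1 card_subspace[of B] card_subspace[of A] finA by (simp add: card_Diff_subset)
  moreover have "q ^ dim B - q ^ dim A = q ^ dim A * (q ^ (dim B - dim A) - 1)"
    using dAB by (simp add: diff_mult_distrib2 flip: power_add)
  moreover have "q ^ (dim A + Suc k) - q ^ dim A = q ^ dim A * (q ^ Suc k - 1)"
    by (simp add: diff_mult_distrib2 power_add mult_ac)
  ultimately have "q ^ dim A * ((q ^ (dim B - dim A) - 1) * gbin q (dim B - Suc (dim A)) k) =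
      q ^ dim A * (card G * (q ^ Suc k - 1))"
    by (simp only: mult_ac)
  then have eq: "(q ^ (dim B - dim A) - 1) * gbin q (dim B - Suc (dim A)) k = card G * (q ^ Suc k - 1)"
    using q_ge_2 by (subst (asm) mult_left_cancel) auto
  have big: "1 \<le> q ^ m" for m using q_ge_2 by simp
  have key: "gbin q (dim B - dim A) (Suc k) * (q ^ Suc k - 1) = card G * (q ^ Suc k - 1)"
  proof (cases "dim B - dim A")
    case 0
    then show ?thesis using eq by simp
  next
    case (Suc m)
    then have m: "dim B - Suc (dim A) = m" by simp
    have "int (gbin q (Suc m) (Suc k) * (q ^ Suc k - 1)) = int ((q ^ Suc m - 1) * gbin q m k)"
      using gbin_Suc_Suc_absorb[OF q_ge_2, of m k] big[of "Suc k"] big[of "Suc m"]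
      by (simp add: of_nat_diff del: power_Suc)
    then have "gbin q (Suc m) (Suc k) * (q ^ Suc k - 1) = (q ^ Suc m - 1) * gbin q m k"
      by (simp only: of_nat_eq_iff)
    then show ?thesis using eq unfolding Suc m by simp
  qed
  have "q ^ Suc k - 1 \<noteq> 0"
    using power_q_inject[of "Suc k" 0] big[of "Suc k"] by (simp del: power_Suc)
  then show ?case using key by (simp add: G_def)
qed

lemma sum_subspaces_between:
  fixes g :: "nat \<Rightarrow> 'r::comm_semiring_1"
  assumes "subspace A" "subspace B" "finite B" "A \<subseteq> B"
  shows "(\<Sum>U\<in>subspaces_between A B. g (dim U)) = (\<Sum>k\<le>dim B - dim A. of_nat (gbin q (dim B - dim A) k) * g (dim A + k))"
proof -
  have "(\<Sum>U\<in>subspaces_between A B. g (dim U)) =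
      (\<Sum>k\<in>{..dim B - dim A}. \<Sum>U\<in>{U\<in>subspaces_between A B. dim U - dim A = k}. g (dim U))"
  proof (rule sum.group[symmetric])
    show "(\<lambda>U. dim U - dim A) ` subspaces_between A B \<subseteq> {..dim B - dim A}"
      using assms dim_subspace_mono[of _ B] by (auto simp: subspaces_between_def intro!: diff_le_mono)
  qed (simp_all add: finite_subspaces_between assms)
  also have "\<dots> = (\<Sum>k\<le>dim B - dim A. of_nat (gbin q (dim B - dim A) k) * g (dim A + k))"
  proof (intro sum.cong refl)
    fix k
    have "{U\<in>subspaces_between A B. dim U - dim A = k} = {U\<in>subspaces_between A B. dim U = dim A + k}"
    proof -
      have "dim A \<le> dim U" if "U \<in> subspaces_between A B" for U
        using that assms dim_subspace_mono[of A U] finite_subset[of U B] by (simp add: subspaces_between_def)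
      then have "U \<in> {U\<in>subspaces_between A B. dim U - dim A = k} \<longleftrightarrow> U \<in> {U\<in>subspaces_between A B. dim U = dim A + k}" for U
        using le_add_diff_inverse[of "dim A" "dim U"] by auto
      then show ?thesis by (rule set_eqI)
    qed
    then show "(\<Sum>U\<in>{U\<in>subspaces_between A B. dim U - dim A = k}. g (dim U)) = of_nat (gbin q (dim B - dim A) k) * g (dim A + k)"
      using card_subspaces_between[OF assms, of k] by simp
  qed
  finally show ?thesis .
qed

text \<open>By \<open>gbin_symmetric\<close> there are as many subspaces at height k above A as at
  depth k below B.\<close>

lemma sum_subspaces_between_reflect:
  fixes g :: "nat \<Rightarrow> 'r::comm_semiring_1"
  assumes "subspace A" "subspace B" "finite B" "A \<subseteq> B"
  shows "(\<Sum>U\<in>subspaces_between A B. g (dim U - dim A)) = (\<Sum>U\<in>subspaces_between A B. g (dim B - dim U))"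
proof -
  define d where "d = dim B - dim A"
  have le: "dim A \<le> dim B" using dim_subspace_mono[of A B] assms by simp
  have "(\<Sum>U\<in>subspaces_between A B. g (dim U - dim A)) = (\<Sum>k\<le>d. of_nat (gbin q d k) * g k)"
    using sum_subspaces_between[OF assms, of "\<lambda>m. g (m - dim A)"] by (simp add: d_def)
  also have "\<dots> = (\<Sum>k<Suc d. of_nat (gbin q d (d - k)) * g (d - k))"
    using sum.nat_diff_reindex[of "\<lambda>k. of_nat (gbin q d k) * g k" "Suc d"] by (simp add: lessThan_Suc_atMost)
  also have "\<dots> = (\<Sum>k\<le>d. of_nat (gbin q d k) * g (d - k))"
    unfolding lessThan_Suc_atMost using gbin_symmetric[OF q_ge_2] by (intro sum.cong) auto
  also have "\<dots> = (\<Sum>U\<in>subspaces_between A B. g (dim B - dim U))"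
    using sum_subspaces_between[OF assms, of "\<lambda>m. g (dim B - m)"] le by (simp add: d_def diff_diff_left)
  finally show ?thesis .
qed

text \<open>Says that the Moebius function of an interval of length d in the lattice of subspaces is
  (-1)^d q^(d choose 2).\<close>

lemma moebius_subspaces_between:
  assumes "subspace A" "subspace B" "finite B" "A \<subseteq> B"
  shows "(\<Sum>U\<in>subspaces_between A B. (-1) ^ (dim B - dim U) * int q ^ ((dim B - dim U) choose 2)) =
    (if A = B then 1 else 0)"
proof -
  have le: "dim A \<le> dim B" using dim_subspace_mono[of A B] assms by simp
  have "dim B - dim A = 0 \<longleftrightarrow> A = B" using le subspace_dim_eq[OF assms] by auto
  then show ?thesis
    using sum_subspaces_between[OF assms, of "\<lambda>m. (-1) ^ (dim B - m) * int q ^ ((dim B - m) choose 2)"]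
      gbin_alternating_sum_reflected[OF q_ge_2, of "dim B - dim A"]
    by (simp add: diff_diff_left mult_ac)
qed

end

section \<open>Matroids of points of a projective space\<close>

locale point_matroid = finite_scalars scale
  for scale :: "'f::{field,finite} \<Rightarrow> 'v::ab_group_add \<Rightarrow> 'v" +
  fixes V :: "'v set" and E :: "'v set set"
  assumes subspace_V: "subspace V" and finite_V: "finite V"
    and points: "\<And>e. e \<in> E \<Longrightarrow> \<exists>v\<in>V. v \<noteq> 0 \<and> e = span {v}"
begin

definition Mat :: "'v set pre_matroid" where
  "Mat = Pre_Matroid E (\<lambda>A. dim (\<Union>A))"

lemma ground_Mat [simp]: "ground Mat = E" and rk_Mat [simp]: "rk Mat A = dim (\<Union>A)"
  by (simp_all add: Mat_def)

definition subs :: "'v set \<Rightarrow> 'v set set" where "subs T = {U. subspace U \<and> U \<subseteq> T}"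

lemma subsI: "subspace U \<Longrightarrow> U \<subseteq> T \<Longrightarrow> U \<in> subs T" and
  subsD: "U \<in> subs T \<Longrightarrow> subspace U" "U \<in> subs T \<Longrightarrow> U \<subseteq> T"
  by (simp_all add: subs_def)

lemma subs_trans: "U \<in> subs T \<Longrightarrow> T \<in> subs W \<Longrightarrow> U \<in> subs W"
  unfolding subs_def by blast

lemma finite_sub: "T \<in> subs V \<Longrightarrow> finite T"
  using finite_subset[OF subsD(2) finite_V] .

lemma finite_subs: "T \<in> subs V \<Longrightarrow> finite (subs T)"
  by (rule finite_subset[of _ "Pow T"]) (auto simp: subs_def finite_sub)

lemma V_subs: "V \<in> subs V" by (simp add: subs_def subspace_V)

lemma finite_points: "finite E"
proof -
  have "E \<subseteq> (\<lambda>v. span {v}) ` V" using points by blast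
  then show ?thesis using finite_V finite_surj by blast
qed

lemma point_subset_V: "e \<in> E \<Longrightarrow> e \<subseteq> V"
  using points[of e] span_minimal[OF _ subspace_V] by auto

lemma point_nonzero: "e \<in> E \<Longrightarrow> \<exists>v. v \<in> e \<and> v \<noteq> 0 \<and> e = span {v}"
  using points[of e] span_base[of _ "{_}"] by blast

definition lspan :: "'v set set \<Rightarrow> 'v set" where "lspan A = span (\<Union>A)"

lemma lspan_subs: "A \<subseteq> E \<Longrightarrow> lspan A \<in> subs V"
proof -
  assume "A \<subseteq> E"
  then have "\<Union>A \<subseteq> V" using point_subset_V by blast
  then show ?thesis unfolding lspan_def by (intro subsI subspace_span span_minimal subspace_V)
qed

lemma subset_lspan: "e \<in> A \<Longrightarrow> e \<subseteq> lspan A"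
  using span_superset[of "\<Union>A"] by (auto simp: lspan_def)

lemma dim_lspan: "dim (lspan A) = dim (\<Union>A)"
  by (simp add: lspan_def)

lemma finite_lspan: "A \<subseteq> E \<Longrightarrow> finite (lspan A)"
  using lspan_subs finite_sub by blast

lemma lspan_mono: "A \<subseteq> B \<Longrightarrow> lspan A \<subseteq> lspan B"
  unfolding lspan_def by (intro span_mono Union_mono)

lemma lspan_subset_iff: "subspace T \<Longrightarrow> lspan A \<subseteq> T \<longleftrightarrow> (\<forall>e\<in>A. e \<subseteq> T)"
  unfolding lspan_def by (auto simp: span_subset_iff)

lemma dim_mono: "T \<in> subs U \<Longrightarrow> U \<in> subs V \<Longrightarrow> dim T \<le> dim U"
  using dim_subspace_mono subsD finite_sub by blast

lemma rank_mono: "A \<subseteq> B \<Longrightarrow> B \<subseteq> E \<Longrightarrow> dim (\<Union>A) \<le> dim (\<Union>B)"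
  using dim_mono[of "lspan A" "lspan B"] lspan_subs[of B] lspan_mono[of A B]
  by (simp add: dim_lspan subs_def lspan_def)

lemma dim_point: "e \<in> E \<Longrightarrow> dim e = 1"
proof -
  assume "e \<in> E"
  then obtain v where v: "v \<noteq> 0" "e = span {v}" using point_nonzero by blast
  then have "v \<notin> span {}" by simp
  then have "dim (span {v}) = Suc (dim (span {}))" by (intro dim_span_insert) auto
  then show ?thesis using v by (simp add: dim_zero_subspace)
qed

lemma matroid_Mat: "matroid Mat"
  unfolding matroid_def ground_Mat rk_Mat
proof (intro conjI allI impI finite_points)
  fix A assume A: "A \<subseteq> E"
  then have "\<forall>e\<in>A. \<exists>v. e = span {v}" using point_nonzero by blast
  then obtain f where f: "\<And>e. e \<in> A \<Longrightarrow> e = span {f e}" by metis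
  have "e \<subseteq> span (f ` A)" if "e \<in> A" for e
  proof -
    have "span {f e} \<subseteq> span (f ` A)" using that by (intro span_mono) auto
    then show ?thesis using f[OF that] by (simp only:)
  qed
  then have "\<Union>A \<subseteq> span (f ` A)" by blast
  moreover have fin: "finite A" using A finite_points finite_subset by blast
  ultimately have "dim (\<Union>A) \<le> card (f ` A)" by (intro dim_le_card) auto
  also have "\<dots> \<le> card A" by (rule card_image_le[OF fin])
  finally show "dim (\<Union>A) \<le> card A" .
next
  fix A B assume "A \<subseteq> B \<and> B \<subseteq> E"
  then show "dim (\<Union>A) \<le> dim (\<Union>B)" using rank_mono by blast
next
  fix A B assume "A \<subseteq> E \<and> B \<subseteq> E"
  then have A: "lspan A \<in> subs V" and B: "lspan B \<in> subs V" using lspan_subs by auto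
  have "lspan (A \<union> B) = span (lspan A \<union> lspan B)"
    unfolding lspan_def span_Un span_span by (simp add: span_Un)
  moreover have "lspan (A \<inter> B) \<in> subs (lspan A \<inter> lspan B)"
    using lspan_mono[of "A \<inter> B" A] lspan_mono[of "A \<inter> B" B] by (simp add: subs_def lspan_def)
  moreover have "lspan A \<inter> lspan B \<in> subs V" using A B by (auto simp: subs_def subspace_inter)
  moreover have "dim (span (lspan A \<union> lspan B)) + dim (lspan A \<inter> lspan B) = dim (lspan A) + dim (lspan B)"
    using dim_sum_Int subsD(1) finite_sub A B by blast
  ultimately show "dim (\<Union>(A \<union> B)) + dim (\<Union>(A \<inter> B)) \<le> dim (\<Union>A) + dim (\<Union>B)"
    using dim_mono[of "lspan (A \<inter> B)" "lspan A \<inter> lspan B"] unfolding dim_lspan[symmetric] by simp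
qed

lemma loopless_Mat: "loopless_matroid Mat"
  by unfold_locales (use matroid_Mat dim_point in auto)

sublocale km: loopless_matroid Mat by (rule loopless_Mat)

abbreviation "LL \<equiv> flats Mat"

section \<open>Flats and subspaces\<close>

definition fl :: "'v set \<Rightarrow> 'v set set" where "fl T = {e\<in>E. e \<subseteq> T}"

lemma fl_subset: "fl T \<subseteq> E" by (auto simp: fl_def)

lemma lspan_fl: "subspace T \<Longrightarrow> lspan (fl T) \<subseteq> T"
  by (simp add: lspan_subset_iff) (simp add: fl_def)

lemma rank_fl_le: "T \<in> subs V \<Longrightarrow> dim (\<Union>(fl T)) \<le> dim T"
  using dim_mono[of "lspan (fl T)" T] lspan_fl[of T] by (simp add: subs_def dim_lspan lspan_def)

text \<open>A Galois connection: \<open>lspan\<close> embeds the flats into the lattice of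
  subspaces, with \<open>fl\<close> undoing it.\<close>

lemma subset_fl_iff: "A \<subseteq> E \<Longrightarrow> subspace T \<Longrightarrow> A \<subseteq> fl T \<longleftrightarrow> lspan A \<subseteq> T"
  by (auto simp: lspan_subset_iff fl_def)

lemma fl_flat: assumes "T \<in> subs V" shows "fl T \<in> LL"
proof -
  have "dim (\<Union>(fl T)) < dim (\<Union>(insert e (fl T)))" if e: "e \<in> E - fl T" for e
  proof -
    have "lspan (fl T) \<subset> lspan (insert e (fl T))"
    proof
      show "lspan (fl T) \<subseteq> lspan (insert e (fl T))" by (rule lspan_mono) auto
      have "e \<subseteq> lspan (insert e (fl T))" by (rule subset_lspan) simp
      moreover have "\<not> e \<subseteq> T" using e by (auto simp: fl_def)
      moreover have "lspan (fl T) \<subseteq> T" by (rule lspan_fl[OF subsD(1)[OF assms]])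
      ultimately show "lspan (fl T) \<noteq> lspan (insert e (fl T))" by (metis order_trans)
    qed
    then show ?thesis
      using subspace_dim_less[of "lspan (fl T)" "lspan (insert e (fl T))"] finite_lspan[of "insert e (fl T)"] e fl_subset
      by (simp add: lspan_def subspace_span)
  qed
  then show ?thesis using fl_subset by (auto simp: flats_def)
qed

lemma fl_lspan: assumes "F \<in> LL" shows "fl (lspan F) = F"
proof
  have FE: "F \<subseteq> E" using km.flatD[OF assms] by simp
  show "F \<subseteq> fl (lspan F)" using FE span_superset[of "\<Union>F"] by (auto simp: fl_def lspan_def)
  show "fl (lspan F) \<subseteq> F"
  proof (rule ccontr)
    assume "\<not> fl (lspan F) \<subseteq> F"
    then obtain e where e: "e \<in> E" "e \<subseteq> lspan F" "e \<notin> F" by (auto simp: fl_def)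
    then have "dim (\<Union>F) < dim (\<Union>(insert e F))" using assms by (auto simp: flats_def)
    moreover have sub: "lspan (insert e F) \<in> subs (lspan F)"
      using e span_superset[of "\<Union>F"]
      by (auto simp: subs_def lspan_def span_subset_iff[OF subspace_span])
    have "dim (\<Union>(insert e F)) \<le> dim (\<Union>F)"
      using dim_mono[OF sub lspan_subs[OF FE]] unfolding dim_lspan .
    ultimately show False by simp
  qed
qed

definition signed_Q :: "'v set \<Rightarrow> int poly" where "signed_Q T = km.signed_ikl (fl T)"

text \<open>
  \<open>pal_poly T\<close> is the multiplicity with which the empty flat enters when the Kazhdan--Lusztig element
  of \<open>T\<close> in the lattice of all subspaces is pushed forward to the lattice of flats; this explains why
  it is palindromic.
\<close>

definition pal_poly :: "'v set \<Rightarrow> int poly" where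
  "pal_poly T = (\<Sum>U\<in>subs T. monom 1 (dim U - dim (\<Union>(fl U))) * signed_Q U)"

lemma degree_signed_Q: "T \<in> subs V \<Longrightarrow> fl T \<noteq> {} \<Longrightarrow> 2 * degree (signed_Q T) < dim (\<Union>(fl T))"
  unfolding signed_Q_def using km.degree_signed_ikl[OF fl_flat] by simp

lemma degree_signed_Q_le: "T \<in> subs V \<Longrightarrow> degree (signed_Q T) \<le> dim (\<Union>(fl T))"
  using degree_signed_Q[of T] by (cases "fl T = {}") (auto simp: signed_Q_def km.signed_ikl_empty)

lemma rev_pal_poly:
  assumes T: "T \<in> subs V"
  shows "rev_poly (dim T) (pal_poly T) =
    (\<Sum>U\<in>subs T. monom 1 (dim T - dim U) * rev_poly (dim (\<Union>(fl U))) (signed_Q U))"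
  unfolding pal_poly_def rev_poly_sum
proof (intro sum.cong refl)
  fix U assume U: "U \<in> subs T"
  then have UV: "U \<in> subs V" using T subs_trans by blast
  define \<rho> where "\<rho> = dim (\<Union>(fl U))"
  have le: "\<rho> \<le> dim U" "dim U \<le> dim T" unfolding \<rho>_def using rank_fl_le[OF UV] dim_mono[OF U T] by auto
  have "rev_poly (dim T) (monom 1 (dim U - \<rho>) * signed_Q U) = rev_poly ((dim T - \<rho>) + \<rho>) (monom 1 (dim U - \<rho>) * signed_Q U)"
    using le by simp
  also have "\<dots> = rev_poly (dim T - \<rho>) (monom 1 (dim U - \<rho>)) * rev_poly \<rho> (signed_Q U)"
    using le degree_signed_Q_le[OF UV] by (intro rev_poly_mult) (auto simp: \<rho>_def intro: order_trans[OF degree_monom_le])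
  also have "rev_poly (dim T - \<rho>) (monom 1 (dim U - \<rho>)) = monom 1 (dim T - dim U)"
    using le by (subst rev_poly_monom) auto
  finally show "rev_poly (dim T) (monom 1 (dim U - dim (\<Union>(fl U))) * signed_Q U) =
      monom 1 (dim T - dim U) * rev_poly (dim (\<Union>(fl U))) (signed_Q U)"
    unfolding \<rho>_def .
qed

text \<open>Both sides are expanded in the witness y of \<open>signed_ikl_duality\<close>. On either
  side the coefficient of \<open>y H\<close> is a sum over the subspaces U between
  \<open>lspan H\<close> and T, weighted by the height of U above \<open>lspan H\<close> on one side
  and by its depth below T on the other; the reflection of the interval exchanges the two.\<close>

lemma pal_poly_palindromic:
  assumes T: "T \<in> subs V"
  shows "rev_poly (dim T) (pal_poly T) = pal_poly T"
proof -
  obtain y where y: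
    "\<And>G. G \<in> LL \<Longrightarrow> rev_poly (dim (\<Union>G)) (km.signed_ikl G) = (\<Sum>H\<in>{H\<in>LL. H \<subseteq> G}. y H)"
    "\<And>G. G \<in> LL \<Longrightarrow> km.signed_ikl G = (\<Sum>H\<in>{H\<in>LL. H \<subseteq> G}. monom 1 (dim (\<Union>G) - dim (\<Union>H)) * y H)"
    by (rule km.signed_ikl_duality[unfolded rk_Mat]) (rule that; assumption)
  have below: "{H\<in>LL. H \<subseteq> fl U} = {H\<in>LL. lspan H \<subseteq> U}" if "U \<in> subs T" for U
    using subset_fl_iff km.flatD subsD(1)[OF that] by auto
  have between: "{U\<in>subs T. lspan H \<subseteq> U} = subspaces_between (lspan H) T" for H
    by (auto simp: subs_def subspaces_between_def)
  have "pal_poly T = (\<Sum>U\<in>subs T. \<Sum>H\<in>{H\<in>LL. lspan H \<subseteq> U}. monom 1 (dim U - dim (lspan H)) * y H)"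
    unfolding pal_poly_def
  proof (intro sum.cong refl)
    fix U assume U: "U \<in> subs T"
    then have UV: "U \<in> subs V" using T subs_trans by blast
    have "monom 1 (dim U - dim (\<Union>(fl U))) * signed_Q U =
        (\<Sum>H\<in>{H\<in>LL. H \<subseteq> fl U}. monom 1 (dim U - dim (\<Union>(fl U))) * (monom 1 (dim (\<Union>(fl U)) - dim (\<Union>H)) * y H))"
      unfolding signed_Q_def y(2)[OF fl_flat[OF UV]] sum_distrib_left ..
    also have "\<dots> = (\<Sum>H\<in>{H\<in>LL. H \<subseteq> fl U}. monom 1 (dim U - dim (lspan H)) * y H)"
    proof (intro sum.cong refl)
      fix H assume "H \<in> {H\<in>LL. H \<subseteq> fl U}"
      then have "dim (\<Union>H) \<le> dim (\<Union>(fl U))" using rank_mono fl_subset by blast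
      then have e: "dim U - dim (\<Union>(fl U)) + (dim (\<Union>(fl U)) - dim (\<Union>H)) = dim U - dim (lspan H)"
        using rank_fl_le[OF UV] by (simp add: dim_lspan)
      show "monom 1 (dim U - dim (\<Union>(fl U))) * (monom 1 (dim (\<Union>(fl U)) - dim (\<Union>H)) * y H) =
          monom 1 (dim U - dim (lspan H)) * y H"
        unfolding mult.assoc[symmetric] mult_monom e by simp
    qed
    finally show "monom 1 (dim U - dim (\<Union>(fl U))) * signed_Q U =
        (\<Sum>H\<in>{H\<in>LL. lspan H \<subseteq> U}. monom 1 (dim U - dim (lspan H)) * y H)"
      unfolding below[OF U] .
  qed
  also have "\<dots> = (\<Sum>H\<in>LL. \<Sum>U\<in>subspaces_between (lspan H) T. monom 1 (dim U - dim (lspan H)) * y H)"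
    using sum.swap_restrict[OF finite_subs[OF T] km.finite_L, of "\<lambda>U H. monom 1 (dim U - dim (lspan H)) * y H" "\<lambda>U H. lspan H \<subseteq> U"]
    unfolding between .
  also have "\<dots> = (\<Sum>H\<in>LL. \<Sum>U\<in>subspaces_between (lspan H) T. monom 1 (dim T - dim U) * y H)"
  proof (rule sum.cong[OF refl])
    fix H
    show "(\<Sum>U\<in>subspaces_between (lspan H) T. monom 1 (dim U - dim (lspan H)) * y H) =
        (\<Sum>U\<in>subspaces_between (lspan H) T. monom 1 (dim T - dim U) * y H)"
    proof (cases "lspan H \<subseteq> T")
      case True
      have "subspace (lspan H)" by (simp add: lspan_def subspace_span)
      from sum_subspaces_between_reflect[OF this subsD(1)[OF T] finite_sub[OF T] True, of "\<lambda>m. monom 1 m :: int poly"]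
      show ?thesis unfolding sum_distrib_right[symmetric] by simp
    next
      case False
      then have "subspaces_between (lspan H) T = {}" by (auto simp: subspaces_between_def)
      then show ?thesis by simp
    qed
  qed
  also have "\<dots> = (\<Sum>U\<in>subs T. \<Sum>H\<in>{H\<in>LL. lspan H \<subseteq> U}. monom 1 (dim T - dim U) * y H)"
    using sum.swap_restrict[OF finite_subs[OF T] km.finite_L, of "\<lambda>U H. monom 1 (dim T - dim U) * y H" "\<lambda>U H. lspan H \<subseteq> U"]
    unfolding between by (rule sym)
  also have "\<dots> = (\<Sum>U\<in>subs T. monom 1 (dim T - dim U) * rev_poly (dim (\<Union>(fl U))) (signed_Q U))"
  proof (intro sum.cong refl)
    fix U assume U: "U \<in> subs T"
    then have UV: "U \<in> subs V" using T subs_trans by blast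
    show "(\<Sum>H\<in>{H\<in>LL. lspan H \<subseteq> U}. monom 1 (dim T - dim U) * y H) =
        monom 1 (dim T - dim U) * rev_poly (dim (\<Union>(fl U))) (signed_Q U)"
      unfolding signed_Q_def y(1)[OF fl_flat[OF UV]] below[OF U] sum_distrib_left ..
  qed
  also have "\<dots> = rev_poly (dim T) (pal_poly T)" using rev_pal_poly[OF T] by simp
  finally show ?thesis ..
qed

text \<open>Moebius inversion of the definition of \<open>pal_poly\<close>. As U is spanned by its
  elements, the monomial in the term isolated is 1.\<close>

lemma signed_Q_eq_alternating_sum:
  assumes U: "U \<in> subs V" and sp: "dim (\<Union>(fl U)) = dim U"
  shows "coeff (signed_Q U) i = (\<Sum>T\<in>subs U. (-1) ^ (dim U - dim T) * int q ^ ((dim U - dim T) choose 2) * coeff (pal_poly T) i)"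
proof -
  define c where "c = (\<lambda>T. (-1) ^ (dim U - dim T) * int q ^ ((dim U - dim T) choose 2))"
  define g where "g = (\<lambda>T. coeff (monom 1 (dim T - dim (\<Union>(fl T))) * signed_Q T) i)"
  have "(\<Sum>T\<in>subs U. c T * coeff (pal_poly T) i) = (\<Sum>T\<in>subs U. \<Sum>T'\<in>{T'\<in>subs U. T' \<subseteq> T}. c T * g T')"
  proof (intro sum.cong refl)
    fix T assume "T \<in> subs U"
    then have "subs T = {T'\<in>subs U. T' \<subseteq> T}" by (auto simp: subs_def)
    then show "c T * coeff (pal_poly T) i = (\<Sum>T'\<in>{T'\<in>subs U. T' \<subseteq> T}. c T * g T')"
      by (simp add: pal_poly_def coeff_sum sum_distrib_left g_def)
  qed
  also have "\<dots> = (\<Sum>T'\<in>subs U. \<Sum>T\<in>{T\<in>subs U. T' \<subseteq> T}. c T * g T')"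
    by (rule sum.swap_restrict[OF finite_subs[OF U] finite_subs[OF U]])
  also have "\<dots> = (\<Sum>T'\<in>subs U. if T' = U then g T' else 0)"
  proof (intro sum.cong refl)
    fix T' assume T': "T' \<in> subs U"
    have "{T\<in>subs U. T' \<subseteq> T} = subspaces_between T' U" by (auto simp: subs_def subspaces_between_def)
    then show "(\<Sum>T\<in>{T\<in>subs U. T' \<subseteq> T}. c T * g T') = (if T' = U then g T' else 0)"
      using moebius_subspaces_between[of T' U] T' subsD[OF T'] subsD(1)[OF U] finite_sub[OF U]
      unfolding c_def sum_distrib_right[symmetric] by simp
  qed
  also have "\<dots> = g U"
  proof -
    have "U \<in> subs U" using subsD(1)[OF U] by (simp add: subs_def)
    then show ?thesis using finite_subs[OF U] by simp
  qed
  also have "g U = coeff (signed_Q U) i" by (simp add: g_def sp)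
  finally show ?thesis unfolding c_def ..
qed

section \<open>Coefficients in terms of missing subspaces\<close>

definition miss :: "'v set \<Rightarrow> nat \<Rightarrow> nat" where
  "miss T i = card {U\<in>subs T. dim U = i \<and> fl U = {}}"

text \<open>For subspaces of dimension \<open>2 * i\<close>, whose middle coefficient is not covered by the degree bound.\<close>

definition middle_corr :: "'v set \<Rightarrow> nat \<Rightarrow> int" where
  "middle_corr T i = (if dim T = 2 * i \<and> fl T \<noteq> {} \<and> dim (\<Union>(fl T)) < dim T then coeff (signed_Q T) (i - 1) else 0)"

lemma miss_eq_0: "T \<in> subs V \<Longrightarrow> dim T < i \<Longrightarrow> miss T i = 0"
proof -
  assume T: "T \<in> subs V" "dim T < i"
  then have none: "{U\<in>subs T. dim U = i \<and> fl U = {}} = {}" using dim_mono by fastforce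
  show ?thesis unfolding miss_def none by simp
qed

text \<open>Counts the pairs of a missing j-dimensional subspace and an m-dimensional subspace
  containing it.\<close>

lemma sum_miss:
  assumes U: "U \<in> subs V" and jm: "j \<le> m"
  shows "(\<Sum>T\<in>{T\<in>subs U. dim T = m}. miss T j) = miss U j * gbin q (dim U - j) (m - j)"
proof -
  define A where "A = {T\<in>subs U. dim T = m}"
  define B where "B = {T'\<in>subs U. dim T' = j \<and> fl T' = {}}"
  have fin: "finite A" "finite B" using finite_subs[OF U] by (auto simp: A_def B_def)
  have "(\<Sum>T\<in>A. card {T'\<in>B. T' \<subseteq> T}) = (\<Sum>T'\<in>B. gbin q (dim U - j) (m - j))"
  proof (rule sum_multicount_gen[OF fin], rule ballI)
    fix T' assume T': "T' \<in> B"
    then have "T' \<in> subs U" "dim T' = j" by (auto simp: B_def)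
    moreover have "{T\<in>A. T' \<subseteq> T} = {T \<in> subspaces_between T' U. dim T = dim T' + (m - j)}"
      using \<open>dim T' = j\<close> jm by (auto simp: A_def subs_def subspaces_between_def)
    ultimately show "card {T\<in>A. T' \<subseteq> T} = gbin q (dim U - j) (m - j)"
      using card_subspaces_between[of T' U "m - j"] subsD(1)[OF U] finite_sub[OF U] subsD[of T' U] by simp
  qed
  moreover have "card {T'\<in>B. T' \<subseteq> T} = miss T j" if "T \<in> A" for T
    unfolding miss_def using that by (intro arg_cong[of _ _ card]) (auto simp: A_def B_def subs_def)
  ultimately show ?thesis by (simp add: A_def B_def miss_def)
qed

end

locale near_point_matroid = point_matroid +
  assumes defect: "\<And>T. T \<in> subs V \<Longrightarrow> fl T \<noteq> {} \<Longrightarrow> dim T \<le> Suc (dim (\<Union>(fl T)))"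
begin

text \<open>A missing U contributes t^(dim U). For any other U, let rho be the rank of
  \<open>fl U\<close>; its term has degree below dim U - rho + rho/2. This is less than dim U / 2 if
  rho = dim U, and at most dim U / 2 if rho = dim U - 1. Reaching i therefore forces U = T, dim T =
  2i and rho = dim T - 1; the monomial t then shifts the index to the i - 1 of
  \<open>middle_corr\<close>.\<close>

lemma coeff_pal_poly_upper:
  assumes T: "T \<in> subs V" and i: "dim T \<le> 2 * i"
  shows "coeff (pal_poly T) i = int (miss T i) + middle_corr T i"
proof -
  have termeq: "coeff (monom 1 (dim U - dim (\<Union>(fl U))) * signed_Q U) i =
      (if dim U = i \<and> fl U = {} then 1 else 0) + (if U = T then middle_corr T i else 0)" if U: "U \<in> subs T" for U
  proof (cases "fl U = {}")
    case True
    moreover have "dim {} = 0" using dim_zero_subspace dim_span[of "{}"] by simp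
    ultimately show ?thesis by (auto simp: signed_Q_def km.signed_ikl_empty middle_corr_def)
  next
    case False
    have UV: "U \<in> subs V" using U T subs_trans by blast
    have dUT: "dim U \<le> dim T" by (rule dim_mono[OF U T])
    define \<rho> where "\<rho> = dim (\<Union>(fl U))"
    have b: "2 * degree (signed_Q U) < \<rho>" "\<rho> \<le> dim U" "dim U \<le> Suc \<rho>"
      unfolding \<rho>_def using degree_signed_Q[OF UV False] rank_fl_le[OF UV] defect[OF UV False] by auto
    have c: "coeff (monom 1 (dim U - \<rho>) * signed_Q U) i = (if i < dim U - \<rho> then 0 else coeff (signed_Q U) (i - (dim U - \<rho>)))"
      by (simp add: coeff_monom_mult)
    show ?thesis
    proof (cases "U = T \<and> dim T = 2 * i \<and> \<rho> < dim T")
      case True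
      then have "dim U - \<rho> = 1" "1 \<le> i" using b by auto
      then show ?thesis using c True False by (simp add: middle_corr_def \<rho>_def)
    next
      case cond: False
      have "coeff (monom 1 (dim U - \<rho>) * signed_Q U) i = 0"
      proof (rule ccontr)
        assume nz: "coeff (monom 1 (dim U - \<rho>) * signed_Q U) i \<noteq> 0"
        then have ge: "dim U - \<rho> \<le> i" and le: "i - (dim U - \<rho>) \<le> degree (signed_Q U)"
          using c le_degree[of "signed_Q U"] by (auto split: if_splits)
        have U1: "dim U = Suc \<rho>"
        proof (rule ccontr)
          assume "dim U \<noteq> Suc \<rho>"
          then have "dim U = \<rho>" using b by simp
          then show False using le b i dUT by simp
        qed
        then have "2 * i < \<rho> + 2" using ge le b by simp
        then have d: "\<rho> < dim T" "dim T = 2 * i" and "dim T \<le> dim U" using U1 i dUT by simp_all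
        have "U = T" using \<open>dim T \<le> dim U\<close>
          by (rule subspace_dim_eq[OF subsD(1)[OF U] subsD(1)[OF T] finite_sub[OF T] subsD(2)[OF U]])
        then show False using cond d(1,2) by blast
      qed
      moreover have "(if U = T then middle_corr T i else 0) = 0"
        using cond by (auto simp: middle_corr_def \<rho>_def)
      ultimately show ?thesis using False by (simp add: \<rho>_def)
    qed
  qed
  have TT: "T \<in> subs T" using subsD(1)[OF T] by (simp add: subs_def)
  have "coeff (pal_poly T) i = (\<Sum>U\<in>subs T. (if dim U = i \<and> fl U = {} then 1 else 0) + (if U = T then middle_corr T i else 0))"
    unfolding pal_poly_def coeff_sum using termeq by (intro sum.cong) auto
  also have "\<dots> = (\<Sum>U\<in>subs T. if dim U = i \<and> fl U = {} then 1 else 0) + middle_corr T i"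
    using finite_subs[OF T] TT by (simp add: sum.distrib)
  also have "(\<Sum>U\<in>subs T. if dim U = i \<and> fl U = {} then 1 else 0) = int (miss T i)"
    unfolding miss_def using finite_subs[OF T] by (simp add: sum.If_cases Int_def)
  finally show ?thesis .
qed

text \<open>\<open>max i (dim T - i)\<close> is the index in the upper half to which palindromicity
  carries i.\<close>

lemma coeff_pal_poly:
  assumes T: "T \<in> subs V"
  shows "coeff (pal_poly T) i = int (miss T (max i (dim T - i))) + middle_corr T i"
proof (cases "dim T \<le> 2 * i")
  case True
  then have "max i (dim T - i) = i" by simp
  then show ?thesis using coeff_pal_poly_upper[OF T True] by simp
next
  case False
  have "coeff (pal_poly T) i = coeff (rev_poly (dim T) (pal_poly T)) i" using pal_poly_palindromic[OF T] by simp
  also have "\<dots> = coeff (pal_poly T) (dim T - i)" using False by (simp add: coeff_rev_poly)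
  also have "\<dots> = int (miss T (dim T - i)) + middle_corr T (dim T - i)"
    using False by (intro coeff_pal_poly_upper[OF T]) auto
  also have "middle_corr T (dim T - i) = middle_corr T i"
  proof -
    have "dim T \<noteq> 2 * (dim T - i)" "dim T \<noteq> 2 * i" using False by linarith+
    then show ?thesis by (simp add: middle_corr_def)
  qed
  finally show ?thesis using False by simp
qed

text \<open>
  The subspaces \<open>T\<close> with \<open>dim T \<le> 2 * i\<close> contribute a truncated alternating sum of Gaussian binomials,
  which has a closed form.
\<close>

theorem coeff_inv_kl:
  assumes U: "U \<in> subs V" and sp: "dim (\<Union>(fl U)) = dim U" and i: "2 * i < dim U"
  shows "(-1) ^ dim U * coeff (signed_Q U) i =
    int (miss U i) * int q ^ ((dim U - 2 * i) choose 2) * int (gbin q (dim U - i - 1) i) +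
    (\<Sum>m\<in>{2 * i + 1..dim U}. (-1) ^ m * int q ^ ((dim U - m) choose 2) * int (miss U (m - i)) * int (gbin q (dim U - (m - i)) i)) +
    int q ^ ((dim U - 2 * i) choose 2) * (\<Sum>T\<in>subs U. middle_corr T i)"
proof -
  define u where "u = dim U"
  define w where "w = (\<lambda>m. (-1) ^ m * int q ^ ((u - m) choose 2))"
  have dimT: "dim T \<le> u" "T \<in> subs V" if "T \<in> subs U" for T
    unfolding u_def using dim_mono[OF that U] subs_trans[OF that U] by auto
  have "(-1) ^ u * coeff (signed_Q U) i = (\<Sum>T\<in>subs U. w (dim T) * coeff (pal_poly T) i)"
    unfolding signed_Q_eq_alternating_sum[OF U sp] sum_distrib_left
  proof (intro sum.cong refl)
    fix T assume "T \<in> subs U"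
    then have "dim T \<le> u" by (rule dimT)
    then have "(-1) ^ u * (-1) ^ (u - dim T) = ((-1) ^ dim T :: int)"
      by (auto simp: minus_one_power_iff)
    then show "(-1) ^ u * ((-1) ^ (dim U - dim T) * int q ^ ((dim U - dim T) choose 2) * coeff (pal_poly T) i) = w (dim T) * coeff (pal_poly T) i"
      unfolding w_def u_def mult.assoc[symmetric] by simp
  qed
  also have "\<dots> = (\<Sum>T\<in>subs U. w (dim T) * int (miss T (max i (dim T - i)))) + (\<Sum>T\<in>subs U. w (dim T) * middle_corr T i)"
    using dimT(2) by (simp add: coeff_pal_poly algebra_simps sum.distrib)
  \<comment> \<open>Corrections occur in the single dimension 2i only, whose sign is
    positive.\<close>
  also have "(\<Sum>T\<in>subs U. w (dim T) * middle_corr T i) = int q ^ ((u - 2 * i) choose 2) * (\<Sum>T\<in>subs U. middle_corr T i)"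
    unfolding sum_distrib_left by (intro sum.cong refl) (auto simp: middle_corr_def w_def)
  also have "(\<Sum>T\<in>subs U. w (dim T) * int (miss T (max i (dim T - i)))) =
      (\<Sum>m\<le>u. \<Sum>T\<in>{T\<in>subs U. dim T = m}. w (dim T) * int (miss T (max i (dim T - i))))"
    using dimT(1) by (intro sum.group[symmetric] finite_subs[OF U]) auto
  also have "\<dots> = (\<Sum>m\<le>u. w m * (\<Sum>T\<in>{T\<in>subs U. dim T = m}. int (miss T (max i (m - i)))))"
    unfolding sum_distrib_left by (intro sum.cong refl) auto
  also have "\<dots> = (\<Sum>m\<in>{i..u}. w m * (\<Sum>T\<in>{T\<in>subs U. dim T = m}. int (miss T (max i (m - i)))))"
  proof (intro sum.mono_neutral_right ballI)
    fix m assume "m \<in> {..u} - {i..u}"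
    then have "miss T (max i (m - i)) = 0" if "T \<in> {T\<in>subs U. dim T = m}" for T
      using that dimT(2) by (intro miss_eq_0) auto
    then show "w m * (\<Sum>T\<in>{T\<in>subs U. dim T = m}. int (miss T (max i (m - i)))) = 0" by simp
  qed auto
  also have "\<dots> = (\<Sum>m\<in>{i..u}. w m * int (miss U (max i (m - i)) * gbin q (u - max i (m - i)) (m - max i (m - i))))"
  proof (intro sum.cong refl)
    fix m assume "m \<in> {i..u}"
    then have "max i (m - i) \<le> m" by auto
    then show "w m * (\<Sum>T\<in>{T\<in>subs U. dim T = m}. int (miss T (max i (m - i)))) =
       w m * int (miss U (max i (m - i)) * gbin q (u - max i (m - i)) (m - max i (m - i)))"
      unfolding of_nat_sum[symmetric] u_def by (subst sum_miss[OF U]) auto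
  qed
  \<comment> \<open>Up to m = 2i the maximum is i, so all these terms share the factor
    \<open>miss U i\<close>. Beyond, the subspaces counted have dimension m - i > i; in the
    application these terms are errors.\<close>
  also have "{i..u} = {i..2 * i} \<union> {2 * i + 1..u}" using i u_def by auto
  also have "(\<Sum>m\<in>{i..2 * i} \<union> {2 * i + 1..u}. w m * int (miss U (max i (m - i)) * gbin q (u - max i (m - i)) (m - max i (m - i)))) =
      (\<Sum>m\<in>{i..2 * i}. w m * int (miss U (max i (m - i)) * gbin q (u - max i (m - i)) (m - max i (m - i)))) +
      (\<Sum>m\<in>{2 * i + 1..u}. w m * int (miss U (max i (m - i)) * gbin q (u - max i (m - i)) (m - max i (m - i))))"
    by (rule sum.union_disjoint) auto
  also have "(\<Sum>m\<in>{i..2 * i}. w m * int (miss U (max i (m - i)) * gbin q (u - max i (m - i)) (m - max i (m - i)))) =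
      (\<Sum>m\<in>{i..2 * i}. int (miss U i) * (w m * int (gbin q (u - i) (m - i))))"
  proof (intro sum.cong refl)
    fix m assume "m \<in> {i..2 * i}"
    then have "max i (m - i) = i" by auto
    then show "w m * int (miss U (max i (m - i)) * gbin q (u - max i (m - i)) (m - max i (m - i))) =
        int (miss U i) * (w m * int (gbin q (u - i) (m - i)))" by simp
  qed
  also have "\<dots> = int (miss U i) * (\<Sum>m\<in>{i..2 * i}. w m * int (gbin q (u - i) (m - i)))"
    by (simp add: sum_distrib_left)
  \<comment> \<open>With m = i + l this is the truncated sum of
    \<open>gbin_alternating_lower_sum\<close> for s = u - i. The sign from the shift cancels the
    sign of the closed form.\<close>
  also have "(\<Sum>m\<in>{i..2 * i}. w m * int (gbin q (u - i) (m - i))) =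
      (\<Sum>l\<le>i. (-1) ^ i * ((-1) ^ l * int q ^ (((u - i) - l) choose 2) * int (gbin q (u - i) l)))"
    by (rule sum.reindex_bij_witness[of _ "\<lambda>l. l + i" "\<lambda>m. m - i"])
      (auto simp: w_def diff_diff_left power_add[symmetric])
  also have "\<dots> = (-1) ^ i * ((-1) ^ i * int q ^ (((u - i) - i) choose 2) * int (gbin q (u - i - 1) i))"
    unfolding sum_distrib_left[symmetric]
    using gbin_alternating_lower_sum[OF q_ge_2, of i "u - i"] i by (simp add: u_def)
  also have "\<dots> = int q ^ ((u - 2 * i) choose 2) * int (gbin q (u - i - 1) i)"
  proof -
    have "(-1) ^ i * (-1) ^ i = (1 :: int)" by (simp flip: power_mult_distrib)
    moreover have "u - i - i = u - 2 * i" by simp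
    ultimately show ?thesis unfolding mult.assoc[symmetric] by simp
  qed
  also have "(\<Sum>m\<in>{2 * i + 1..u}. w m * int (miss U (max i (m - i)) * gbin q (u - max i (m - i)) (m - max i (m - i)))) =
      (\<Sum>m\<in>{2 * i + 1..u}. (-1) ^ m * int q ^ ((u - m) choose 2) * int (miss U (m - i)) * int (gbin q (u - (m - i)) i))"
  proof (intro sum.cong refl)
    fix m assume "m \<in> {2 * i + 1..u}"
    then have "max i (m - i) = m - i" "m - (m - i) = i" by auto
    then show "w m * int (miss U (max i (m - i)) * gbin q (u - max i (m - i)) (m - max i (m - i))) =
        (-1) ^ m * int q ^ ((u - m) choose 2) * int (miss U (m - i)) * int (gbin q (u - (m - i)) i)"
      by (simp add: w_def)
  qed
  finally show ?thesis unfolding u_def by (simp only: mult.assoc)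
qed

lemma coeff_inv_kl_poly_restriction:
  assumes "U \<in> subs V" "dim (\<Union>(fl U)) = dim U"
  shows "coeff (inv_kl_poly (restriction Mat (fl U))) i = (-1) ^ dim U * coeff (signed_Q U) i"
proof -
  have "signed_Q U = (-1) ^ dim U * inv_kl_poly (restriction Mat (fl U))"
    using assms(2) by (simp add: signed_Q_def km.signed_ikl_def)
  then have "inv_kl_poly (restriction Mat (fl U)) = (-1) ^ dim U * signed_Q U"
    by (simp add: mult.assoc[symmetric] flip: power_mult_distrib)
  then show ?thesis by (cases "even (dim U)") auto
qed

end

section \<open>Coordinate subspaces\<close>

interpretation fq: finite_scalars "scale_fun :: 'f::{field,finite} \<Rightarrow> ('i \<Rightarrow> 'f) \<Rightarrow> 'i \<Rightarrow> 'f"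
  by unfold_locales

definition coord_space :: "'i set \<Rightarrow> ('i \<Rightarrow> 'f::zero) set" where
  "coord_space I = {v. \<forall>i. i \<notin> I \<longrightarrow> v i = 0}"

lemma coord_space_iff: "v \<in> coord_space I \<longleftrightarrow> (\<forall>i. i \<notin> I \<longrightarrow> v i = 0)"
  by (simp add: coord_space_def)

lemma subspace_coord_space: "fvec.subspace (coord_space I :: ('i \<Rightarrow> 'f::field) set)"
  by (rule fvec.subspaceI) (auto simp: coord_space_def scale_fun_def)

lemma coord_space_mono: "I \<subseteq> J \<Longrightarrow> coord_space I \<subseteq> coord_space J"
  by (auto simp: coord_space_def)

lemma sum_fun_apply: "(\<Sum>a\<in>A. f a) x = (\<Sum>a\<in>A. f a x)"
  by (induction A rule: infinite_finite_induct) auto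

lemma span_unit_fun:
  assumes "finite I"
  shows "fvec.span {unit_fun i | i. i \<in> I} = (coord_space I :: ('i \<Rightarrow> 'f::field) set)"
proof
  show "fvec.span {unit_fun i | i. i \<in> I} \<subseteq> (coord_space I :: ('i \<Rightarrow> 'f) set)"
    by (rule fvec.span_minimal[OF _ subspace_coord_space]) (auto simp: coord_space_def unit_fun_def)
  show "(coord_space I :: ('i \<Rightarrow> 'f) set) \<subseteq> fvec.span {unit_fun i | i. i \<in> I}"
  proof
    fix v :: "'i \<Rightarrow> 'f" assume v: "v \<in> coord_space I"
    have "v = (\<Sum>i\<in>I. scale_fun (v i) (unit_fun i))"
    proof
      fix j
      have "(\<Sum>i\<in>I. scale_fun (v i) (unit_fun i)) j = (\<Sum>i\<in>I. if i = j then v i else 0)"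
        unfolding sum_fun_apply by (intro sum.cong) (auto simp: scale_fun_def unit_fun_def)
      also have "\<dots> = v j" using v assms by (auto simp: coord_space_def)
      finally show "v j = (\<Sum>i\<in>I. scale_fun (v i) (unit_fun i)) j" ..
    qed
    also have "\<dots> \<in> fvec.span {unit_fun i | i. i \<in> I}"
      by (intro fvec.span_sum fvec.span_scale fvec.span_base) auto
    finally show "v \<in> fvec.span {unit_fun i | i. i \<in> I}" .
  qed
qed

lemma card_coord_space:
  assumes "finite I"
  shows "finite (coord_space I :: ('i \<Rightarrow> 'f::{zero,finite}) set) \<and>
    card (coord_space I :: ('i \<Rightarrow> 'f) set) = card (UNIV :: 'f set) ^ card I"
  using assms
proof (induction I rule: finite_induct)
  case empty
  have "(coord_space {} :: ('i \<Rightarrow> 'f) set) = {\<lambda>_. 0}" by (auto simp: coord_space_def)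
  then show ?case by simp
next
  case (insert i I)
  have bij: "bij_betw (\<lambda>(c, v). v(i := c)) (UNIV \<times> coord_space I) (coord_space (insert i I) :: ('i \<Rightarrow> 'f) set)"
    by (rule bij_betw_byWitness[where f' = "\<lambda>v. (v i, v(i := 0))"])
      (use insert.hyps in \<open>auto simp: coord_space_def fun_eq_iff\<close>)
  have "finite (UNIV \<times> coord_space I :: ('f \<times> ('i \<Rightarrow> 'f)) set)" using insert by simp
  then show ?case
    using bij_betw_finite[OF bij] bij_betw_same_card[OF bij] insert by (simp add: card_cartesian_product)
qed

lemma finite_coord_space: "finite I \<Longrightarrow> finite (coord_space I :: ('i \<Rightarrow> 'f::{zero,finite}) set)"
  using card_coord_space by blast

lemma dim_coord_space:
  assumes "finite I"
  shows "fvec.dim (coord_space I :: ('i \<Rightarrow> 'f::{field,finite}) set) = card I"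
proof -
  have "card (UNIV :: 'f set) ^ fvec.dim (coord_space I :: ('i \<Rightarrow> 'f) set) = card (UNIV :: 'f set) ^ card I"
    using fq.card_subspace[OF subspace_coord_space finite_coord_space[OF assms], where 'f = 'f, unfolded fq.q_def]
      card_coord_space[OF assms, where 'f = 'f] by simp
  then show ?thesis by (simp only: fq.power_q_inject[where 'f = 'f, unfolded fq.q_def])
qed

section \<open>The elements of the construction\<close>

lemma span_single_scale: "c \<noteq> 0 \<Longrightarrow> fvec.span {scale_fun c v} = fvec.span {v}"
proof
  assume c: "c \<noteq> 0"
  show "fvec.span {scale_fun c v} \<subseteq> fvec.span {v}"
    by (rule fvec.span_minimal) (auto intro: fvec.span_scale fvec.span_base fvec.subspace_span)
  have "v = scale_fun (inverse c) (scale_fun c v)" using c by (simp add: scale_fun_def fun_eq_iff mult.assoc[symmetric])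
  then have "v \<in> fvec.span {scale_fun c v}"
    by (metis fvec.span_scale fvec.span_base singletonI)
  then show "fvec.span {v} \<subseteq> fvec.span {scale_fun c v}"
    by (intro fvec.span_minimal) (auto intro: fvec.subspace_span)
qed

lemma span_single_eqD:
  assumes "fvec.span {v} = fvec.span {w}" shows "\<exists>c. v = scale_fun c w"
  using fvec.span_base[of v "{v}"] unfolding assms by (auto simp: fvec.span_singleton)

text \<open>The field is visible only in types, so \<open>tag\<close> has to fix it.\<close>

locale construction =
  fixes tag :: "'f::{field,finite} itself" and S :: "nat set" and K n :: nat
  assumes finite_S: "finite S" and S_nonempty: "S \<noteq> {}" and S_ge_2: "s \<in> S \<Longrightarrow> 2 \<le> s"
    and K_bound: "Suc (Max S) \<le> K" and n_bound: "20 * K\<^sup>2 \<le> n"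
begin

abbreviation "h \<equiv> card S"

definition VV :: "(label \<Rightarrow> 'f) set" where "VV = space_V S K n"
definition EE :: "(label \<Rightarrow> 'f) set set" where "EE = ground (matroid_M S K n)"

definition "IW = WI ` {1..K}"
definition "IX a = XI a ` {1..dim_X S n a}"
definition "IL a = WI ` {1..ell S a}"
definition "IV = IW \<union> (\<Union>a\<in>{0..h}. IX a)"

lemma mem_index [simp]:
  "WI i \<in> IW \<longleftrightarrow> 1 \<le> i \<and> i \<le> K" "XI b j \<notin> IW"
  "XI b j \<in> IX a \<longleftrightarrow> b = a \<and> 1 \<le> j \<and> j \<le> dim_X S n a" "WI i \<notin> IX a"
  "WI i \<in> IL a \<longleftrightarrow> 1 \<le> i \<and> i \<le> ell S a" "XI b j \<notin> IL a"
  by (auto simp: IW_def IX_def IL_def)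

lemma mem_IV [simp]:
  "WI i \<in> IV \<longleftrightarrow> 1 \<le> i \<and> i \<le> K" "XI b j \<in> IV \<longleftrightarrow> b \<le> h \<and> 1 \<le> j \<and> j \<le> dim_X S n b"
  by (auto simp: IV_def)

lemma finite_index [simp]: "finite IW" "finite (IX a)" "finite (IL a)" "finite IV"
  by (simp_all add: IW_def IX_def IL_def IV_def)

lemma space_W_eq: "(space_W K :: (label \<Rightarrow> 'f) set) = coord_space IW"
proof -
  have "{unit_fun (WI i) | i. i \<in> {1..K}} = {unit_fun j :: label \<Rightarrow> 'f | j. j \<in> IW}" by (auto simp: IW_def)
  then show ?thesis by (simp add: space_W_def span_unit_fun)
qed

lemma space_X_eq: "(space_X S n a :: (label \<Rightarrow> 'f) set) = coord_space (IX a)"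
proof -
  have "{unit_fun (XI a j) | j. j \<in> {1..dim_X S n a}} = {unit_fun j :: label \<Rightarrow> 'f | j. j \<in> IX a}" by (auto simp: IX_def)
  then show ?thesis by (simp add: space_X_def span_unit_fun)
qed

lemma space_L_eq: "(space_L S a :: (label \<Rightarrow> 'f) set) = coord_space (IL a)"
proof -
  have "{unit_fun (WI i) | i. i \<in> {1..ell S a}} = {unit_fun j :: label \<Rightarrow> 'f | j. j \<in> IL a}" by (auto simp: IL_def)
  then show ?thesis by (simp add: space_L_def span_unit_fun)
qed

lemma VV_eq: "VV = coord_space IV"
proof
  show "VV \<subseteq> coord_space IV"
    unfolding VV_def space_V_def space_W_eq space_X_eq
    by (intro fvec.span_minimal subspace_coord_space Un_least UN_least coord_space_mono) (auto simp: IV_def)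
  have "unit_fun j \<in> VV" if j: "j \<in> IV" for j
  proof -
    have "(unit_fun j :: label \<Rightarrow> 'f) \<in> coord_space IW \<union> (\<Union>a\<in>{0..h}. coord_space (IX a))"
      using j by (auto simp: IV_def coord_space_def unit_fun_def)
    then show ?thesis unfolding VV_def space_V_def space_W_eq space_X_eq by (rule fvec.span_base)
  qed
  then show "coord_space IV \<subseteq> VV"
    unfolding span_unit_fun[OF finite_index(4), symmetric]
    by (intro fvec.span_minimal) (auto simp: VV_def space_V_def fvec.subspace_span)
qed

lemma s_elem_in: "a \<in> {1..h} \<Longrightarrow> s_elem S a \<in> S"
proof -
  assume "a \<in> {1..h}"
  then have "a - 1 < length (sorted_list_of_set S)" by auto
  then have "sorted_list_of_set S ! (a - 1) \<in> set (sorted_list_of_set S)" by (rule nth_mem)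
  then show ?thesis unfolding s_elem_def set_sorted_list_of_set[OF finite_S] .
qed

lemma s_elem_less: "1 \<le> a \<Longrightarrow> a < b \<Longrightarrow> b \<le> h \<Longrightarrow> s_elem S a < s_elem S b"
  unfolding s_elem_def
  by (rule sorted_wrt_nth_less[OF strict_sorted_list_of_set]) auto

lemma S_elem_ex: "s \<in> S \<Longrightarrow> \<exists>a\<in>{1..h}. s = s_elem S a"
proof -
  assume "s \<in> S"
  then have "s \<in> set (sorted_list_of_set S)" using finite_S by simp
  then obtain i where "i < h" "s = sorted_list_of_set S ! i" by (auto simp: in_set_conv_nth)
  then show ?thesis by (intro bexI[of _ "Suc i"]) (auto simp: s_elem_def)
qed

lemma s_elem_bounds: "a \<in> {1..h} \<Longrightarrow> 2 \<le> s_elem S a \<and> s_elem S a < K"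
  using s_elem_in[of a] S_ge_2 Max_ge[OF finite_S] K_bound by fastforce

lemma ell_eq: "a \<in> {1..h} \<Longrightarrow> s_elem S a = ell S a + 2"
  using s_elem_bounds[of a] unfolding ell_def by linarith

lemma ell_bound: "a \<in> {1..h} \<Longrightarrow> ell S a + 3 \<le> K"
  using s_elem_bounds[of a] ell_eq[of a] by simp

text \<open>These predicates read off coordinates; the admissible ranges of the labels come from
  membership in \<open>VV\<close>. There, \<open>in_cone a\<close> describes the nonzero multiples
  of w_0 + l + x. Those with x = 0 lie in W, which is why the cone conditions below are often paired
  with the negation of \<open>inW\<close>.\<close>

definition inW :: "(label \<Rightarrow> 'f) \<Rightarrow> bool" where "inW v \<longleftrightarrow> (\<forall>b j. v (XI b j) = 0)"
definition inX :: "nat \<Rightarrow> (label \<Rightarrow> 'f) \<Rightarrow> bool" where "inX a v \<longleftrightarrow> (\<forall>b j. b \<noteq> a \<longrightarrow> v (XI b j) = 0)"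
definition rest :: "nat \<Rightarrow> (label \<Rightarrow> 'f) \<Rightarrow> bool" where
  "rest a v \<longleftrightarrow> (\<forall>i. i \<noteq> K \<longrightarrow> ell S a < i \<longrightarrow> v (WI i) = 0)"
definition in_cone :: "nat \<Rightarrow> (label \<Rightarrow> 'f) \<Rightarrow> bool" where
  "in_cone a v \<longleftrightarrow> v (WI K) \<noteq> 0 \<and> inX a v \<and> rest a v"

text \<open>A vector of the ambient space is bad iff it is zero or spans a line that is not an element.\<close>

definition bad :: "(label \<Rightarrow> 'f) \<Rightarrow> bool" where "bad v \<longleftrightarrow> inW v \<or> (\<exists>a\<in>{1..h}. in_cone a v)"

lemma scale_apply: "scale_fun c v l = c * v l" by (simp add: scale_fun_def)

lemma in_space_W_iff: "v \<in> VV \<Longrightarrow> v \<in> space_W K \<longleftrightarrow> inW v"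
  unfolding space_W_eq VV_eq coord_space_iff inW_def IV_def IW_def IX_def
  by (auto; case_tac i; fastforce)

lemma deleted_imp_in_cone:
  assumes "v \<noteq> 0" "a \<in> {1..h}" "fvec.span {v} \<in> deleted S K n a"
  shows "in_cone a v"
proof -
  obtain l x where l: "l \<in> space_L S a" and x: "x \<in> space_X S n a"
    and sp: "fvec.span {v} = fvec.span {vec_w0 K + l + x}"
    using assms(3) by (auto simp: deleted_def)
  obtain c where c: "v = scale_fun c (vec_w0 K + l + x)" using span_single_eqD[OF sp] by blast
  have c0: "c \<noteq> 0" using c assms(1) by (auto simp: scale_fun_def zero_fun_def)
  have lK: "l (WI K) = 0" "\<And>b j. l (XI b j) = 0" "\<And>i. ell S a < i \<Longrightarrow> l (WI i) = 0"
    using l ell_bound[OF assms(2)] by (simp_all add: space_L_eq coord_space_iff)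
  have xK: "\<And>i. x (WI i) = 0" "\<And>b j. b \<noteq> a \<Longrightarrow> x (XI b j) = 0"
    using x by (simp_all add: space_X_eq coord_space_iff)
  show ?thesis using c0 lK xK unfolding c in_cone_def inX_def rest_def
    by (auto simp: scale_apply vec_w0_def unit_fun_def)
qed

lemma in_cone_imp_deleted:
  assumes v: "v \<in> VV" and a: "a \<in> {1..h}" and in_cone: "in_cone a v"
  shows "fvec.span {v} \<in> deleted S K n a"
proof -
  define c where "c = inverse (v (WI K))"
  have c: "c \<noteq> 0" "c * v (WI K) = 1" using in_cone by (auto simp: in_cone_def c_def)
  define l where "l = (\<lambda>j. case j of WI i \<Rightarrow> if i \<le> ell S a then c * v j else 0 | XI b k \<Rightarrow> 0)"
  define x where "x = (\<lambda>j. case j of WI i \<Rightarrow> 0 | XI b k \<Rightarrow> c * v j)"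
  have v0: "v (WI 0) = 0" "\<And>k. k \<notin> {1..dim_X S n a} \<Longrightarrow> v (XI a k) = 0"
    using v by (auto simp: VV_eq coord_space_iff)
  have "l \<in> space_L S a"
    unfolding space_L_eq coord_space_iff
  proof (intro allI impI)
    fix j assume j: "j \<notin> IL a"
    show "l j = 0"
    proof (cases j)
      case (WI i)
      then have "i = 0 \<or> ell S a < i" using j by (cases "i = 0") (auto simp: IL_def)
      then show ?thesis using WI v0 by (auto simp: l_def)
    qed (simp add: l_def)
  qed
  moreover have "x \<in> space_X S n a"
    unfolding space_X_eq coord_space_iff
  proof (intro allI impI)
    fix j assume j: "j \<notin> IX a"
    show "x j = 0"
    proof (cases j)
      case (XI b k)
      then show ?thesis using j in_cone v0(2)[of k] by (cases "b = a") (auto simp: x_def in_cone_def inX_def)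
    qed (simp add: x_def)
  qed
  moreover have "scale_fun c v = vec_w0 K + l + x"
  proof
    fix j
    show "scale_fun c v j = (vec_w0 K + l + x) j"
    proof (cases j)
      case (WI i)
      consider "i = K" | "i \<noteq> K" "i \<le> ell S a" | "i \<noteq> K" "ell S a < i" by linarith
      then show ?thesis
      proof cases
        case 3
        then show ?thesis using in_cone WI by (simp add: scale_apply l_def x_def vec_w0_def unit_fun_def in_cone_def rest_def)
      qed (use c WI ell_bound[OF a] in \<open>auto simp: scale_apply l_def x_def vec_w0_def unit_fun_def\<close>)
    qed (simp add: scale_apply l_def x_def vec_w0_def unit_fun_def)
  qed
  ultimately show ?thesis
    unfolding deleted_def using span_single_scale[OF c(1), of v] by fastforce
qed

lemma EE_iff:
  assumes v: "v \<in> VV" "v \<noteq> 0"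
  shows "fvec.span {v} \<in> EE \<longleftrightarrow> \<not> bad v"
proof -
  have 1: "fvec.span {v} \<in> proj_points U \<longleftrightarrow> v \<in> U" if "fvec.subspace U" for U
  proof
    assume "fvec.span {v} \<in> proj_points U"
    then obtain w where w: "w \<in> U" "fvec.span {v} = fvec.span {w}" by (auto simp: proj_points_def)
    then have "v \<in> fvec.span {w}" using fvec.span_base[of v "{v}"] by simp
    moreover have "fvec.span {w} \<subseteq> U" using w that by (intro fvec.span_minimal) auto
    ultimately show "v \<in> U" by blast
  qed (use v in \<open>auto simp: proj_points_def\<close>)
  have "fvec.span {v} \<in> proj_points VV" "fvec.span {v} \<in> proj_points (space_W K) \<longleftrightarrow> inW v"
    using v 1[of VV] 1[of "space_W K"] in_space_W_iff by (simp_all add: VV_eq space_W_eq subspace_coord_space)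
  moreover have "(\<exists>a\<in>{1..h}. fvec.span {v} \<in> deleted S K n a) \<longleftrightarrow> (\<exists>a\<in>{1..h}. in_cone a v)"
    using deleted_imp_in_cone[OF v(2)] in_cone_imp_deleted[OF v(1)] by blast
  ultimately show ?thesis
    unfolding EE_def matroid_M_def bad_def VV_def[symmetric] by simp
qed

sublocale pm: point_matroid "scale_fun :: 'f \<Rightarrow> (label \<Rightarrow> 'f) \<Rightarrow> label \<Rightarrow> 'f" VV EE
proof unfold_locales
  fix e assume "e \<in> EE"
  then have "e \<in> proj_points VV" by (simp add: EE_def matroid_M_def VV_def)
  then show "\<exists>v\<in>VV. v \<noteq> 0 \<and> e = fvec.span {v}" by (auto simp: proj_points_def)
qed (simp_all add: VV_eq subspace_coord_space finite_coord_space)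

section \<open>Subspaces and the span of their elements\<close>

lemma Mat_eq: "pm.Mat = matroid_M S K n"
  unfolding pm.Mat_def by (simp add: EE_def matroid_M_def)

lemma bad_0: "bad 0" by (simp add: bad_def inW_def)

lemma fl_eq:
  assumes "T \<in> pm.subs VV" shows "pm.fl T = (\<lambda>v. fvec.span {v}) ` {v\<in>T. \<not> bad v}"
proof (intro equalityI subsetI)
  fix e assume "e \<in> pm.fl T"
  then have e: "e \<in> EE" "e \<subseteq> T" by (auto simp: pm.fl_def)
  then obtain v where v: "v \<in> e" "v \<noteq> 0" "e = fvec.span {v}" using pm.point_nonzero by blast
  then have "v \<in> T" "v \<in> VV" using e assms pm.subsD by blast+
  then have "\<not> bad v" using EE_iff[of v] v e by simp
  then show "e \<in> (\<lambda>v. fvec.span {v}) ` {v\<in>T. \<not> bad v}" using v \<open>v \<in> T\<close> by blast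
next
  fix e assume "e \<in> (\<lambda>v. fvec.span {v}) ` {v\<in>T. \<not> bad v}"
  then obtain v where v: "v \<in> T" "\<not> bad v" "e = fvec.span {v}" by blast
  then have "v \<noteq> 0" using bad_0 by blast
  moreover have "v \<in> VV" using v assms pm.subsD by blast
  ultimately have "e \<in> EE" using EE_iff[of v] v by simp
  moreover have "e \<subseteq> T" using v pm.subsD(1)[OF assms] by (simp add: fq.span_subset_iff)
  ultimately show "e \<in> pm.fl T" by (simp add: pm.fl_def)
qed

lemma fl_empty_iff: "T \<in> pm.subs VV \<Longrightarrow> pm.fl T = {} \<longleftrightarrow> (\<forall>v\<in>T. bad v)"
  by (auto simp: fl_eq)

lemma good_in_lspan: "T \<in> pm.subs VV \<Longrightarrow> v \<in> T \<Longrightarrow> \<not> bad v \<Longrightarrow> v \<in> pm.lspan (pm.fl T)"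
  unfolding pm.lspan_def by (rule fvec.span_base) (auto simp: fl_eq intro: fvec.span_base)

lemma lspan_fl_subs: "T \<in> pm.subs VV \<Longrightarrow> pm.lspan (pm.fl T) \<in> pm.subs VV"
  using pm.lspan_subs[OF pm.fl_subset] .

text \<open>The sum of the X_a is direct, so different cones meet only inside W.\<close>

lemma inX_inW: "inX a v \<Longrightarrow> inX b v \<Longrightarrow> a \<noteq> b \<Longrightarrow> inW v"
  unfolding inX_def inW_def by metis

lemma inW_inX: "inW v \<Longrightarrow> inX a v" by (simp add: inX_def inW_def)

lemma inW_add: "inW v \<Longrightarrow> inW w \<Longrightarrow> inW (v + w)" and inW_diff: "inW v \<Longrightarrow> inW w \<Longrightarrow> inW (v - w)"
  and inW_scale: "inW v \<Longrightarrow> inW (scale_fun c v)"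
  by (simp_all add: inW_def scale_apply)

lemma inX_add: "inX a v \<Longrightarrow> inX a w \<Longrightarrow> inX a (v + w)" and inX_diff: "inX a v \<Longrightarrow> inX a w \<Longrightarrow> inX a (v - w)"
  and inX_scale: "inX a v \<Longrightarrow> inX a (scale_fun c v)"
  by (simp_all add: inX_def scale_apply)

lemma rest_add: "rest a v \<Longrightarrow> rest a w \<Longrightarrow> rest a (v + w)" and rest_diff: "rest a v \<Longrightarrow> rest a w \<Longrightarrow> rest a (v - w)"
  and rest_scale: "rest a v \<Longrightarrow> rest a (scale_fun c v)"
  by (simp_all add: rest_def scale_apply)

lemma bad_not_inW: "bad v \<Longrightarrow> \<not> inW v \<Longrightarrow> \<exists>a\<in>{1..h}. in_cone a v"
  by (simp add: bad_def)

lemma bad_kap_0: "bad v \<Longrightarrow> v (WI K) = 0 \<Longrightarrow> inW v"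
  by (auto simp: bad_def in_cone_def)

lemma fl_nonempty_good:
  assumes "T \<in> pm.subs VV" "pm.fl T \<noteq> {}"
  obtains g where "g \<in> T" "\<not> bad g" "g \<in> pm.lspan (pm.fl T)"
  using fl_empty_iff[OF assms(1)] assms good_in_lspan by blast

lemma rest_scale_iff: "c \<noteq> 0 \<Longrightarrow> rest a (scale_fun c v) \<longleftrightarrow> rest a v"
  by (simp add: rest_def scale_apply)

text \<open>
  Let \<open>G\<close> be the span of the elements in \<open>T\<close>. All vectors of \<open>T\<close> outside of \<open>G\<close> are bad, and a bad vector
  with vanishing coordinate at \<open>e\<^sub>K\<close> lies in \<open>W\<close>. The case treated first occurs only over the field with two
  elements: a point of \<open>W\<close>, one of some \<open>C\<^sub>a\<close> and an element on a common line.
\<close>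

lemma structure_in_kernel:
  assumes T: "T \<in> pm.subs VV" and ne: "pm.fl T \<noteq> {}"
    and w: "w \<in> T" "w \<notin> pm.lspan (pm.fl T)" "w (WI K) = 0"
  shows "T = fvec.span (insert w (pm.lspan (pm.fl T)))"
    and "\<forall>u\<in>pm.lspan (pm.fl T). inW u \<or> \<not> bad u"
    and "\<exists>a\<in>{1..h}. \<exists>T0\<in>pm.subs T. (\<forall>t\<in>T0. inW t) \<and> fvec.dim T \<le> Suc (fvec.dim T0) \<and> (\<forall>t\<in>T. inX a t)"
proof -
  define G where "G = pm.lspan (pm.fl T)"
  have Ts: "fvec.subspace T" and TV: "T \<subseteq> VV" using T pm.subsD by blast+
  have Gs: "fvec.subspace G" by (simp add: G_def pm.lspan_def fvec.subspace_span)
  have GT: "G \<subseteq> T" unfolding G_def by (rule pm.lspan_fl[OF Ts])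
  note add = fvec.subspace_add[OF Ts] and diff = fvec.subspace_diff[OF Ts] and scale = fvec.subspace_scale[OF Ts]
  note Gadd = fvec.subspace_add[OF Gs] and Gdiff = fvec.subspace_diff[OF Gs] and Gscale = fvec.subspace_scale[OF Gs]
  have notG: "bad t" if "t \<in> T" "t \<notin> G" for t
    using good_in_lspan[OF T] that by (auto simp: G_def)
  have wG: "w \<notin> G" using w by (simp add: G_def)
  obtain g where g: "g \<in> T" "\<not> bad g" "g \<in> G"
    using fl_nonempty_good[OF T ne] unfolding G_def by blast
  have ng: "\<not> inW g" using g by (simp add: bad_def)
  have wW: "inW w" using bad_kap_0[OF notG[OF w(1) wG] w(3)] .
  have shift: "t + x \<notin> G" if "t \<in> G" "x \<notin> G" for t x
    using Gdiff[of "t + x" t] that by auto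
  \<comment> \<open>If t lies in G, then t + w does not; so t + w is bad, and its coordinate at e_K
    still vanishes.\<close>
  have kerW: "inW t" if t: "t \<in> T" "t (WI K) = 0" for t
  proof (cases "t \<in> G")
    case True
    have "inW (t + w)"
      using bad_kap_0[OF notG[OF add[OF t(1) w(1)] shift[OF True wG]]] t w by simp
    then have "inW (t + w - w)" using wW by (rule inW_diff)
    then show ?thesis by simp
  next
    case False
    then show ?thesis using bad_kap_0[OF notG[OF t(1) False] t(2)] by simp
  qed
  have kg: "g (WI K) \<noteq> 0" using kerW[OF g(1)] ng by blast
  have key0: "\<exists>a\<in>{1..h}. in_cone a (g + x)" if x: "x \<in> T" "x \<notin> G" "x (WI K) = 0" for x
  proof -
    have "bad (g + x)" by (rule notG[OF add[OF g(1) x(1)] shift[OF g(3) x(2)]])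
    moreover have "\<not> inW (g + x)" using inW_diff[of "g + x" x] kerW[OF x(1,3)] ng by auto
    ultimately show ?thesis by (rule bad_not_inW)
  qed
  obtain a where a: "a \<in> {1..h}" "in_cone a (g + w)" using key0[OF w(1) wG w(3)] by blast
  have Xg: "inX a g"
    using inX_diff[of a "g + w" w] a(2) inW_inX[OF wW] by (simp add: in_cone_def)
  have key: "rest a (g + x)" if x: "x \<in> T" "x \<notin> G" "x (WI K) = 0" for x
  proof -
    obtain a' where a': "in_cone a' (g + x)" using key0[OF x] by blast
    then have "inX a' g" using inX_diff[of a' "g + x" x] inW_inX[OF kerW[OF x(1,3)]] by (simp add: in_cone_def)
    then have "a' = a" using inX_inW Xg ng by blast
    then show ?thesis using a' by (simp add: in_cone_def)
  qed
  have nrest: "\<not> rest a g" using g(2) kg Xg a(1) by (auto simp: bad_def in_cone_def)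
  define co where "co = (\<lambda>t. t (WI K) / g (WI K))"
  define pr where "pr = (\<lambda>t. t - scale_fun (co t) g)"
  have pr: "pr t \<in> T" "pr t (WI K) = 0" "t = pr t + scale_fun (co t) g" if "t \<in> T" for t
    using that diff[OF that scale[OF g(1)]] kg by (auto simp: pr_def co_def scale_apply)
  show "T = fvec.span (insert w (pm.lspan (pm.fl T)))"
  proof
    show "fvec.span (insert w (pm.lspan (pm.fl T))) \<subseteq> T"
      using Ts w GT by (intro fvec.span_minimal) (auto simp: G_def)
    show "T \<subseteq> fvec.span (insert w (pm.lspan (pm.fl T)))"
    proof
      fix t assume t: "t \<in> T"
      let ?Sp = "fvec.span (insert w G)"
      have GS: "x \<in> ?Sp" if "x \<in> G" for x using that by (intro fvec.span_base) auto
      have wS: "w \<in> ?Sp" by (intro fvec.span_base) auto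
      have "pr t \<in> ?Sp"
      proof (cases "pr t \<in> G")
        case False
        have "pr t - w \<in> G"
        proof (rule ccontr)
          assume n: "pr t - w \<notin> G"
          have r1: "rest a (g + (pr t - w))"
            using key[OF diff[OF pr(1)[OF t] w(1)] n] pr(2)[OF t] w(3) by simp
          have r2: "rest a (g + pr t)" using key[OF pr(1)[OF t] False pr(2)[OF t]] .
          have r3: "rest a (g + w)" using key[OF w(1) wG w(3)] .
          \<comment> \<open>The combination equals g, for which \<open>rest a\<close> fails. Hence
            the vectors of T outside G with vanishing coordinate at e_K form a single coset w + G
            within that hyperplane.\<close>
          have "rest a ((g + w) + (g + (pr t - w)) - (g + pr t))"
            by (rule rest_diff[OF rest_add[OF r3 r1] r2])
          then show False using nrest by (simp add: algebra_simps)
        qed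
        then have "(pr t - w) + w \<in> ?Sp" using GS wS fvec.span_add by blast
        then show ?thesis by simp
      qed (rule GS)
      then have "pr t + scale_fun (co t) g \<in> ?Sp" by (rule fvec.span_add[OF _ fvec.span_scale[OF GS[OF g(3)]]])
      then show "t \<in> fvec.span (insert w (pm.lspan (pm.fl T)))" using pr(3)[OF t] by (simp add: G_def)
    qed
  qed
  have allX: "inX a t" if t: "t \<in> T" for t
    using inX_add[OF inW_inX[OF kerW[OF pr(1,2)[OF t]]] inX_scale[OF Xg, of "co t"]] pr(3)[OF t] by simp
  show "\<forall>u\<in>pm.lspan (pm.fl T). inW u \<or> \<not> bad u"
  proof (rule ccontr)
    assume "\<not> ?thesis"
    then obtain u where u: "u \<in> G" "\<not> inW u" "bad u" by (auto simp: G_def)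
    then obtain b where b: "in_cone b u" using bad_not_inW by blast
    have uT: "u \<in> T" using u GT by blast
    have "b = a" using b inX_inW[of b u a] allX[OF uT] u by (auto simp: in_cone_def)
    then have ru: "rest a u" and ku: "u (WI K) \<noteq> 0" using b by (auto simp: in_cone_def)
    have prG: "pr u \<in> G" unfolding pr_def by (rule Gdiff[OF u(1) Gscale[OF g(3)]])
    \<comment> \<open>Adding w pushes both g and g + pr u out of G into the cone. Their difference
      pr u then satisfies \<open>rest a\<close>, and so would the nonzero multiple u - pr u of
      g.\<close>
    have "rest a (g + (pr u + w))"
      using key[OF add[OF pr(1)[OF uT] w(1)] shift[OF prG wG]] pr(2)[OF uT] w(3) by simp
    then have "rest a ((g + (pr u + w)) - (g + w))" using key[OF w(1) wG w(3)] by (rule rest_diff)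
    then have "rest a (pr u)" by (simp add: algebra_simps)
    then have "rest a (u - pr u)" by (rule rest_diff[OF ru])
    then have "rest a (scale_fun (co u) g)" by (simp add: pr_def)
    then show False using nrest rest_scale_iff[of "co u" a g] ku kg by (simp add: co_def)
  qed
  define T0 where "T0 = {t\<in>T. t (WI K) = 0}"
  have T0s: "fvec.subspace T0"
    using add scale fvec.subspace_0[OF Ts] by (intro fvec.subspaceI) (auto simp: T0_def scale_apply)
  have T0f: "finite T0" using pm.finite_sub[OF T] by (simp add: T0_def)
  have "T \<subseteq> fvec.span (insert g T0)"
  proof
    fix t assume t: "t \<in> T"
    have "pr t \<in> fvec.span (insert g T0)" "g \<in> fvec.span (insert g T0)"
      using pr[OF t] by (auto intro!: fvec.span_base simp: T0_def)
    then have "pr t + scale_fun (co t) g \<in> fvec.span (insert g T0)"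
      by (intro fvec.span_add fvec.span_scale)
    then show "t \<in> fvec.span (insert g T0)" using pr(3)[OF t] by simp
  qed
  moreover have "fvec.span (insert g T0) \<subseteq> T"
    using Ts g by (intro fvec.span_minimal) (auto simp: T0_def)
  ultimately have "T = fvec.span (insert g T0)" by simp
  moreover have "fvec.dim (fvec.span (insert g T0)) = Suc (fvec.dim (fvec.span T0))"
  proof (rule fq.dim_span_insert)
    show "finite (fvec.span T0)" unfolding fq.span_subspace'[OF T0s] by (rule T0f)
    show "g \<notin> fvec.span T0" unfolding fq.span_subspace'[OF T0s] by (simp add: T0_def kg)
  qed
  ultimately have "fvec.dim T = Suc (fvec.dim T0)" by (metis fvec.dim_span)
  then have "fvec.dim T \<le> Suc (fvec.dim T0)" by simp
  moreover have "T0 \<in> pm.subs T" using T0s by (auto simp: pm.subs_def T0_def)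
  moreover have "\<forall>t\<in>T0. inW t" using kerW by (auto simp: T0_def)
  ultimately show "\<exists>a\<in>{1..h}. \<exists>T0\<in>pm.subs T. (\<forall>t\<in>T0. inW t) \<and> fvec.dim T \<le> Suc (fvec.dim T0) \<and> (\<forall>t\<in>T. inX a t)"
    using a(1) allX by blast
qed

text \<open>
  Over the field with two elements, \<open>G\<close> may contain a vector \<open>g\<close> such that \<open>v\<close> and \<open>v + g\<close> lie in different
  \<open>C\<^sub>a\<close> and \<open>C\<^sub>b\<close>; then \<open>G \<subseteq> W + span {g}\<close>. Otherwise \<open>b = a\<close>.
\<close>

lemma structure_outside_kernel:
  assumes T: "T \<in> pm.subs VV" and ne: "pm.fl T \<noteq> {}"
    and ker: "\<And>t. t \<in> T \<Longrightarrow> t (WI K) = 0 \<Longrightarrow> t \<in> pm.lspan (pm.fl T)" and neq: "T \<noteq> pm.lspan (pm.fl T)"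
  shows "\<exists>v. T = fvec.span (insert v (pm.lspan (pm.fl T)))"
    and "\<forall>u\<in>pm.lspan (pm.fl T). inW u \<or> \<not> bad u"
    and "\<exists>a\<in>{1..h}. \<exists>b\<in>{1..h}. \<exists>v\<in>T. \<not> inW v \<and> in_cone a v \<and>
      (\<forall>u\<in>pm.lspan (pm.fl T). u (WI K) = 0 \<and> (inW u \<longrightarrow> rest a u)) \<and>
      (\<forall>t\<in>T. \<exists>c. inX b (t - scale_fun c v))"
proof -
  define G where "G = pm.lspan (pm.fl T)"
  have Ts: "fvec.subspace T" and TV: "T \<subseteq> VV" using T pm.subsD by blast+
  have Gs: "fvec.subspace G" by (simp add: G_def pm.lspan_def fvec.subspace_span)
  have GT: "G \<subseteq> T" unfolding G_def by (rule pm.lspan_fl[OF Ts])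
  note add = fvec.subspace_add[OF Ts] and diff = fvec.subspace_diff[OF Ts] and scale = fvec.subspace_scale[OF Ts]
  note Gadd = fvec.subspace_add[OF Gs] and Gdiff = fvec.subspace_diff[OF Gs] and Gscale = fvec.subspace_scale[OF Gs]
  have notG: "bad t" if "t \<in> T" "t \<notin> G" for t
    using good_in_lspan[OF T] that by (auto simp: G_def)
  have shift: "x + t \<notin> G" if "t \<in> G" "x \<notin> G" for t x
    using Gdiff[of "x + t" t] that by auto
  obtain g where g: "g \<in> T" "\<not> bad g" "g \<in> G"
    using fl_nonempty_good[OF T ne] unfolding G_def by blast
  have ng: "\<not> inW g" using g by (simp add: bad_def)
  obtain v1 where v1: "v1 \<in> T" "v1 \<notin> G" using GT neq by (auto simp: G_def)
  \<comment> \<open>Otherwise subtracting a suitable multiple of u from v1 would reach coordinate 0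
    at e_K, where T is contained in G.\<close>
  have kG: "u (WI K) = 0" if u: "u \<in> G" for u
  proof (rule ccontr)
    assume ku: "u (WI K) \<noteq> 0"
    define c where "c = v1 (WI K) / u (WI K)"
    have "v1 - scale_fun c u \<in> G"
      using ker[OF diff[OF v1(1) scale[of u c]]] u GT ku by (auto simp: G_def scale_apply c_def)
    then have "v1 - scale_fun c u + scale_fun c u \<in> G" by (intro Gadd Gscale u)
    then show False using v1 by simp
  qed
  obtain v where v: "v \<in> T" "v \<notin> G" "\<not> inW v"
  proof (cases "inW v1")
    case True
    have "\<not> inW (v1 + g)" using inW_diff[of "v1 + g" v1] True ng by auto
    then show ?thesis using that[of "v1 + g"] add[OF v1(1) g(1)] shift[OF g(3) v1(2)] by blast
  next
    case False
    then show ?thesis using that v1 by blast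
  qed
  obtain a where a: "a \<in> {1..h}" "in_cone a v" using bad_not_inW[OF notG[OF v(1,2)] v(3)] by blast
  have kv: "v (WI K) \<noteq> 0" and Xv: "inX a v" using a by (auto simp: in_cone_def)
  define co where "co = (\<lambda>t. t (WI K) / v (WI K))"
  define pr where "pr = (\<lambda>t. t - scale_fun (co t) v)"
  have pr: "pr t \<in> G" "t = pr t + scale_fun (co t) v" if t: "t \<in> T" for t
    using ker[OF diff[OF t scale[OF v(1)]]] kv by (auto simp: pr_def co_def scale_apply G_def)
  have "T = fvec.span (insert v G)"
  proof
    show "fvec.span (insert v G) \<subseteq> T"
      using Ts v GT by (intro fvec.span_minimal) auto
    show "T \<subseteq> fvec.span (insert v G)"
    proof
      fix t assume t: "t \<in> T"
      have "pr t \<in> fvec.span (insert v G)" "v \<in> fvec.span (insert v G)"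
        using pr[OF t] by (auto intro!: fvec.span_base)
      then have "pr t + scale_fun (co t) v \<in> fvec.span (insert v G)"
        by (intro fvec.span_add fvec.span_scale)
      then show "t \<in> fvec.span (insert v G)" using pr(2)[OF t] by simp
    qed
  qed
  then show "\<exists>v. T = fvec.span (insert v (pm.lspan (pm.fl T)))" by (auto simp: G_def)
  show "\<forall>u\<in>pm.lspan (pm.fl T). inW u \<or> \<not> bad u"
    using kG bad_kap_0 by (auto simp: G_def)
  have r: "rest a u" if u: "u \<in> G" "inW u" for u
  proof -
    have "\<not> inW (v + u)" using inW_diff[of "v + u" u] u v by auto
    then obtain a' where a': "in_cone a' (v + u)"
      using bad_not_inW[OF notG[OF add[OF v(1)] shift[OF u(1) v(2)]]] u GT by blast
    have "inX a' v" using inX_diff[of a' "v + u" u] a' inW_inX[OF u(2)] by (simp add: in_cone_def)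
    then have "a' = a" using inX_inW Xv v(3) by blast
    then have "rest a (v + u)" "rest a v" using a a' by (auto simp: in_cone_def)
    then have "rest a ((v + u) - v)" by (rule rest_diff)
    then show ?thesis by simp
  qed
  have "\<exists>b\<in>{1..h}. \<forall>t\<in>T. \<exists>c. inX b (t - scale_fun c v)"
  proof (cases "\<forall>u\<in>G. inX a u")
    case True
    then show ?thesis using a(1) pr unfolding pr_def by blast
  next
    case False
    then obtain g1 where g1: "g1 \<in> G" "\<not> inX a g1" by blast
    \<comment> \<open>A second bad vector outside G, whose X-part lies in a different X_b. Together
      v and y determine all possible X-parts of vectors in G.\<close>
    define y where "y = v + g1"
    have yT: "y \<in> T" "y \<notin> G" using add[OF v(1)] shift[OF g1(1) v(2)] g1 GT by (auto simp: y_def)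
    have nXy: "\<not> inX a y" using inX_diff[OF _ Xv, of y] g1 by (auto simp: y_def)
    then have nWy: "\<not> inW y" using inW_inX by blast
    obtain b where b: "b \<in> {1..h}" "in_cone b y" using bad_not_inW[OF notG[OF yT] nWy] by blast
    have Xy: "inX b y" using b by (simp add: in_cone_def)
    have ab: "a \<noteq> b" using nXy Xy by blast
    have badX: "\<exists>c. inX c t" if "bad t" for t
      using that inW_inX by (auto simp: bad_def in_cone_def)
    obtain ja where ja: "v (XI a ja) \<noteq> 0" using v(3) Xv unfolding inW_def inX_def by metis
    obtain jb where jb: "y (XI b jb) \<noteq> 0" using nWy Xy unfolding inW_def inX_def by metis
    have y0: "y (XI d j) = 0" if "d \<noteq> b" for d j using Xy that by (simp add: inX_def)
    have v0: "v (XI d j) = 0" if "d \<noteq> a" for d j using Xv that by (simp add: inX_def)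
    \<comment> \<open>Both v + u and y + u are bad, so their X-parts lie in single summands c1 and
      c2. Their difference v - y has nonzero parts in X_a and X_b, so c1 and c2 are a and b in some
      order; the two orders yield the two alternatives.\<close>
    have dich: "inW u \<or> (\<forall>d j. u (XI d j) = - v (XI d j) - y (XI d j))" if u: "u \<in> G" for u
    proof -
      have uT: "u \<in> T" using u GT by blast
      obtain c1 where c1: "inX c1 (v + u)" using badX[OF notG[OF add[OF v(1) uT] shift[OF u v(2)]]] by blast
      obtain c2 where c2: "inX c2 (y + u)" using badX[OF notG[OF add[OF yT(1) uT] shift[OF u yT(2)]]] by blast
      have e1: "v (XI d j) + u (XI d j) = 0" if "c1 \<noteq> d" for d j using c1 that by (simp add: inX_def)
      have e2: "y (XI d j) + u (XI d j) = 0" if "c2 \<noteq> d" for d j using c2 that by (simp add: inX_def)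
      have "c1 = a \<or> c2 = a"
      proof (rule ccontr)
        assume "\<not> ?thesis"
        then have "c1 \<noteq> a" "c2 \<noteq> a" by auto
        then show False using e1[of a ja] e2[of a ja] y0[OF ab, of ja] ja by simp
      qed
      moreover have "c1 = b \<or> c2 = b"
      proof (rule ccontr)
        assume "\<not> ?thesis"
        then have "c1 \<noteq> b" "c2 \<noteq> b" by auto
        then show False using e1[of b jb] e2[of b jb] v0[of b jb] ab jb by auto
      qed
      ultimately consider "c1 = a" "c2 = b" | "c1 = b" "c2 = a" using ab by blast
      then show ?thesis
      proof cases
        case 1
        have "u (XI d j) = 0" for d j
          using e1[of d j] e2[of d j] v0[of d j] y0[of d j] 1 ab by (cases "d = a") auto
        then show ?thesis by (simp add: inW_def)
      next
        case 2
        have "u (XI d j) = - v (XI d j) - y (XI d j)" for d j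
          using e1[of d j] e2[of d j] v0[of d j] y0[of d j] 2 ab
          by (cases "d = b") (auto simp: eq_neg_iff_add_eq_0 add.commute)
        then show ?thesis by blast
      qed
    qed
    have ng1: "\<not> inW g1" using g1 inW_inX by blast
    have "\<exists>c. inX b (t - scale_fun c v)" if t: "t \<in> T" for t
    proof (cases "inW (pr t)")
      case True
      then show ?thesis using inW_inX unfolding pr_def by blast
    next
      case False
      have "inW (pr t - g1)"
        using dich[OF pr(1)[OF t]] dich[OF g1(1)] False ng1 unfolding inW_def by auto
      then have "inX b ((pr t - g1) + y)" by (rule inX_add[OF inW_inX Xy])
      \<comment> \<open>As y contains v once, the coefficient of v drops by one.\<close>
      moreover have "(pr t - g1) + y = t - scale_fun (co t - 1) v"
        by (simp add: pr_def y_def fun_eq_iff scale_apply algebra_simps)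
      ultimately show ?thesis by metis
    qed
    then show ?thesis using b(1) by blast
  qed
  then show "\<exists>a\<in>{1..h}. \<exists>b\<in>{1..h}. \<exists>v\<in>T. \<not> inW v \<and> in_cone a v \<and>
      (\<forall>u\<in>pm.lspan (pm.fl T). u (WI K) = 0 \<and> (inW u \<longrightarrow> rest a u)) \<and>
      (\<forall>t\<in>T. \<exists>c. inX b (t - scale_fun c v))"
    using a v kG r unfolding G_def by blast
qed

end

context construction
begin

section \<open>The codimension bound and the middle correction\<close>

lemma q_ge_2: "2 \<le> pm.q" by (rule fq.q_ge_2)

lemma q_power_mono: "a \<le> b \<Longrightarrow> pm.q ^ a \<le> pm.q ^ b"
  using q_ge_2 by (intro power_increasing) auto

lemma subs_eq_between: "pm.subs T = fq.subspaces_between {0} T"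
  by (auto simp: pm.subs_def fq.subspaces_between_def fvec.subspace_0)

lemma card_subs:
  assumes "fvec.subspace T" "finite T"
  shows "card {U\<in>pm.subs T. fvec.dim U = i} = gbin pm.q (fvec.dim T) i"
  using fq.card_subspaces_between[OF fvec.subspace_single_0 assms, of i] fvec.subspace_0[OF assms(1)]
  by (simp add: subs_eq_between fq.dim_zero_subspace)

lemma exists_subspace:
  assumes "fvec.subspace T" "finite T" "i \<le> fvec.dim T"
  obtains U where "U \<in> pm.subs T" "fvec.dim U = i"
proof -
  have "card {U\<in>pm.subs T. fvec.dim U = i} > 0"
    using card_subs[OF assms(1,2)] gbin_pos[of pm.q i "fvec.dim T"] q_ge_2 assms(3) by simp
  then have "{U\<in>pm.subs T. fvec.dim U = i} \<noteq> {}" by (metis card.empty less_irrefl)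
  then show ?thesis using that by blast
qed

lemma dim_lspan_fl: "fvec.dim (pm.lspan (pm.fl T)) = fvec.dim (\<Union>(pm.fl T))"
  by (rule pm.dim_lspan)

lemma dim_insert_le:
  assumes "G \<in> pm.subs VV" "T = fvec.span (insert v G)"
  shows "fvec.dim T \<le> Suc (fvec.dim G)"
proof (cases "v \<in> G")
  case True
  then have "T = fvec.span G" using assms by (simp add: insert_absorb)
  then show ?thesis by simp
next
  case False
  have sp: "fvec.span G = G" using pm.subsD(1)[OF assms(1)] by (rule fq.span_subspace')
  have "fvec.dim (fvec.span (insert v G)) = Suc (fvec.dim (fvec.span G))"
  proof (rule fq.dim_span_insert)
    show "finite (fvec.span G)" unfolding sp by (rule pm.finite_sub[OF assms(1)])
    show "v \<notin> fvec.span G" unfolding sp by (rule False)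
  qed
  then show ?thesis by (simp only: assms(2) sp)
qed

lemma defect_structure:
  assumes T: "T \<in> pm.subs VV" and ne: "pm.fl T \<noteq> {}" and neq: "T \<noteq> pm.lspan (pm.fl T)"
  shows "fvec.dim T \<le> Suc (fvec.dim (pm.lspan (pm.fl T)))"
    and "\<forall>u\<in>pm.lspan (pm.fl T). inW u \<or> \<not> bad u"
proof -
  have "(\<exists>v. T = fvec.span (insert v (pm.lspan (pm.fl T)))) \<and> (\<forall>u\<in>pm.lspan (pm.fl T). inW u \<or> \<not> bad u)"
  proof (cases "\<exists>w\<in>T. w \<notin> pm.lspan (pm.fl T) \<and> w (WI K) = 0")
    case True
    then obtain w where w: "w \<in> T" "w \<notin> pm.lspan (pm.fl T)" "w (WI K) = 0" by blast
    show ?thesis using structure_in_kernel(1,2)[OF T ne w] by blast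
  next
    case False
    then have "\<And>t. t \<in> T \<Longrightarrow> t (WI K) = 0 \<Longrightarrow> t \<in> pm.lspan (pm.fl T)" by blast
    from structure_outside_kernel(1,2)[OF T ne this neq] show ?thesis by blast
  qed
  then show "fvec.dim T \<le> Suc (fvec.dim (pm.lspan (pm.fl T)))"
    and "\<forall>u\<in>pm.lspan (pm.fl T). inW u \<or> \<not> bad u"
    using dim_insert_le[OF lspan_fl_subs[OF T]] by blast+
qed

sublocale nm: near_point_matroid "scale_fun :: 'f \<Rightarrow> (label \<Rightarrow> 'f) \<Rightarrow> label \<Rightarrow> 'f" VV EE
proof unfold_locales
  fix T assume T: "T \<in> pm.subs VV" "pm.fl T \<noteq> {}"
  show "fvec.dim T \<le> Suc (fvec.dim (\<Union>(pm.fl T)))"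
    using defect_structure(1)[OF T] by (cases "T = pm.lspan (pm.fl T)") (metis dim_lspan_fl le_SucI order_refl)+
qed

definition Wpart :: "(label \<Rightarrow> 'f) set \<Rightarrow> (label \<Rightarrow> 'f) set" where "Wpart G = {u\<in>G. inW u}"

lemma subspace_Wpart: "fvec.subspace G \<Longrightarrow> fvec.subspace (Wpart G)"
  using inW_add inW_scale by (intro fvec.subspaceI) (auto simp: Wpart_def inW_def scale_apply fvec.subspace_0 fvec.subspace_add fvec.subspace_scale)

lemma dim_Wpart_le:
  assumes G: "G \<in> pm.subs VV" shows "fvec.dim (Wpart G) \<le> K"
proof -
  have "Wpart G \<subseteq> coord_space IW"
    using G in_space_W_iff pm.subsD(2)[OF G] by (auto simp: Wpart_def space_W_eq[symmetric])
  then have "fvec.dim (Wpart G) \<le> fvec.dim (coord_space IW :: (label \<Rightarrow> 'f) set)"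
    using subspace_Wpart[OF pm.subsD(1)[OF G]]
    by (intro fq.dim_subspace_mono subspace_coord_space finite_coord_space) auto
  also have "\<dots> = K" by (simp add: dim_coord_space) (simp add: IW_def card_image inj_on_def)
  finally show ?thesis .
qed

lemma gbin_le_K: "k \<le> K \<Longrightarrow> gbin pm.q k i \<le> pm.q ^ (K * K)"
proof (cases "i \<le> k")
  case True
  assume "k \<le> K"
  then have "k * i \<le> K * K" using True by (intro mult_le_mono) auto
  then show ?thesis using gbin_le_power[OF q_ge_2, of k i] q_power_mono le_trans by blast
qed (simp add: gbin_eq_0)

text \<open>Here G is a projective space with only the subspace G \<inter> W removed. So its missing
  subspaces are those of \<open>Wpart G\<close>, and every subspace U containing an element g is
  spanned by elements, as a bad v is the difference of v + g and g; there are no middle corrections.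
  In dimension 2j + 1 the formula for the coefficient j keeps the main term and the error term m =
  2j + 1, both with trivial weights: a difference of two Gaussian binomials.\<close>

lemma coeff_signed_Q_almost_full:
  assumes G: "G \<in> pm.subs VV" and sp: "pm.lspan (pm.fl G) = G"
    and dich: "\<forall>u\<in>G. inW u \<or> \<not> bad u" and dG: "fvec.dim G = 2 * j + 1"
  shows "\<bar>coeff (pm.signed_Q G) j\<bar> \<le> int (pm.q ^ (K * K))"
    and "coeff (pm.signed_Q G) j \<noteq> 0 \<Longrightarrow> j \<le> fvec.dim (Wpart G)"
proof -
  define k where "k = fvec.dim (Wpart G)"
  have Gs: "fvec.subspace G" by (rule pm.subsD(1)[OF G])
  have bW: "bad u \<longleftrightarrow> inW u" if "u \<in> G" for u using dich that by (auto simp: bad_def)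
  have miss: "pm.miss G i = gbin pm.q k i" for i
  proof -
    have "{U \<in> pm.subs G. fvec.dim U = i \<and> pm.fl U = {}} = {U\<in>pm.subs (Wpart G). fvec.dim U = i}"
    proof (intro equalityI subsetI)
      fix U assume U: "U \<in> {U \<in> pm.subs G. fvec.dim U = i \<and> pm.fl U = {}}"
      then have "\<forall>u\<in>U. bad u" using fl_empty_iff[of U] pm.subs_trans[of U G VV] G by blast
      then show "U \<in> {U\<in>pm.subs (Wpart G). fvec.dim U = i}"
        using U bW by (auto simp: pm.subs_def Wpart_def)
    next
      fix U assume U: "U \<in> {U\<in>pm.subs (Wpart G). fvec.dim U = i}"
      then have UG: "U \<in> pm.subs G" by (auto simp: pm.subs_def Wpart_def)
      moreover have "\<forall>u\<in>U. bad u" using U by (auto simp: pm.subs_def Wpart_def bad_def)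
      ultimately have "pm.fl U = {}" using fl_empty_iff[of U] pm.subs_trans[of U G VV] G by blast
      then show "U \<in> {U \<in> pm.subs G. fvec.dim U = i \<and> pm.fl U = {}}" using U UG by blast
    qed
    then show ?thesis
      using card_subs[OF subspace_Wpart[OF Gs]] pm.finite_sub[OF G] by (simp add: pm.miss_def k_def Wpart_def)
  qed
  have middle_corr: "pm.middle_corr U j = 0" if U: "U \<in> pm.subs G" for U
  proof (cases "pm.fl U = {}")
    case False
    have UV: "U \<in> pm.subs VV" by (rule pm.subs_trans[OF U G])
    have Us: "fvec.subspace U" "U \<subseteq> G" using U pm.subsD by blast+
    obtain g where g: "g \<in> U" "\<not> bad g" "g \<in> pm.lspan (pm.fl U)" using fl_nonempty_good[OF UV False] .
    have "U \<subseteq> pm.lspan (pm.fl U)"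
    proof
      fix v assume v: "v \<in> U"
      show "v \<in> pm.lspan (pm.fl U)"
      proof (cases "bad v")
        case True
        have "\<not> inW (v + g)" using inW_diff[of "v + g" v] bW True v g Us by auto
        moreover have vg: "v + g \<in> U" using fvec.subspace_add[OF Us(1)] v g by blast
        ultimately have "v + g \<in> pm.lspan (pm.fl U)" using good_in_lspan[OF UV] bW Us by blast
        then have "(v + g) - g \<in> pm.lspan (pm.fl U)"
          using g(3) unfolding pm.lspan_def by (rule fvec.span_diff)
        then show ?thesis by simp
      qed (rule good_in_lspan[OF UV v])
    qed
    then have "pm.lspan (pm.fl U) = U" using pm.lspan_fl[OF Us(1)] by blast
    then show ?thesis using dim_lspan_fl[of U] by (simp add: pm.middle_corr_def)
  qed (simp add: pm.middle_corr_def)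
  have rk: "fvec.dim (\<Union>(pm.fl G)) = fvec.dim G" using dim_lspan_fl[of G] sp by simp
  have "(-1) ^ fvec.dim G * coeff (pm.signed_Q G) j = int (gbin pm.q k j) - int (gbin pm.q k (Suc j))"
  proof -
    have "2 * j < fvec.dim G" using dG by simp
    moreover have "(-1) ^ (j + j) = (1 :: int)" by simp
    ultimately show ?thesis
      using nm.coeff_inv_kl[OF G rk] by (simp add: dG miss middle_corr numeral_2_eq_2)
  qed
  moreover have "\<bar>(-1) ^ fvec.dim G * coeff (pm.signed_Q G) j\<bar> = \<bar>coeff (pm.signed_Q G) j\<bar>"
    by (simp add: abs_mult)
  ultimately have c: "\<bar>coeff (pm.signed_Q G) j\<bar> = \<bar>int (gbin pm.q k j) - int (gbin pm.q k (Suc j))\<bar>" by simp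
  have "k \<le> K" unfolding k_def by (rule dim_Wpart_le[OF G])
  then have "int (gbin pm.q k j) \<le> int (pm.q ^ (K * K))" "int (gbin pm.q k (Suc j)) \<le> int (pm.q ^ (K * K))"
    using gbin_le_K by (simp_all only: of_nat_le_iff)
  then show "\<bar>coeff (pm.signed_Q G) j\<bar> \<le> int (pm.q ^ (K * K))" unfolding c by linarith
  show "j \<le> fvec.dim (Wpart G)" if "coeff (pm.signed_Q G) j \<noteq> 0"
  proof (rule ccontr)
    assume "\<not> j \<le> fvec.dim (Wpart G)"
    then have "gbin pm.q k j = 0" "gbin pm.q k (Suc j) = 0" by (auto simp: k_def intro!: gbin_eq_0)
    then show False using c that by simp
  qed
qed

definition Missing :: "nat \<Rightarrow> (label \<Rightarrow> 'f) set set" where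
  "Missing i = {U\<in>pm.subs VV. fvec.dim U = i \<and> pm.fl U = {}}"

text \<open>A correction is the coefficient i - 1 of the span G of the elements in T, of dimension
  2i - 1. That it is nonzero forces dim (G \<inter> W) \<ge> i - 1, enough to build a missing U of
  dimension i inside T. The containment of T in U + W + X_b limits how many T belong to one
  U.\<close>

lemma middle_corr_bound:
  assumes T: "T \<in> pm.subs VV" and nz: "pm.middle_corr T i \<noteq> 0"
  shows "\<bar>pm.middle_corr T i\<bar> \<le> int (pm.q ^ (K * K))"
    and "\<exists>b\<in>{1..h}. \<exists>U\<in>Missing i. U \<subseteq> T \<and> (\<forall>t\<in>T. \<exists>u\<in>U. inX b (t - u))"
proof -
  define G where "G = pm.lspan (pm.fl T)"
  have Ts: "fvec.subspace T" and TV: "T \<subseteq> VV" using T pm.subsD by blast+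
  have dT: "fvec.dim T = 2 * i" and ne: "pm.fl T \<noteq> {}" and lt: "fvec.dim G < fvec.dim T"
    and ce: "pm.middle_corr T i = coeff (pm.signed_Q T) (i - 1)"
    using nz dim_lspan_fl[of T] by (auto simp: pm.middle_corr_def G_def split: if_splits)
  have neq: "T \<noteq> G" using lt by auto
  have GV: "G \<in> pm.subs VV" unfolding G_def by (rule lspan_fl_subs[OF T])
  have Gs: "fvec.subspace G" and GT: "G \<subseteq> T"
    using GV pm.subsD(1) pm.lspan_fl[OF Ts] by (auto simp: G_def)
  have dich: "\<forall>u\<in>G. inW u \<or> \<not> bad u" and dle: "fvec.dim T \<le> Suc (fvec.dim G)"
    using defect_structure[OF T ne] neq unfolding G_def by blast+
  have i1: "1 \<le> i" and dG: "fvec.dim G = 2 * (i - 1) + 1" using dT lt dle by auto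
  have flG: "pm.fl G = pm.fl T" unfolding G_def by (rule pm.fl_lspan[OF pm.fl_flat[OF T]])
  then have sqG: "pm.signed_Q G = pm.signed_Q T" and spG: "pm.lspan (pm.fl G) = G" by (simp_all add: pm.signed_Q_def G_def)
  note cf = coeff_signed_Q_almost_full[OF GV spG dich dG]
  show "\<bar>pm.middle_corr T i\<bar> \<le> int (pm.q ^ (K * K))" using cf(1) by (simp add: ce sqG)
  have jW: "i - 1 \<le> fvec.dim (Wpart G)" using cf(2) nz by (simp add: ce sqG)
  have missI: "U \<in> Missing i" if "U \<in> pm.subs T" "fvec.dim U = i" "\<forall>u\<in>U. bad u" for U
    using that fl_empty_iff[OF pm.subs_trans[OF that(1) T]] pm.subs_trans[OF that(1) T] by (simp add: Missing_def)
  show "\<exists>b\<in>{1..h}. \<exists>U\<in>Missing i. U \<subseteq> T \<and> (\<forall>t\<in>T. \<exists>u\<in>U. inX b (t - u))"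
  proof (cases "\<exists>w\<in>T. w \<notin> G \<and> w (WI K) = 0")
    case True
    then obtain w where w: "w \<in> T" "w \<notin> G" "w (WI K) = 0" by blast
    from structure_in_kernel(3)[OF T ne w(1) w(2)[unfolded G_def] w(3)]
    obtain a T0 where a: "a \<in> {1..h}" and T0: "T0 \<in> pm.subs T" "\<forall>t\<in>T0. inW t"
      "fvec.dim T \<le> Suc (fvec.dim T0)" "\<forall>t\<in>T. inX a t" by blast
    \<comment> \<open>T0 has dimension at least 2i - 1, and i is positive.\<close>
    have "i \<le> fvec.dim T0" using T0(3) dT i1 by linarith
    then obtain U where U: "U \<in> pm.subs T0" "fvec.dim U = i"
      using exists_subspace[OF pm.subsD(1)[OF T0(1)] pm.finite_sub[OF pm.subs_trans[OF T0(1) T]]] by blast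
    have UT: "U \<in> pm.subs T" by (rule pm.subs_trans[OF U(1) T0(1)])
    have "\<forall>u\<in>U. bad u" using T0(2) pm.subsD(2)[OF U(1)] by (auto simp: bad_def)
    then have "U \<in> Missing i" using missI UT U(2) by blast
    moreover have "0 \<in> U" using fvec.subspace_0[OF pm.subsD(1)[OF U(1)]] .
    moreover have "\<forall>t\<in>T. inX a (t - 0)" using T0(4) by simp
    ultimately show ?thesis using a pm.subsD(2)[OF UT] by blast
  next
    case False
    then have ker: "\<And>t. t \<in> T \<Longrightarrow> t (WI K) = 0 \<Longrightarrow> t \<in> pm.lspan (pm.fl T)" by (auto simp: G_def)
    from structure_outside_kernel(3)[OF T ne ker neq[unfolded G_def]]
    obtain a b v where ab: "a \<in> {1..h}" "b \<in> {1..h}" and v: "v \<in> T" "\<not> inW v" "in_cone a v"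
      and Gk: "\<And>u. u \<in> G \<Longrightarrow> u (WI K) = 0" "\<And>u. u \<in> G \<Longrightarrow> inW u \<Longrightarrow> rest a u"
      and Tb: "\<forall>t\<in>T. \<exists>c. inX b (t - scale_fun c v)"
      unfolding G_def by blast
    obtain P where P: "P \<in> pm.subs (Wpart G)" "fvec.dim P = i - 1"
      using exists_subspace[OF subspace_Wpart[OF Gs] _ jW] pm.finite_sub[OF GV] by (auto simp: Wpart_def)
    have Ps: "fvec.subspace P" and PW: "P \<subseteq> Wpart G" using P pm.subsD by blast+
    have PG: "P \<subseteq> G" and PinW: "\<And>p. p \<in> P \<Longrightarrow> inW p" using PW by (auto simp: Wpart_def)
    have spP: "fvec.span P = P" by (rule fq.span_subspace'[OF Ps])
    have vP: "v \<notin> P" using v PinW by blast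
    \<comment> \<open>P lies in W and satisfies \<open>rest a\<close>, so adding it to a nonzero
      multiple of v stays in the cone a.\<close>
    define U where "U = fvec.span (insert v P)"
    have "fvec.dim U = Suc (fvec.dim (fvec.span P))"
      unfolding U_def using vP finite_subset[OF PG pm.finite_sub[OF GV]] by (intro fq.dim_span_insert) (auto simp: spP)
    then have "fvec.dim U = i" using P(2) i1 by (simp add: spP)
    moreover have UT: "U \<in> pm.subs T"
      unfolding U_def using v PG GT Ts by (intro pm.subsI fvec.subspace_span fvec.span_minimal) auto
    moreover have "\<forall>u\<in>U. bad u"
    proof
      fix u assume "u \<in> U"
      then obtain c where c: "u - scale_fun c v \<in> P" by (auto simp: U_def fvec.span_insert spP)
      define p where "p = u - scale_fun c v"
      have up: "u = p + scale_fun c v" by (simp add: p_def)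
      have "p \<in> P" using c by (simp add: p_def)
      then have p: "inW p" "rest a p" "p (WI K) = 0" using PinW[of p] PG Gk[of p] by blast+
      show "bad u"
      proof (cases "c = 0")
        case True
        then show ?thesis using p(1) up by (simp add: bad_def scale_fun_def zero_fun_def[symmetric])
      next
        case False
        have "inX a u" "rest a u" "u (WI K) \<noteq> 0"
          using v(3) p False unfolding up in_cone_def
          by (auto intro: inX_add inX_scale rest_add rest_scale inW_inX simp: scale_apply)
        then show ?thesis using ab(1) by (auto simp: bad_def in_cone_def)
      qed
    qed
    ultimately have "U \<in> Missing i" using missI by blast
    moreover have "\<forall>t\<in>T. \<exists>u\<in>U. inX b (t - u)"
    proof
      fix t assume "t \<in> T"
      then obtain c where "inX b (t - scale_fun c v)" using Tb by blast
      moreover have "scale_fun c v \<in> U"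
        unfolding U_def by (intro fvec.span_scale fvec.span_base) auto
      ultimately show "\<exists>u\<in>U. inX b (t - u)" by (rule bexI)
    qed
    ultimately show ?thesis using ab(2) pm.subsD(2)[OF UT] by blast
  qed
qed

lemma lam_mono: "1 \<le> b \<Longrightarrow> lam S b \<le> lam S 1"
  by (auto simp: lam_def intro!: binomial_right_mono)

lemma card_IX: "card (IX a) = dim_X S n a"
  by (simp add: IX_def card_image inj_on_def)

lemma card_IW: "card IW = K"
  by (simp add: IW_def card_image inj_on_def)

lemma finite_Missing: "finite (Missing i)"
  using pm.finite_subs[OF pm.V_subs] by (simp add: Missing_def)

lemma card_Missing: "card (Missing i) = pm.miss VV i"
  by (simp add: Missing_def pm.miss_def)

text \<open>Every T with a correction arises from one of \<open>miss VV i * h\<close> pairs (U, b)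
  as an extension of U by i dimensions inside U + W + X_b, which has codimension at most K +
  lambda_1 n over U. The last factor bounds a single correction.\<close>

lemma sum_middle_corr_bound:
  "(\<Sum>T\<in>pm.subs VV. \<bar>pm.middle_corr T i\<bar>) \<le> int (pm.miss VV i * h * pm.q ^ ((K + lam S 1 * n) * i) * pm.q ^ (K * K))"
proof -
  define Y where "Y = (\<lambda>U b. fvec.span (U \<union> coord_space (IW \<union> IX b)) :: (label \<Rightarrow> 'f) set)"
  define Z where "Z = (\<lambda>U b. {T \<in> fq.subspaces_between U (Y U b). fvec.dim T = fvec.dim U + i})"
  have finsub: "finite (pm.subs VV)" by (rule pm.finite_subs[OF pm.V_subs])
  have Yfin: "finite (Y U b)" and Zcard: "card (Z U b) \<le> pm.q ^ ((K + lam S 1 * n) * i)"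
    if U: "U \<in> Missing i" and b: "b \<in> {1..h}" for U b
  proof -
    have UV: "U \<in> pm.subs VV" "fvec.dim U = i" using U by (auto simp: Missing_def)
    have Us: "fvec.subspace U" "finite U" using UV pm.subsD(1) pm.finite_sub by blast+
    have cs: "fvec.subspace (coord_space (IW \<union> IX b) :: (label \<Rightarrow> 'f) set)"
      "finite (coord_space (IW \<union> IX b) :: (label \<Rightarrow> 'f) set)"
      by (auto intro: subspace_coord_space finite_coord_space)
    have "card (IW \<union> IX b) \<le> K + dim_X S n b" using card_Un_le[of IW "IX b"] by (simp add: card_IX card_IW)
    also have "\<dots> \<le> K + lam S 1 * n" using b lam_mono[of b] by (simp add: dim_X_def)
    finally have "fvec.dim (coord_space (IW \<union> IX b) :: (label \<Rightarrow> 'f) set) \<le> K + lam S 1 * n"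
      by (simp add: dim_coord_space)
    then have dY: "fvec.dim (Y U b) \<le> i + (K + lam S 1 * n)"
      using fq.dim_sum_Int[OF Us cs] UV(2) by (simp add: Y_def)
    have "(\<lambda>(x, y). x + y) ` (U \<times> coord_space (IW \<union> IX b)) = Y U b"
      unfolding Y_def fvec.span_Un fq.span_subspace'[OF Us(1)] fq.span_subspace'[OF cs(1)] by auto
    moreover have "finite ((\<lambda>(x, y). x + y) ` (U \<times> coord_space (IW \<union> IX b)))" using Us cs by simp
    ultimately show fin: "finite (Y U b)" by simp
    have "card (Z U b) = gbin pm.q (fvec.dim (Y U b) - fvec.dim U) i"
      unfolding Z_def using Us fin fvec.span_superset[of "U \<union> coord_space (IW \<union> IX b)"]
      by (intro fq.card_subspaces_between) (auto simp: Y_def fvec.subspace_span)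
    also have "\<dots> \<le> pm.q ^ ((fvec.dim (Y U b) - fvec.dim U) * i)" by (rule gbin_le_power[OF q_ge_2])
    also have "\<dots> \<le> pm.q ^ ((K + lam S 1 * n) * i)"
      using dY UV(2) by (intro q_power_mono mult_le_mono1) simp
    finally show "card (Z U b) \<le> pm.q ^ ((K + lam S 1 * n) * i)" .
  qed
  have sub: "{T\<in>pm.subs VV. pm.middle_corr T i \<noteq> 0} \<subseteq> (\<Union>p\<in>Missing i \<times> {1..h}. Z (fst p) (snd p))"
  proof
    fix T assume "T \<in> {T\<in>pm.subs VV. pm.middle_corr T i \<noteq> 0}"
    then have T: "T \<in> pm.subs VV" and nz: "pm.middle_corr T i \<noteq> 0" by auto
    obtain b U where b: "b \<in> {1..h}" and U: "U \<in> Missing i" "U \<subseteq> T" "\<forall>t\<in>T. \<exists>u\<in>U. inX b (t - u)"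
      using middle_corr_bound(2)[OF T nz] by blast
    have "T \<subseteq> Y U b"
    proof
      fix t assume t: "t \<in> T"
      then obtain u where u: "u \<in> U" "inX b (t - u)" using U by blast
      have "t - u \<in> VV" using t u U pm.subsD[OF T] fvec.subspace_diff[of VV t u] pm.subspace_V by blast
      then have "t - u \<in> coord_space (IW \<union> IX b)"
        using u(2) unfolding VV_eq coord_space_iff inX_def
        by (metis Un_iff label.exhaust mem_IV(1) mem_IV(2) mem_index(1) mem_index(3))
      then have "u + (t - u) \<in> Y U b" unfolding Y_def using u by (intro fvec.span_add fvec.span_base) auto
      then show "t \<in> Y U b" by simp
    qed
    moreover have "fvec.dim T = fvec.dim U + i" using nz U(1) by (auto simp: pm.middle_corr_def Missing_def split: if_splits)
    ultimately have "T \<in> Z U b" using T U(2) by (auto simp: Z_def fq.subspaces_between_def pm.subs_def)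
    then show "T \<in> (\<Union>p\<in>Missing i \<times> {1..h}. Z (fst p) (snd p))" using U(1) b by force
  qed
  have finZ: "finite (\<Union>p\<in>Missing i \<times> {1..h}. Z (fst p) (snd p))"
  proof (intro finite_UN_I)
    fix p assume p: "p \<in> Missing i \<times> {1..h}"
    then have "finite (Y (fst p) (snd p))" by (intro Yfin) auto
    from fq.finite_subspaces_between[OF this] show "finite (Z (fst p) (snd p))"
      unfolding Z_def by simp
  qed (simp add: finite_Missing)
  have "card {T\<in>pm.subs VV. pm.middle_corr T i \<noteq> 0} \<le> card (\<Union>p\<in>Missing i \<times> {1..h}. Z (fst p) (snd p))"
    by (rule card_mono[OF finZ sub])
  also have "\<dots> \<le> (\<Sum>p\<in>Missing i \<times> {1..h}. card (Z (fst p) (snd p)))"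
    by (intro card_UN_le) (simp add: finite_Missing)
  also have "\<dots> \<le> (\<Sum>p\<in>Missing i \<times> {1..h}. pm.q ^ ((K + lam S 1 * n) * i))"
  proof (rule sum_mono)
    fix p assume "p \<in> Missing i \<times> {1..h}"
    then show "card (Z (fst p) (snd p)) \<le> pm.q ^ ((K + lam S 1 * n) * i)" by (intro Zcard) auto
  qed
  also have "\<dots> = pm.miss VV i * h * pm.q ^ ((K + lam S 1 * n) * i)"
    by (simp add: card_cartesian_product card_Missing)
  finally have cnt: "card {T\<in>pm.subs VV. pm.middle_corr T i \<noteq> 0} \<le> pm.miss VV i * h * pm.q ^ ((K + lam S 1 * n) * i)" .
  have "(\<Sum>T\<in>pm.subs VV. \<bar>pm.middle_corr T i\<bar>) = (\<Sum>T\<in>{T\<in>pm.subs VV. pm.middle_corr T i \<noteq> 0}. \<bar>pm.middle_corr T i\<bar>)"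
    by (rule sum.mono_neutral_right[OF finsub]) auto
  also have "\<dots> \<le> (\<Sum>T\<in>{T\<in>pm.subs VV. pm.middle_corr T i \<noteq> 0}. int (pm.q ^ (K * K)))"
    by (intro sum_mono) (use middle_corr_bound(1) in blast)
  also have "\<dots> = int (card {T\<in>pm.subs VV. pm.middle_corr T i \<noteq> 0} * pm.q ^ (K * K))" by simp
  also have "\<dots> \<le> int (pm.miss VV i * h * pm.q ^ ((K + lam S 1 * n) * i) * pm.q ^ (K * K))"
    unfolding of_nat_le_iff by (rule mult_le_mono1[OF cnt])
  finally show ?thesis .
qed

section \<open>Counting the missing subspaces\<close>

definition Missing_cone :: "nat \<Rightarrow> nat \<Rightarrow> (label \<Rightarrow> 'f) set set" where
  "Missing_cone a i = {T\<in>Missing i. \<exists>v\<in>T. in_cone a v \<and> \<not> inW v}"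

lemma MissingD:
  assumes "T \<in> Missing i"
  shows "T \<in> pm.subs VV" "fvec.dim T = i" "\<And>v. v \<in> T \<Longrightarrow> bad v"
  using assms fl_empty_iff[of T] by (auto simp: Missing_def)

lemma MissingI: "T \<in> pm.subs VV \<Longrightarrow> fvec.dim T = i \<Longrightarrow> (\<And>v. v \<in> T \<Longrightarrow> bad v) \<Longrightarrow> T \<in> Missing i"
  using fl_empty_iff[of T] by (auto simp: Missing_def)

text \<open>Projection along v lands in the vectors with vanishing coordinate at e_K, which for a
  missing T lie in W. For u in T \<inter> W, the vector v + u is still bad and off W with X-part in
  X_a, so it is in the cone a; comparing with v confines u to L_a plus multiples of e_K, and the
  coordinate at e_K must vanish because otherwise v itself would be in W.\<close>

lemma Missing_structure:
  assumes T: "T \<in> Missing i" and v: "v \<in> T" "in_cone a v" "\<not> inW v"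
  shows "T = fvec.span (insert v (Wpart T))" "Wpart T \<subseteq> coord_space (IL a)" "\<And>t. t \<in> T \<Longrightarrow> inX a t"
proof -
  have Ts: "fvec.subspace T" and TV: "T \<subseteq> VV" using MissingD(1)[OF T] pm.subsD by blast+
  note add = fvec.subspace_add[OF Ts] and diff = fvec.subspace_diff[OF Ts] and scale = fvec.subspace_scale[OF Ts]
  have kv: "v (WI K) \<noteq> 0" and Xv: "inX a v" using v by (auto simp: in_cone_def)
  define pr where "pr = (\<lambda>t. t - scale_fun (t (WI K) / v (WI K)) v)"
  have pr: "pr t \<in> Wpart T" if t: "t \<in> T" for t
  proof -
    have "pr t \<in> T" unfolding pr_def by (intro diff scale t v)
    moreover have "pr t (WI K) = 0" using kv by (simp add: pr_def scale_apply)
    ultimately show ?thesis using bad_kap_0[OF MissingD(3)[OF T]] by (simp add: Wpart_def)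
  qed
  have pr2: "t = pr t + scale_fun (t (WI K) / v (WI K)) v" for t by (simp add: pr_def)
  show allX: "inX a t" if t: "t \<in> T" for t
  proof -
    have "inX a (pr t + scale_fun (t (WI K) / v (WI K)) v)"
      using pr[OF t] by (intro inX_add inX_scale Xv) (simp add: Wpart_def inW_inX)
    then show ?thesis by (simp only: pr2[symmetric])
  qed
  show "T = fvec.span (insert v (Wpart T))"
  proof
    show "fvec.span (insert v (Wpart T)) \<subseteq> T"
      using v Ts by (intro fvec.span_minimal) (auto simp: Wpart_def)
    show "T \<subseteq> fvec.span (insert v (Wpart T))"
    proof
      fix t assume t: "t \<in> T"
      have "pr t \<in> fvec.span (insert v (Wpart T))" "v \<in> fvec.span (insert v (Wpart T))"
        using pr[OF t] by (auto intro: fvec.span_base)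
      then have "pr t + scale_fun (t (WI K) / v (WI K)) v \<in> fvec.span (insert v (Wpart T))"
        by (intro fvec.span_add fvec.span_scale)
      then show "t \<in> fvec.span (insert v (Wpart T))" by (simp only: pr2[symmetric])
    qed
  qed
  show "Wpart T \<subseteq> coord_space (IL a)"
  proof
    fix u assume "u \<in> Wpart T"
    then have u: "u \<in> T" "inW u" by (auto simp: Wpart_def)
    have nW: "\<not> inW (v + u)" using inW_diff[of "v + u" u] u v by auto
    obtain a' where a': "in_cone a' (v + u)" using bad_not_inW[OF MissingD(3)[OF T add[OF v(1) u(1)]] nW] by blast
    have "a' = a" using inX_inW[of a' "v + u" a] allX[OF add[OF v(1) u(1)]] a' nW by (auto simp: in_cone_def)
    then have "rest a (v + u)" "rest a v" using a' v by (auto simp: in_cone_def)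
    then have "rest a ((v + u) - v)" by (rule rest_diff)
    then have r: "rest a u" by simp
    have k: "u (WI K) = 0"
    proof (rule ccontr)
      assume ku: "u (WI K) \<noteq> 0"
      define c where "c = v (WI K) / u (WI K)"
      have "v - scale_fun c u \<in> T" by (intro diff scale v u)
      moreover have "(v - scale_fun c u) (WI K) = 0" using ku by (simp add: scale_apply c_def)
      ultimately have "inW (v - scale_fun c u)" using bad_kap_0[OF MissingD(3)[OF T]] by blast
      then have "inW (v - scale_fun c u + scale_fun c u)" by (intro inW_add inW_scale u)
      then show False using v by simp
    qed
    have u0: "u (WI 0) = 0" using u TV by (auto simp: VV_eq coord_space_iff)
    show "u \<in> coord_space (IL a)"
      unfolding coord_space_iff
    proof (intro allI impI)
      fix j assume j: "j \<notin> IL a"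
      show "u j = 0"
      proof (cases j)
        case (WI m)
        consider "m = 0" | "m = K" | "m \<noteq> K" "ell S a < m" using j WI by fastforce
        then show ?thesis using u0 k r WI by cases (auto simp: rest_def)
      next
        case (XI b m)
        then show ?thesis using u(2) by (simp add: inW_def)
      qed
    qed
  qed
qed

text \<open>The converse of \<open>Missing_structure\<close>: every subspace of L_a and every point
  of the cone off W occur.\<close>

lemma Missing_extend:
  assumes a: "a \<in> {1..h}" and P: "P \<in> pm.subs (coord_space (IL a))" and v: "v \<in> VV" "in_cone a v" "\<not> inW v"
  shows "fvec.span (insert v P) \<in> Missing_cone a (Suc (fvec.dim P))" "Wpart (fvec.span (insert v P)) = P"
proof -
  let ?T = "fvec.span (insert v P)"
  have Ps: "fvec.subspace P" and PL: "P \<subseteq> coord_space (IL a)" using P pm.subsD by blast+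
  have spP: "fvec.span P = P" by (rule fq.span_subspace'[OF Ps])
  have LV: "coord_space (IL a) \<subseteq> VV" unfolding VV_eq
  proof (rule coord_space_mono)
    show "IL a \<subseteq> IV" using ell_bound[OF a] by (auto simp: IL_def)
  qed
  have pL: "inW p" "rest a p" "p (WI K) = 0" if "p \<in> P" for p
    using that PL ell_bound[OF a] by (auto simp: coord_space_iff inW_def rest_def subset_iff)
  have vP: "v \<notin> P" using v pL by blast
  have mem: "\<exists>c. t - scale_fun c v \<in> P" if "t \<in> ?T" for t
    using that by (simp add: fvec.span_insert spP)
  show W: "Wpart ?T = P"
  proof
    show "P \<subseteq> Wpart ?T" using pL by (auto simp: Wpart_def intro: fvec.span_base)
    show "Wpart ?T \<subseteq> P"
    proof
      fix t assume "t \<in> Wpart ?T"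
      then have t: "t \<in> ?T" "inW t" by (auto simp: Wpart_def)
      obtain c where c: "t - scale_fun c v \<in> P" using mem[OF t(1)] by blast
      have "inW (t - (t - scale_fun c v))" by (intro inW_diff t pL c)
      then have "inW (scale_fun c v)" by simp
      then have "c = 0" using v(3) by (auto simp: inW_def scale_apply)
      then have z: "scale_fun c v = 0" by (simp add: scale_fun_def zero_fun_def)
      show "t \<in> P" using c unfolding z by simp
    qed
  qed
  have "fvec.dim ?T = Suc (fvec.dim (fvec.span P))"
  proof (rule fq.dim_span_insert)
    show "finite (fvec.span P)" unfolding spP by (rule finite_subset[OF PL finite_coord_space]) simp
  qed (simp only: spP vP not_False_eq_True)
  then have dT: "fvec.dim ?T = Suc (fvec.dim P)" by (simp only: spP)
  have TV: "?T \<in> pm.subs VV"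
    using v(1) PL LV pm.subspace_V by (intro pm.subsI fvec.subspace_span fvec.span_minimal) auto
  have "bad t" if t: "t \<in> ?T" for t
  proof -
    obtain c where c: "t - scale_fun c v \<in> P" using mem[OF t] by blast
    define p where "p = t - scale_fun c v"
    have tp: "t = p + scale_fun c v" by (simp add: p_def)
    have p: "inW p" "rest a p" "p (WI K) = 0" using pL[OF c] by (simp_all add: p_def)
    show "bad t"
    proof (cases "c = 0")
      case True
      then have z: "scale_fun c v = 0" by (simp add: scale_fun_def zero_fun_def)
      have "t = p" using tp unfolding z by simp
      then show ?thesis using p(1) by (simp add: bad_def)
    next
      case False
      have "inX a t" "rest a t" "t (WI K) \<noteq> 0"
        using v(2) p False unfolding tp in_cone_def
        by (auto intro: inX_add inX_scale rest_add rest_scale inW_inX simp: scale_apply)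
      then show ?thesis using a by (auto simp: bad_def in_cone_def)
    qed
  qed
  then have "?T \<in> Missing (Suc (fvec.dim P))" by (intro MissingI TV dT)
  moreover have "v \<in> ?T" by (intro fvec.span_base) simp
  ultimately show "?T \<in> Missing_cone a (Suc (fvec.dim P))" using v by (auto simp: Missing_cone_def)
qed

definition Cvec :: "nat \<Rightarrow> (label \<Rightarrow> 'f) set" where "Cvec a = {v\<in>VV. in_cone a v \<and> \<not> inW v}"

lemma card_coord: "finite I \<Longrightarrow> card (coord_space I :: (label \<Rightarrow> 'f) set) = pm.q ^ card I"
  using card_coord_space[of I, where 'f = 'f] by (simp add: fq.q_def)

lemma finite_Cvec: "finite (Cvec a)"
  by (simp add: Cvec_def pm.finite_V)

text \<open>The factors count the nonzero multiples, the vectors l, and the nonzero vectors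
  x.\<close>

lemma card_Cvec:
  assumes a: "a \<in> {1..h}"
  shows "int (card (Cvec a)) = (int pm.q - 1) * (int pm.q ^ ell S a * (int pm.q ^ (lam S a * n) - 1))"
proof -
  define el m where "el = ell S a" and "m = lam S a * n"
  let ?D = "coord_space (insert (WI K) (IL a \<union> IX a)) :: (label \<Rightarrow> 'f) set"
  let ?D1 = "coord_space (IL a \<union> IX a) :: (label \<Rightarrow> 'f) set"
  let ?D2 = "coord_space (insert (WI K) (IL a)) :: (label \<Rightarrow> 'f) set"
  have K: "WI K \<notin> IL a" "1 \<le> K" "el < K" using ell_bound[OF a] by (auto simp: el_def)
  have cIL: "card (IL a) = el" by (simp add: IL_def card_image inj_on_def el_def)
  have cIX: "card (IX a) = m" using a by (simp add: card_IX dim_X_def m_def)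
  have "IL a \<inter> IX a = {}" by (auto simp: IL_def IX_def)
  then have cU: "card (IL a \<union> IX a) = el + m" by (simp add: card_Un_disjoint cIL cIX)
  \<comment> \<open>\<open>?D1\<close> removes the vectors with vanishing coordinate at e_K and
    \<open>?D2\<close> those in W; they overlap in L_a.\<close>
  have eq: "Cvec a = ?D - (?D1 \<union> ?D2)"
  proof (intro equalityI subsetI)
    fix v assume "v \<in> Cvec a"
    then have v: "v \<in> VV" "in_cone a v" "\<not> inW v" by (auto simp: Cvec_def)
    have "v \<in> ?D"
      unfolding coord_space_iff
    proof (intro allI impI)
      fix j assume j: "j \<notin> insert (WI K) (IL a \<union> IX a)"
      show "v j = 0"
      proof (cases j)
        case (WI i)
        then have "i \<noteq> K" "i = 0 \<or> ell S a < i" using j by auto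
        then show ?thesis using v(1,2) WI by (auto simp: in_cone_def rest_def VV_eq coord_space_iff)
      next
        case (XI b k)
        show ?thesis
        proof (cases "b = a")
          case True
          then show ?thesis using j XI v(1) by (auto simp: VV_eq coord_space_iff)
        qed (use v(2) XI in \<open>simp add: in_cone_def inX_def\<close>)
      qed
    qed
    moreover have "v \<notin> ?D1"
    proof
      assume "v \<in> ?D1"
      then have "v (WI K) = 0" using K(1) mem_index(4)[of K a] unfolding coord_space_iff by blast
      then show False using v(2) by (simp add: in_cone_def)
    qed
    moreover have "v \<notin> ?D2"
    proof
      assume "v \<in> ?D2"
      then have "inW v" by (simp add: coord_space_iff inW_def)
      then show False using v(3) by simp
    qed
    ultimately show "v \<in> ?D - (?D1 \<union> ?D2)" by blast
  next
    fix v assume "v \<in> ?D - (?D1 \<union> ?D2)"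
    then have v: "v \<in> ?D" "v \<notin> ?D1" "v \<notin> ?D2" by auto
    have d: "v j = 0" if "j \<notin> insert (WI K) (IL a \<union> IX a)" for j using v(1) that by (simp add: coord_space_iff)
    have "v \<in> VV" unfolding VV_eq
    proof (rule subsetD[OF coord_space_mono v(1)])
      show "insert (WI K) (IL a \<union> IX a) \<subseteq> IV"
        using K a ell_bound[OF a] by (auto simp: IL_def IX_def)
    qed
    moreover have "v (WI K) \<noteq> 0" using v(2) d unfolding coord_space_iff by (metis insert_iff)
    moreover have "inX a v" "rest a v" using d by (auto simp: inX_def rest_def)
    moreover have "\<not> inW v"
    proof
      assume iw: "inW v"
      have "v j = 0" if "j \<notin> insert (WI K) (IL a)" for j
        using iw d[of j] that by (cases j) (auto simp: inW_def)
      then show False using v(3) by (simp add: coord_space_iff)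
    qed
    ultimately show "v \<in> Cvec a" by (auto simp: Cvec_def in_cone_def)
  qed
  have int12: "?D1 \<inter> ?D2 = coord_space (IL a)" using K(1)
    by (auto simp: coord_space_def IL_def IX_def) 
  have sub: "?D1 \<union> ?D2 \<subseteq> ?D" by (intro Un_least coord_space_mono) auto
  have fin: "finite ?D1" "finite ?D2" by (auto intro: finite_coord_space)
  have "card ?D = card (Cvec a) + card (?D1 \<union> ?D2)"
    unfolding eq using sub fin card_Diff_subset[of "?D1 \<union> ?D2" ?D] card_mono[OF _ sub] finite_coord_space[of "insert (WI K) (IL a \<union> IX a)", where 'f = 'f]
    by simp
  moreover have "card (?D1 \<union> ?D2) + card (coord_space (IL a) :: (label \<Rightarrow> 'f) set) = card ?D1 + card ?D2"
    using card_Un_Int[OF fin] unfolding int12 by simp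
  moreover have "card ?D = pm.q ^ Suc (el + m)" "card ?D1 = pm.q ^ (el + m)" "card ?D2 = pm.q ^ Suc el"
    "card (coord_space (IL a) :: (label \<Rightarrow> 'f) set) = pm.q ^ el"
    using K(1) cU cIL by (simp_all add: card_coord IX_def image_iff)
  ultimately have "pm.q ^ Suc (el + m) + pm.q ^ el = card (Cvec a) + pm.q ^ (el + m) + pm.q ^ Suc el" by linarith
  then have "int (pm.q ^ Suc (el + m) + pm.q ^ el) = int (card (Cvec a) + pm.q ^ (el + m) + pm.q ^ Suc el)"
    by (simp only:)
  then show ?thesis unfolding el_def[symmetric] m_def[symmetric]
    by (simp add: power_add algebra_simps)
qed

lemma finite_Missing_cone: "finite (Missing_cone a i)"
  using finite_Missing by (simp add: Missing_cone_def)

text \<open>Double counting of the vectors of \<open>Cvec a\<close> in the subspaces T: each T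
  contains exactly those outside \<open>Wpart T\<close>, which is a hyperplane of T, and by taking
  \<open>Wpart\<close> the T through a fixed vector correspond to the j-dimensional subspaces of
  L_a.\<close>

lemma card_Missing_cone_Suc:
  assumes a: "a \<in> {1..h}"
  shows "int (card (Missing_cone a (Suc j))) * int pm.q ^ j =
    int (gbin pm.q (ell S a) j) * (int pm.q ^ ell S a * (int pm.q ^ (lam S a * n) - 1))"
proof -
  have cIL: "card (IL a) = ell S a" by (simp add: IL_def card_image inj_on_def)
  have "(\<Sum>v\<in>Cvec a. card {T\<in>Missing_cone a (Suc j). v \<in> T}) = (\<Sum>T\<in>Missing_cone a (Suc j). pm.q ^ Suc j - pm.q ^ j)"
  proof (rule sum_multicount_gen[OF finite_Cvec finite_Missing_cone], rule ballI)
    fix T assume "T \<in> Missing_cone a (Suc j)"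
    then obtain v where T: "T \<in> Missing (Suc j)" and v: "v \<in> T" "in_cone a v" "\<not> inW v" by (auto simp: Missing_cone_def)
    note st = Missing_structure[OF T v]
    have Ts: "fvec.subspace T" and TV: "T \<subseteq> VV" using MissingD(1)[OF T] pm.subsD by blast+
    have finT: "finite T" using pm.finite_sub[OF MissingD(1)[OF T]] .
    have Ws: "fvec.subspace (Wpart T)" by (rule subspace_Wpart[OF Ts])
    have spW: "fvec.span (Wpart T) = Wpart T" by (rule fq.span_subspace'[OF Ws])
    have finW: "finite (Wpart T)" using finT by (simp add: Wpart_def)
    have "fvec.dim (fvec.span (insert v (Wpart T))) = Suc (fvec.dim (fvec.span (Wpart T)))"
      using finW v(3) by (intro fq.dim_span_insert) (simp_all only: spW, simp add: Wpart_def)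
    then have dW: "fvec.dim (Wpart T) = j" using MissingD(2)[OF T] st(1) by (simp only: spW)
    have "{v\<in>Cvec a. v \<in> T} = T - Wpart T"
    proof (intro equalityI subsetI)
      fix t assume t: "t \<in> T - Wpart T"
      then have nW: "t \<in> T" "\<not> inW t" by (auto simp: Wpart_def)
      obtain b where b: "in_cone b t" using bad_not_inW[OF MissingD(3)[OF T nW(1)] nW(2)] by blast
      then have "b = a" using inX_inW[of b t a] st(3)[OF nW(1)] nW(2) by (auto simp: in_cone_def)
      then show "t \<in> {v\<in>Cvec a. v \<in> T}" using b nW TV by (auto simp: Cvec_def)
    qed (auto simp: Cvec_def Wpart_def)
    moreover have "Wpart T \<subseteq> T" by (auto simp: Wpart_def)
    ultimately show "card {v\<in>Cvec a. v \<in> T} = pm.q ^ Suc j - pm.q ^ j"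
      using fq.card_subspace[OF Ts finT] fq.card_subspace[OF Ws finW] finW
      by (simp add: card_Diff_subset dW MissingD(2)[OF T])
  qed
  moreover have "card {T\<in>Missing_cone a (Suc j). v \<in> T} = gbin pm.q (ell S a) j" if "v \<in> Cvec a" for v
  proof -
    have v: "v \<in> VV" "in_cone a v" "\<not> inW v" using that by (auto simp: Cvec_def)
    define B where "B = {P\<in>pm.subs (coord_space (IL a)). fvec.dim P = j}"
    have "bij_betw (\<lambda>P. fvec.span (insert v P)) B {T\<in>Missing_cone a (Suc j). v \<in> T}"
    proof (rule bij_betw_byWitness[where f' = Wpart])
      show "\<forall>P\<in>B. Wpart (fvec.span (insert v P)) = P"
        using Missing_extend(2)[OF a _ v] by (auto simp: B_def)
      show "\<forall>T\<in>{T\<in>Missing_cone a (Suc j). v \<in> T}. fvec.span (insert v (Wpart T)) = T"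
        using Missing_structure(1)[OF _ _ v(2,3)] by (auto simp: Missing_cone_def)
      show "(\<lambda>P. fvec.span (insert v P)) ` B \<subseteq> {T\<in>Missing_cone a (Suc j). v \<in> T}"
        using Missing_extend(1)[OF a _ v] by (auto simp: B_def intro: fvec.span_base)
      show "Wpart ` {T\<in>Missing_cone a (Suc j). v \<in> T} \<subseteq> B"
      proof (rule image_subsetI)
        fix T assume "T \<in> {T\<in>Missing_cone a (Suc j). v \<in> T}"
        then have T: "T \<in> Missing (Suc j)" "v \<in> T" by (auto simp: Missing_cone_def)
        have Ts: "fvec.subspace T" using MissingD(1)[OF T(1)] pm.subsD by blast
        have PL: "Wpart T \<in> pm.subs (coord_space (IL a))"
          using Missing_structure(2)[OF T v(2,3)] subspace_Wpart[OF Ts] by (simp add: pm.subs_def)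
        have "T \<in> Missing_cone a (Suc (fvec.dim (Wpart T)))"
          using Missing_extend(1)[OF a PL v] Missing_structure(1)[OF T v(2,3)] by simp
        then have "Suc (fvec.dim (Wpart T)) = Suc j"
          using MissingD(2)[OF T(1)] MissingD(2)[of T "Suc (fvec.dim (Wpart T))"] by (auto simp: Missing_cone_def)
        then show "Wpart T \<in> B" using PL by (simp add: B_def)
      qed
    qed
    then have "card {T\<in>Missing_cone a (Suc j). v \<in> T} = card B" by (simp add: bij_betw_same_card)
    also have "\<dots> = gbin pm.q (fvec.dim (coord_space (IL a) :: (label \<Rightarrow> 'f) set)) j"
      unfolding B_def by (intro card_subs subspace_coord_space finite_coord_space) simp
    finally show ?thesis by (simp add: dim_coord_space cIL)
  qed
  ultimately have "card (Cvec a) * gbin pm.q (ell S a) j = card (Missing_cone a (Suc j)) * (pm.q ^ Suc j - pm.q ^ j)"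
    by simp
  then have "int (card (Cvec a) * gbin pm.q (ell S a) j) = int (card (Missing_cone a (Suc j)) * (pm.q ^ Suc j - pm.q ^ j))"
    by (simp only:)
  moreover have "int (pm.q ^ Suc j - pm.q ^ j) = (int pm.q - 1) * int pm.q ^ j"
    using q_power_mono[of j "Suc j"] by (subst of_nat_diff) (auto simp: algebra_simps)
  ultimately have "(int pm.q - 1) * (int (card (Missing_cone a (Suc j))) * int pm.q ^ j) =
     (int pm.q - 1) * (int (gbin pm.q (ell S a) j) * (int pm.q ^ ell S a * (int pm.q ^ (lam S a * n) - 1)))"
    unfolding of_nat_mult card_Cvec[OF a] by (simp only: mult_ac)
  moreover have "int pm.q - 1 \<noteq> 0" using q_ge_2 by simp
  ultimately show ?thesis by (simp only: mult_cancel_left simp_thms)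
qed

lemma Missing_cone_0: "Missing_cone a 0 = {}"
proof -
  have "T = {0}" if "T \<in> Missing 0" for T
    using fq.subspace_dim_0[of T] MissingD(1,2)[OF that] pm.subsD(1) pm.finite_sub by blast
  moreover have "inW 0" by (simp add: inW_def)
  ultimately show ?thesis unfolding Missing_cone_def by blast
qed

text \<open>A subspace of W is always missing; a missing subspace not inside W leaves W through
  exactly one cone.\<close>

lemma miss_eq: "pm.miss VV i = gbin pm.q K i + (\<Sum>a\<in>{1..h}. card (Missing_cone a i))"
proof -
  define A where "A = {T\<in>Missing i. \<forall>v\<in>T. inW v}"
  have dec: "Missing i = A \<union> (\<Union>a\<in>{1..h}. Missing_cone a i)"
    using bad_not_inW MissingD(3) by (fastforce simp: A_def Missing_cone_def)
  have disjA: "A \<inter> (\<Union>a\<in>{1..h}. Missing_cone a i) = {}" by (auto simp: A_def Missing_cone_def)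
  have disj: "Missing_cone a i \<inter> Missing_cone b i = {}" if "a \<noteq> b" for a b
  proof (rule ccontr)
    assume "\<not> ?thesis"
    then obtain T v w where T: "T \<in> Missing i" "v \<in> T" "in_cone a v" "\<not> inW v" "w \<in> T" "in_cone b w" "\<not> inW w"
      by (auto simp: Missing_cone_def)
    have "inX a w" by (rule Missing_structure(3)[OF T(1-5)])
    then show False using T(6,7) inX_inW[of a w b] that by (auto simp: in_cone_def)
  qed
  have W: "coord_space IW \<subseteq> VV" unfolding VV_eq by (rule coord_space_mono) (auto simp: IV_def)
  have inWcoord: "v \<in> coord_space IW \<longleftrightarrow> inW v" if "v \<in> VV" for v
    using in_space_W_iff[OF that] by (simp add: space_W_eq)
  have "A = {T\<in>pm.subs (coord_space IW). fvec.dim T = i}"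
  proof (intro equalityI subsetI)
    fix T assume "T \<in> A"
    then have T: "T \<in> Missing i" "\<forall>v\<in>T. inW v" by (auto simp: A_def)
    then show "T \<in> {T\<in>pm.subs (coord_space IW). fvec.dim T = i}"
      using MissingD(1,2)[OF T(1)] inWcoord by (auto simp: pm.subs_def)
  next
    fix T assume "T \<in> {T\<in>pm.subs (coord_space IW). fvec.dim T = i}"
    then have T: "fvec.subspace T" "T \<subseteq> coord_space IW" "fvec.dim T = i" by (auto simp: pm.subs_def)
    have iw: "inW v" if "v \<in> T" for v using that T(2) inWcoord W by blast
    then have "T \<in> Missing i" using T W by (intro MissingI) (auto simp: pm.subs_def bad_def)
    then show "T \<in> A" using iw by (simp add: A_def)
  qed
  then have cA: "card A = gbin pm.q K i"
    using card_subs[OF subspace_coord_space finite_coord_space, of IW i] by (simp add: dim_coord_space card_IW)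
  have "card (Missing i) = card A + card (\<Union>a\<in>{1..h}. Missing_cone a i)"
    unfolding dec using finite_Missing disjA by (intro card_Un_disjoint) (auto simp: A_def finite_Missing_cone)
  also have "card (\<Union>a\<in>{1..h}. Missing_cone a i) = (\<Sum>a\<in>{1..h}. card (Missing_cone a i))"
    by (intro card_UN_disjoint) (use disj finite_Missing_cone in auto)
  finally show ?thesis by (simp add: card_Missing cA)
qed

section \<open>Growth of the numbers of missing subspaces\<close>

definition num_missing :: "nat \<Rightarrow> nat" where "num_missing i = pm.miss VV i"

lemma num_missing_eq: "num_missing i = gbin pm.q K i + (\<Sum>a\<in>{1..h}. card (Missing_cone a i))"
  by (simp add: num_missing_def miss_eq)

lemma S_subset: "S \<subseteq> {2..<K}"
  using S_ge_2 Max_ge[OF finite_S] K_bound by fastforce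

lemma h_bounds: "1 \<le> h" "h + 2 \<le> K" "3 \<le> K"
proof -
  show "1 \<le> h" using finite_S S_nonempty by (simp add: Suc_le_eq card_gt_0_iff)
  then have K: "2 < K" using S_subset S_nonempty by fastforce
  have "h \<le> card {2..<K}" by (rule card_mono[OF _ S_subset]) simp
  then show "h + 2 \<le> K" "3 \<le> K" using K by auto
qed

lemma n_ge: "20 * (K * K) \<le> n" using n_bound by (simp add: power2_eq_square)

lemma K_le_KK: "K \<le> K * K" using h_bounds(3) by simp

lemma KK_ge: "9 \<le> K * K" using mult_le_mono[OF h_bounds(3) h_bounds(3)] by simp

lemma lam_eq: "lam S a = ((h - a + 1) choose 2) + (h - a + 1)"
  using choose_two_Suc[of "h - a + 1"] by (simp add: lam_def)

lemma Missing_cone_zero: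
  assumes a: "a \<in> {1..h}" and i: "s_elem S a \<le> i" shows "card (Missing_cone a i) = 0"
proof -
  obtain j where j: "i = Suc j" "ell S a < j" using i ell_eq[OF a] by (cases i) auto
  have "int (card (Missing_cone a (Suc j))) * int pm.q ^ j = 0"
    unfolding card_Missing_cone_Suc[OF a] by (simp add: gbin_eq_0[OF j(2)])
  then show ?thesis using q_ge_2 by (simp add: j(1))
qed

lemma card_Missing_cone_Suc_nat:
  assumes a: "a \<in> {1..h}"
  shows "card (Missing_cone a (Suc j)) * pm.q ^ j = gbin pm.q (ell S a) j * (pm.q ^ ell S a * (pm.q ^ (lam S a * n) - 1))"
proof -
  have "1 \<le> pm.q ^ (lam S a * n)" using q_ge_2 by simp
  then have "int (card (Missing_cone a (Suc j)) * pm.q ^ j) =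
      int (gbin pm.q (ell S a) j * (pm.q ^ ell S a * (pm.q ^ (lam S a * n) - 1)))"
    using card_Missing_cone_Suc[OF a, of j] by (simp add: of_nat_diff)
  then show ?thesis by (simp only: of_nat_eq_iff)
qed

lemma Missing_cone_upper:
  assumes a: "a \<in> {1..h}" shows "card (Missing_cone a i) \<le> pm.q ^ (K * K + lam S a * n)"
proof (cases "1 \<le> i \<and> i < s_elem S a")
  case False
  then have "card (Missing_cone a i) = 0" using Missing_cone_zero[OF a, of i] Missing_cone_0[of a] by (cases "i = 0") auto
  then show ?thesis by simp
next
  case True
  then obtain j where j: "i = Suc j" "j \<le> ell S a" using ell_eq[OF a] by (cases i) auto
  have "card (Missing_cone a i) * 1 \<le> card (Missing_cone a i) * pm.q ^ j" using q_ge_2 by (intro mult_le_mono2) simp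
  also have "\<dots> = gbin pm.q (ell S a) j * (pm.q ^ ell S a * (pm.q ^ (lam S a * n) - 1))"
    unfolding j(1) by (rule card_Missing_cone_Suc_nat[OF a])
  also have "\<dots> \<le> pm.q ^ (ell S a * j) * (pm.q ^ ell S a * pm.q ^ (lam S a * n))"
    by (intro mult_le_mono gbin_le_power q_ge_2) auto
  also have "\<dots> = pm.q ^ (ell S a * Suc j + lam S a * n)" by (simp add: power_add)
  also have "\<dots> \<le> pm.q ^ (K * K + lam S a * n)"
    using ell_bound[OF a] j(2) by (intro q_power_mono add_mono mult_le_mono) auto
  finally show ?thesis by simp
qed

text \<open>The factor q on the right pays for the -1 in q^(lambda_a n) - 1.\<close>

lemma Missing_cone_lower:
  assumes a: "a \<in> {1..h}" and i: "1 \<le> i" "i < s_elem S a"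
  shows "pm.q ^ (lam S a * n) \<le> pm.q * card (Missing_cone a i)"
proof -
  obtain j where j: "i = Suc j" "j \<le> ell S a" using i ell_eq[OF a] by (cases i) auto
  define m where "m = lam S a * n"
  have m: "1 \<le> m" using lam_eq[of a] n_ge KK_ge by (simp add: m_def)
  have "pm.q ^ j * (pm.q ^ m - 1) \<le> 1 * (pm.q ^ ell S a * (pm.q ^ m - 1))"
    using q_power_mono[OF j(2)] by simp
  also have "\<dots> \<le> gbin pm.q (ell S a) j * (pm.q ^ ell S a * (pm.q ^ m - 1))"
    using gbin_pos[of pm.q j "ell S a"] q_ge_2 j(2) by (intro mult_le_mono1) simp
  also have "\<dots> = pm.q ^ j * card (Missing_cone a i)"
    unfolding m_def j(1) card_Missing_cone_Suc_nat[OF a, symmetric] by simp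
  finally have c: "pm.q ^ m - 1 \<le> card (Missing_cone a i)" using q_ge_2 by simp
  have qm: "pm.q \<le> pm.q ^ m" using q_power_mono[OF m] by simp
  have "2 * pm.q ^ m \<le> pm.q * pm.q ^ m" using q_ge_2 by (intro mult_le_mono1)
  then have "pm.q ^ m \<le> pm.q * pm.q ^ m - pm.q" using qm by linarith
  also have "\<dots> = pm.q * (pm.q ^ m - 1)" by (simp add: diff_mult_distrib2)
  also have "\<dots> \<le> pm.q * card (Missing_cone a i)" using c by (rule mult_le_mono2)
  finally show ?thesis by (simp add: m_def)
qed

text \<open>As functions of the dimension, these cardinalities are Gaussian binomials times a
  geometric sequence.\<close>

lemma Missing_cone_log_concave:
  assumes a: "a \<in> {1..h}"
  shows "4 * (card (Missing_cone a i) * card (Missing_cone a (i + 2))) \<le> card (Missing_cone a (i + 1)) * card (Missing_cone a (i + 1))"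
proof (cases i)
  case 0
  then show ?thesis by (simp add: Missing_cone_0)
next
  case (Suc j)
  define X where "X = pm.q ^ ell S a * (pm.q ^ (lam S a * n) - 1)"
  define Q2 where "Q2 = pm.q ^ Suc j * pm.q ^ Suc j"
  have e: "card (Missing_cone a (Suc j)) * pm.q ^ j = gbin pm.q (ell S a) j * X"
    "card (Missing_cone a (Suc (Suc j))) * pm.q ^ Suc j = gbin pm.q (ell S a) (Suc j) * X"
    "card (Missing_cone a (Suc (Suc (Suc j)))) * pm.q ^ Suc (Suc j) = gbin pm.q (ell S a) (Suc (Suc j)) * X"
    unfolding X_def by (rule card_Missing_cone_Suc_nat[OF a])+
  have "(4 * (card (Missing_cone a (Suc j)) * card (Missing_cone a (Suc (Suc (Suc j)))))) * Q2 =
      4 * ((card (Missing_cone a (Suc j)) * pm.q ^ j) * (card (Missing_cone a (Suc (Suc (Suc j)))) * pm.q ^ Suc (Suc j)))"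
    by (simp add: Q2_def mult_ac)
  also have "\<dots> = (4 * (gbin pm.q (ell S a) j * gbin pm.q (ell S a) (Suc (Suc j)))) * (X * X)"
    unfolding e by (simp only: mult_ac)
  also have "\<dots> \<le> (gbin pm.q (ell S a) (Suc j) * gbin pm.q (ell S a) (Suc j)) * (X * X)"
    by (intro mult_le_mono1 gbin_strongly_log_concave q_ge_2)
  also have "\<dots> = (gbin pm.q (ell S a) (Suc j) * X) * (gbin pm.q (ell S a) (Suc j) * X)"
    by (simp only: mult_ac)
  also have "\<dots> = (card (Missing_cone a (Suc (Suc j))) * card (Missing_cone a (Suc (Suc j)))) * Q2"
    unfolding e(2)[symmetric] Q2_def by (simp only: mult_ac)
  finally have "4 * (card (Missing_cone a (Suc j)) * card (Missing_cone a (Suc (Suc (Suc j))))) \<le> card (Missing_cone a (Suc (Suc j))) * card (Missing_cone a (Suc (Suc j)))"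
    using q_ge_2 by (simp add: Q2_def)
  then show ?thesis by (simp add: Suc)
qed

text \<open>What is left of \<open>num_missing\<close> from dimension s_a on, where the cones 1,
  ..., a have died out.\<close>

definition tail :: "nat \<Rightarrow> nat \<Rightarrow> nat" where
  "tail a i = gbin pm.q K i + (\<Sum>b\<in>{a + 1..h}. card (Missing_cone b i))"

lemma num_missing_tail_0: "num_missing i = tail 0 i"
  by (simp add: num_missing_eq tail_def)

lemma tail_split: "a \<in> {1..h} \<Longrightarrow> tail (a - 1) i = card (Missing_cone a i) + tail a i"
proof -
  assume a: "a \<in> {1..h}"
  then have "{a - 1 + 1..h} = insert a {a + 1..h}" by auto
  then show ?thesis by (simp add: tail_def)
qed

lemma tail_vanish:
  assumes "a \<le> h" "\<And>b. 1 \<le> b \<Longrightarrow> b \<le> a \<Longrightarrow> s_elem S b \<le> i"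
  shows "num_missing i = tail a i"
  using assms
proof (induction a)
  case (Suc a)
  have "card (Missing_cone (Suc a) i) = 0" using Suc.prems by (intro Missing_cone_zero) auto
  then show ?case using tail_split[of "Suc a" i] Suc by simp
qed (simp add: num_missing_tail_0)

text \<open>The largest cone left is a + 1, with exponent \<open>lam S (a + 1)\<close>. For a = h
  the exponent is 0, in accordance with only the subspaces of W being left.\<close>

lemma tail_upper:
  assumes "a \<le> h" shows "tail a i \<le> pm.q ^ (2 * (K * K) + ((h - a + 1) choose 2) * n)"
proof -
  define t where "t = pm.q ^ (K * K + ((h - a + 1) choose 2) * n)"
  have "gbin pm.q K i \<le> pm.q ^ (K * K)" by (rule gbin_le_K) simp
  also have "\<dots> \<le> t" unfolding t_def by (intro q_power_mono) simp
  finally have g: "gbin pm.q K i \<le> t" .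
  have "card (Missing_cone b i) \<le> t" if b: "b \<in> {a + 1..h}" for b
  proof -
    have "lam S b \<le> (h - a + 1) choose 2" unfolding lam_def using b by (intro binomial_right_mono) auto
    then have "pm.q ^ (K * K + lam S b * n) \<le> t" unfolding t_def by (intro q_power_mono add_mono mult_le_mono1) auto
    then show ?thesis using Missing_cone_upper[of b i] b by force
  qed
  then have "(\<Sum>b\<in>{a + 1..h}. card (Missing_cone b i)) \<le> (\<Sum>b\<in>{a + 1..h}. t)" by (rule sum_mono)
  also have "\<dots> \<le> h * t" by simp
  finally have "tail a i \<le> (h + 1) * t" unfolding tail_def using g by (simp add: algebra_simps)
  also have "\<dots> \<le> pm.q ^ K * t"
    using less_power_nat[OF q_ge_2, of K] h_bounds(2) by (intro mult_le_mono1) linarith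
  also have "\<dots> = pm.q ^ (K + K * K + ((h - a + 1) choose 2) * n)" by (simp add: t_def power_add)
  also have "\<dots> \<le> pm.q ^ (2 * (K * K) + ((h - a + 1) choose 2) * n)"
    using K_le_KK by (intro q_power_mono) simp
  finally show ?thesis .
qed

lemma num_missing_upper: "num_missing i \<le> pm.q ^ (2 * (K * K) + lam S 1 * n)"
  using tail_upper[of 0 i] h_bounds(1) by (simp add: num_missing_tail_0 lam_def Suc_diff_le)

lemma num_missing_pos: "i \<le> K \<Longrightarrow> 1 \<le> num_missing i"
  using gbin_pos[of pm.q i K] q_ge_2 by (simp add: num_missing_eq)

lemma num_missing_zero: "K < i \<Longrightarrow> num_missing i = 0"
proof -
  assume i: "K < i"
  have "card (Missing_cone a i) = 0" if "a \<in> {1..h}" for a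
    using Missing_cone_zero[OF that, of i] s_elem_bounds[OF that] i by auto
  then show ?thesis using i by (simp add: num_missing_eq gbin_eq_0)
qed

lemma s_elem_mono: "1 \<le> a \<Longrightarrow> a \<le> b \<Longrightarrow> b \<le> h \<Longrightarrow> s_elem S a \<le> s_elem S b"
  using s_elem_less[of a b] by (cases "a = b") auto

text \<open>Let a be the first cone alive in dimension j. Because j is not in S, all earlier cones
  have died out already in dimension j - 1, so the same strongly log-concave sequence dominates in
  the dimensions j - 1, j, j + 1, perturbed by a tail smaller by about q^(-n). If no cone is alive,
  only the Gaussian binomials of W remain.\<close>

lemma num_missing_log_concave:
  assumes j: "1 \<le> j" "j < K" "j \<notin> S"
  shows "2 * (num_missing (j - 1) * num_missing (j + 1)) \<le> num_missing j * num_missing j"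
proof -
  have neq: "s_elem S b \<noteq> j" if "b \<in> {1..h}" for b using s_elem_in[OF that] j by auto
  obtain i where i: "j = Suc i" using j by (cases j) auto
  show ?thesis
  proof (cases "\<exists>a\<in>{1..h}. j < s_elem S a")
    case False
    have le: "s_elem S b \<le> i" if "1 \<le> b" "b \<le> h" for b
    proof -
      have "\<not> j < s_elem S b" "s_elem S b \<noteq> j" using False neq[of b] that by auto
      then show ?thesis using i by linarith
    qed
    have "num_missing m = gbin pm.q K m" if "i \<le> m" for m
      using tail_vanish[of h m] le that by (fastforce simp: tail_def)
    then show ?thesis using gbin_strongly_log_concave[OF q_ge_2, of K i] by (simp add: i)
  next
    case True
    define a where "a = (LEAST a. a \<in> {1..h} \<and> j < s_elem S a)"
    have a: "a \<in> {1..h}" "j < s_elem S a"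
      using LeastI_ex[of "\<lambda>a. a \<in> {1..h} \<and> j < s_elem S a"] True unfolding a_def by blast+
    have le: "s_elem S b \<le> i" if "1 \<le> b" "b < a" for b
    proof -
      have "\<not> (b \<in> {1..h} \<and> j < s_elem S b)" using not_less_Least that(2) unfolding a_def by blast
      then show ?thesis using neq[of b] that a(1) i by auto
    qed
    define F where "F = (\<lambda>m. card (Missing_cone a m))"
    have NF: "num_missing m = F m + tail a m" if "i \<le> m" for m
      unfolding F_def tail_split[OF a(1), symmetric]
      using a(1) le that by (intro tail_vanish) (fastforce dest: le)+
    define l' m where "l' = ((h - a + 1) choose 2) * n" and "m = lam S a * n"
    have lm: "l' + n \<le> m" unfolding l'_def m_def lam_eq by (simp add: add_mult_distrib)
    define e where "e = pm.q ^ (2 * (K * K) + l')"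
    define g where "g = pm.q ^ (2 * (K * K) + m)"
    have t: "tail a x \<le> e" for x unfolding e_def l'_def using tail_upper[of a x] a by simp
    have F: "F x \<le> g" for x
    proof -
      have "F x \<le> pm.q ^ (K * K + m)" unfolding F_def m_def by (rule Missing_cone_upper[OF a(1)])
      also have "\<dots> \<le> g" unfolding g_def by (intro q_power_mono) simp
      finally show ?thesis .
    qed
    have eg: "e \<le> g" unfolding e_def g_def using lm by (intro q_power_mono) simp
    have Fj: "pm.q ^ m \<le> pm.q * F j" unfolding F_def m_def by (rule Missing_cone_lower[OF a(1) j(1) a(2)])
    have lc: "4 * (F i * F (j + 1)) \<le> F j * F j"
      using Missing_cone_log_concave[OF a(1), of i] by (simp add: F_def i)
    \<comment> \<open>Multiplying out leaves three error products, each at most e * g; doubled they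
      make 6 e g, which should be at most half of F j * F j. The other half is taken by the doubled
      main product.\<close>
    have eg12: "12 * (e * g) \<le> F j * F j"
    proof -
      have "12 * (e * g) * (pm.q * pm.q) \<le> 2 ^ 4 * (e * g) * (pm.q * pm.q)" by simp
      also have "\<dots> \<le> pm.q ^ 4 * (e * g) * (pm.q * pm.q)"
        using power_mono[OF q_ge_2, of 4] by (intro mult_le_mono1) auto
      also have "\<dots> = pm.q ^ (4 + (2 * (K * K) + l' + (2 * (K * K) + m)) + 2)"
        unfolding e_def g_def power_add by (simp add: power2_eq_square)
      also have "\<dots> \<le> pm.q ^ (m + m)" using lm n_ge KK_ge by (intro q_power_mono) linarith
      also have "\<dots> \<le> (pm.q * F j) * (pm.q * F j)" unfolding power_add using Fj by (intro mult_le_mono)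
      also have "\<dots> = (F j * F j) * (pm.q * pm.q)" by (simp only: mult_ac)
      finally show ?thesis using q_ge_2 by simp
    qed
    have "num_missing i * num_missing (j + 1) \<le> (F i + e) * (F (j + 1) + e)"
      using NF[of i] NF[of "j + 1"] t i by (intro mult_le_mono) auto
    also have "\<dots> = F i * F (j + 1) + (F i * e + e * F (j + 1) + e * e)" by (simp add: algebra_simps)
    also have "\<dots> \<le> F i * F (j + 1) + (g * e + e * g + e * g)"
      using F eg by (intro add_mono mult_le_mono) auto
    finally have "2 * (num_missing i * num_missing (j + 1)) \<le> 2 * (F i * F (j + 1)) + 6 * (e * g)" by (simp add: mult.commute)
    then have "2 * (num_missing i * num_missing (j + 1)) \<le> F j * F j" using lc eg12 by linarith
    also have "\<dots> \<le> num_missing j * num_missing j" using NF[of j] i by (intro mult_le_mono) auto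
    finally show ?thesis by (simp add: i)
  qed
qed

text \<open>At j = s_a the cone a has just died out. With x = h - a the exponents of n at j - 1, j,
  j + 1 are at least (x+2) choose 2, at most (x+1) choose 2, and at least x choose 2; the second
  difference 1 produces q^n.\<close>

lemma num_missing_convex:
  assumes "j \<in> S"
  shows "num_missing j * num_missing j * pm.q ^ n \<le> pm.q ^ (4 * (K * K) + 2) * (num_missing (j - 1) * num_missing (j + 1))"
proof -
  obtain a where a: "a \<in> {1..h}" and j: "j = s_elem S a" using S_elem_ex[OF assms] by blast
  note b = s_elem_bounds[OF a]
  have ah: "a \<le> h" using a by simp
  define x where "x = h - a"
  have le: "s_elem S b \<le> j" if "1 \<le> b" "b \<le> a" for b
    unfolding j using s_elem_mono[of b a] that a by auto
  have "num_missing j = tail a j" using le ah by (intro tail_vanish) auto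
  then have Nj: "num_missing j \<le> pm.q ^ (2 * (K * K) + ((x + 1) choose 2) * n)"
    using tail_upper[OF ah, of j] by (simp add: x_def)
  have part: "card (Missing_cone c i) \<le> num_missing i" if "c \<in> {1..h}" for c i
    unfolding num_missing_eq using that by (intro trans_le_add2 member_le_sum) auto
  have Nm: "pm.q ^ (((x + 2) choose 2) * n) \<le> pm.q * num_missing (j - 1)"
  proof -
    have "pm.q ^ (lam S a * n) \<le> pm.q * card (Missing_cone a (j - 1))"
      using b j by (intro Missing_cone_lower[OF a]) auto
    also have "\<dots> \<le> pm.q * num_missing (j - 1)" by (intro mult_le_mono2 part a)
    finally show ?thesis by (simp add: lam_def x_def)
  qed
  \<comment> \<open>If s_(a+1) = j + 1, then the cone a + 1 is gone in dimension j + 1 as well. The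
    cone a + 2 is always alive there, and its exponent suffices. For a \<ge> h - 1 the exponent is 0
    and some missing subspace of W is enough.\<close>
  have Np: "pm.q ^ ((x choose 2) * n) \<le> pm.q * num_missing (j + 1)"
  proof (cases "a + 2 \<le> h")
    case True
    then have c: "a + 2 \<in> {1..h}" by simp
    have "j < s_elem S (a + 1)" "s_elem S (a + 1) < s_elem S (a + 2)"
      using s_elem_less[of a "a + 1"] s_elem_less[of "a + 1" "a + 2"] a True by (auto simp: j)
    then have "pm.q ^ (lam S (a + 2) * n) \<le> pm.q * card (Missing_cone (a + 2) (j + 1))"
      by (intro Missing_cone_lower[OF c]) auto
    also have "\<dots> \<le> pm.q * num_missing (j + 1)" by (intro mult_le_mono2 part c)
    also have "lam S (a + 2) = x choose 2"
    proof -
      have "h - (a + 2) + 2 = h - a" using True by simp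
      then show ?thesis unfolding lam_def x_def by (simp only:)
    qed
    finally show ?thesis .
  next
    case False
    then have "x \<le> 1" by (simp add: x_def)
    then have z: "x choose 2 = 0" by (intro binomial_eq_0) simp
    have "1 \<le> num_missing (j + 1)" using b j by (intro num_missing_pos) simp
    then have "1 * 1 \<le> pm.q * num_missing (j + 1)" using q_ge_2 by (intro mult_le_mono) auto
    then show ?thesis unfolding z by simp
  qed
  have ch: "2 * ((x + 1) choose 2) + 1 = ((x + 2) choose 2) + (x choose 2)"
    using choose_two_Suc[of "x + 1"] choose_two_Suc[of x] by simp
  have "num_missing j * num_missing j * pm.q ^ n \<le> pm.q ^ (2 * (K * K) + ((x + 1) choose 2) * n) * pm.q ^ (2 * (K * K) + ((x + 1) choose 2) * n) * pm.q ^ n"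
    by (intro mult_le_mono Nj order_refl)
  also have "\<dots> = pm.q ^ (4 * (K * K) + (2 * ((x + 1) choose 2) + 1) * n)"
    by (simp add: power_add[symmetric] algebra_simps)
  also have "\<dots> = pm.q ^ (4 * (K * K)) * (pm.q ^ (((x + 2) choose 2) * n) * pm.q ^ ((x choose 2) * n))"
    unfolding ch by (simp add: power_add add_mult_distrib)
  also have "\<dots> \<le> pm.q ^ (4 * (K * K)) * ((pm.q * num_missing (j - 1)) * (pm.q * num_missing (j + 1)))"
    by (intro mult_le_mono Nm Np order_refl)
  also have "\<dots> = pm.q ^ (4 * (K * K) + 2) * (num_missing (j - 1) * num_missing (j + 1))"
    by (simp add: power_add power2_eq_square)
  finally show ?thesis .
qed

section \<open>Size of the coefficients\<close>

definition ikl_coeff :: "nat \<Rightarrow> int" where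
  "ikl_coeff i = coeff (inv_kl_poly (matroid_M S K n :: (label \<Rightarrow> 'f) set pre_matroid)) i"

definition R :: nat where "R = K + n * (1 + ((h + 2) choose 3))"

lemma sum_lam: "(\<Sum>a\<in>{1..h}. lam S a) = (h + 2) choose 3"
proof -
  have "(\<Sum>a\<in>{1..h}. lam S a) = (\<Sum>a\<in>{1..h}. lam S (h + 1 - a))"
    by (rule sum.atLeastAtMost_rev)
  also have "\<dots> = (\<Sum>a\<in>{1..h}. Suc a choose 2)"
    by (intro sum.cong) (auto simp: lam_def)
  also have "\<dots> = (h + 2) choose 3" by (rule hockey_stick)
  finally show ?thesis .
qed

lemma dim_VV: "fvec.dim VV = R"
proof -
  have "card (\<Union>a\<in>{0..h}. IX a) = (\<Sum>a\<in>{0..h}. card (IX a))"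
    by (intro card_UN_disjoint) (auto simp: IX_def)
  also have "\<dots> = card (IX 0) + (\<Sum>a\<in>{1..h}. card (IX a))"
    by (simp add: sum.atLeast_Suc_atMost)
  also have "(\<Sum>a\<in>{1..h}. card (IX a)) = (\<Sum>a\<in>{1..h}. lam S a) * n"
    unfolding sum_distrib_right by (intro sum.cong) (auto simp: card_IX dim_X_def)
  finally have "card (\<Union>a\<in>{0..h}. IX a) = n + ((h + 2) choose 3) * n"
    unfolding sum_lam by (simp add: card_IX dim_X_def)
  moreover have "card IV = card IW + card (\<Union>a\<in>{0..h}. IX a)"
    unfolding IV_def by (intro card_Un_disjoint) (auto simp: IW_def IX_def)
  ultimately show ?thesis by (simp add: VV_eq dim_coord_space card_IW R_def algebra_simps)
qed

text \<open>The summand n comes from X_0 and is the margin in all error estimates.\<close>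

lemma R_ge: "K + n + lam S 1 * n \<le> R"
proof -
  have "lam S 1 \<le> (\<Sum>a\<in>{1..h}. lam S a)" using h_bounds(1) by (intro member_le_sum) auto
  then have "lam S 1 * n \<le> ((h + 2) choose 3) * n" unfolding sum_lam by (rule mult_le_mono1)
  then show ?thesis by (simp add: R_def algebra_simps)
qed

text \<open>No deleted vector has a nonzero coordinate in X_0; a vector v without one is the
  difference of v + e and e.\<close>

lemma lspan_fl_VV: "pm.lspan (pm.fl VV) = VV"
proof
  show "pm.lspan (pm.fl VV) \<subseteq> VV" by (rule pm.lspan_fl[OF pm.subspace_V])
  define e :: "label \<Rightarrow> 'f" where "e = unit_fun (XI 0 1)"
  have good: "\<not> bad v" if "v (XI 0 1) \<noteq> 0" for v
  proof
    assume "bad v"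
    then consider "inW v" | a where "a \<in> {1..h}" "inX a v" by (auto simp: bad_def in_cone_def)
    then have "v (XI 0 1) = 0"
    proof cases
      case 2
      then have "0 \<noteq> a" by simp
      then show ?thesis using 2(2) unfolding inX_def by blast
    qed (simp add: inW_def)
    then show False using that by simp
  qed
  have eV: "e \<in> VV" using n_ge KK_ge by (auto simp: VV_eq coord_space_iff e_def unit_fun_def dim_X_def)
  have e1: "e (XI 0 1) = 1" by (simp add: e_def unit_fun_def)
  have eG: "e \<in> pm.lspan (pm.fl VV)" using good[of e] e1 by (intro good_in_lspan pm.V_subs eV) simp
  show "VV \<subseteq> pm.lspan (pm.fl VV)"
  proof
    fix v assume v: "v \<in> VV"
    show "v \<in> pm.lspan (pm.fl VV)"
    proof (cases "v (XI 0 1) = 0")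
      case True
      then have "\<not> bad (v + e)" using good[of "v + e"] e1 by simp
      then have "v + e \<in> pm.lspan (pm.fl VV)"
        using fvec.subspace_add[OF pm.subspace_V v eV] by (intro good_in_lspan pm.V_subs)
      then have "(v + e) - e \<in> pm.lspan (pm.fl VV)" using eG unfolding pm.lspan_def by (rule fvec.span_diff)
      then show ?thesis by simp
    qed (intro good_in_lspan pm.V_subs v good)
  qed
qed

lemma fl_VV: "pm.fl VV = EE"
  using pm.point_subset_V by (auto simp: pm.fl_def)

lemma rank_VV: "fvec.dim (\<Union>(pm.fl VV)) = fvec.dim VV"
  using dim_lspan_fl[of VV] lspan_fl_VV by simp

lemma ikl_coeff_eq: "ikl_coeff i = (-1) ^ R * coeff (pm.signed_Q VV) i"
proof -
  have "restriction pm.Mat (pm.fl VV) = matroid_M S K n"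
    unfolding fl_VV Mat_eq by (simp add: restriction_def EE_def matroid_M_def)
  then show ?thesis
    using nm.coeff_inv_kl_poly_restriction[OF pm.V_subs rank_VV, of i] by (simp add: ikl_coeff_def dim_VV)
qed

lemma coeff_formula:
  assumes "2 * i < R"
  shows "ikl_coeff i = int (num_missing i) * int pm.q ^ ((R - 2 * i) choose 2) * int (gbin pm.q (R - i - 1) i) +
    (\<Sum>m\<in>{2 * i + 1..R}. (-1) ^ m * int pm.q ^ ((R - m) choose 2) * int (num_missing (m - i)) * int (gbin pm.q (R - (m - i)) i)) +
    int pm.q ^ ((R - 2 * i) choose 2) * (\<Sum>T\<in>pm.subs VV. pm.middle_corr T i)"
  using nm.coeff_inv_kl[OF pm.V_subs rank_VV, of i] assms unfolding dim_VV num_missing_def ikl_coeff_eq .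

lemma middle_corr_0: "T \<in> pm.subs VV \<Longrightarrow> pm.middle_corr T 0 = 0"
proof -
  assume T: "T \<in> pm.subs VV"
  have "pm.fl T = {}" if "fvec.dim T = 0"
  proof -
    have "T = {0}" using fq.subspace_dim_0[of T] pm.subsD(1)[OF T] pm.finite_sub[OF T] that by blast
    then show ?thesis using fl_empty_iff[OF T] bad_0 by simp
  qed
  then show ?thesis by (auto simp: pm.middle_corr_def)
qed

text \<open>Beyond K there are no missing subspaces, so every term vanishes, including the middle
  corrections, whose bound has the factor \<open>miss VV i\<close>. For 2i \<ge> R the degree bound
  takes over.\<close>

lemma coeff_zero: "K < i \<Longrightarrow> ikl_coeff i = 0"
proof (cases "2 * i < R")
  case True
  assume i: "K < i"
  have "(\<Sum>T\<in>pm.subs VV. \<bar>pm.middle_corr T i\<bar>) \<le> 0"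
    using sum_middle_corr_bound[of i] num_missing_zero[OF i] by (simp add: num_missing_def)
  moreover have "\<bar>\<Sum>T\<in>pm.subs VV. pm.middle_corr T i\<bar> \<le> (\<Sum>T\<in>pm.subs VV. \<bar>pm.middle_corr T i\<bar>)" by (rule sum_abs)
  ultimately have "(\<Sum>T\<in>pm.subs VV. pm.middle_corr T i) = 0" by linarith
  moreover have "(\<Sum>m\<in>{2 * i + 1..R}. (-1) ^ m * int pm.q ^ ((R - m) choose 2) * int (num_missing (m - i)) * int (gbin pm.q (R - (m - i)) i)) = 0"
    using i num_missing_zero by (intro sum.neutral) auto
  ultimately show ?thesis unfolding coeff_formula[OF True] using num_missing_zero[OF i] by simp
next
  case False
  have "pm.fl VV \<noteq> {}"
  proof
    assume "pm.fl VV = {}"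
    then have "fvec.dim VV = fvec.dim ({} :: (label \<Rightarrow> 'f) set)" using rank_VV by simp
    also have "\<dots> = 0" using fq.dim_zero_subspace[where 'f = 'f and 'i = label] fvec.dim_span[of "{} :: (label \<Rightarrow> 'f) set"] by simp
    finally show False using R_ge h_bounds by (simp add: dim_VV)
  qed
  then have "2 * degree (pm.signed_Q VV) < R" using pm.degree_signed_Q[OF pm.V_subs] by (simp add: rank_VV dim_VV)
  then show ?thesis using False by (simp add: ikl_coeff_eq coeff_eq_0)
qed

section \<open>The main term against the errors\<close>

definition main_term :: "nat \<Rightarrow> nat" where
  "main_term i = pm.q ^ ((R - 2 * i) choose 2) * gbin pm.q (R - i - 1) i"

lemma R_large: assumes "i \<le> K" shows "2 * i < R" "2 * i + 1 \<le> R" "19 * (K * K) \<le> R - 2 * i"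
  using assms R_ge n_ge KK_ge K_le_KK by linarith+

text \<open>Each of the two errors is at most a twentieth of the main term: the terms with m > 2i
  lose a power R - 2i - 1 of q, the middle corrections lose against the Gaussian binomial G.\<close>

lemma coeff_estimate:
  assumes i: "i \<le> K"
  shows "10 * \<bar>ikl_coeff i - int (num_missing i * main_term i)\<bar> \<le> int (num_missing i * main_term i)"
proof -
  note Rl = R_large[OF i]
  define E where "E = (R - 2 * i) choose 2"
  define E' where "E' = (R - (2 * i + 1)) choose 2"
  define G where "G = gbin pm.q (R - i - 1) i"
  have EE': "E = E' + (R - 2 * i - 1)"
    using choose_two_Suc[of "R - (2 * i + 1)"] Rl(1) by (simp add: E_def E'_def Suc_diff_Suc)
  have G1: "pm.q ^ (i * (R - 2 * i - 1)) \<le> G"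
  proof -
    have "R - i - 1 - i = R - 2 * i - 1" by simp
    then show ?thesis
      unfolding G_def using power_le_gbin[of pm.q i "R - i - 1"] q_ge_2 Rl by simp
  qed
  have K1: "K \<le> pm.q ^ K" using less_power_nat[OF q_ge_2, of K] by simp
  have q5: "20 \<le> pm.q ^ 5" using power_mono[OF q_ge_2, of 5] by simp
  define S1 where "S1 = (\<Sum>m\<in>{2 * i + 1..R}. (-1) ^ m * int pm.q ^ ((R - m) choose 2) * int (num_missing (m - i)) * int (gbin pm.q (R - (m - i)) i))"
  define b where "b = pm.q ^ E' * pm.q ^ (2 * (K * K) + lam S 1 * n) * G"
  \<comment> \<open>Only m \<le> i + K contribute, as there are no missing subspaces of dimension
    above K; that leaves at most K terms.\<close>
  have S1K: "\<bar>S1\<bar> \<le> int (K * b)"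
  proof -
    have "S1 = (\<Sum>m\<in>{2 * i + 1..R} \<inter> {..i + K}. (-1) ^ m * int pm.q ^ ((R - m) choose 2) * int (num_missing (m - i)) * int (gbin pm.q (R - (m - i)) i))"
      unfolding S1_def using num_missing_zero by (intro sum.mono_neutral_right) auto
    also have "\<bar>\<dots>\<bar> \<le> (\<Sum>m\<in>{2 * i + 1..R} \<inter> {..i + K}. int b)"
    proof (rule order_trans[OF sum_abs sum_mono])
      fix m assume m: "m \<in> {2 * i + 1..R} \<inter> {..i + K}"
      have "pm.q ^ ((R - m) choose 2) \<le> pm.q ^ E'"
        unfolding E'_def using m by (intro q_power_mono binomial_right_mono) auto
      moreover have "gbin pm.q (R - (m - i)) i \<le> G"
        unfolding G_def using m q_ge_2 by (intro gbin_mono) auto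
      ultimately have "pm.q ^ ((R - m) choose 2) * num_missing (m - i) * gbin pm.q (R - (m - i)) i \<le> b"
        unfolding b_def by (intro mult_le_mono num_missing_upper)
      then have "int (pm.q ^ ((R - m) choose 2) * num_missing (m - i) * gbin pm.q (R - (m - i)) i) \<le> int b"
        by (simp only: of_nat_le_iff)
      then show "\<bar>(-1) ^ m * int pm.q ^ ((R - m) choose 2) * int (num_missing (m - i)) * int (gbin pm.q (R - (m - i)) i)\<bar> \<le> int b"
        by (simp add: abs_mult)
    qed
    also have "\<dots> = int (card ({2 * i + 1..R} \<inter> {..i + K}) * b)" by simp
    also have "\<dots> \<le> int (K * b)"
    proof -
      have "card ({2 * i + 1..R} \<inter> {..i + K}) \<le> card {2 * i + 1..i + K}" by (intro card_mono) auto
      also have "\<dots> \<le> K" by simp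
      finally show ?thesis unfolding of_nat_le_iff by (rule mult_le_mono1)
    qed
    finally show ?thesis .
  qed
  have Kb: "20 * (K * b) \<le> num_missing i * main_term i"
  proof -
    have "20 * (K * b) \<le> pm.q ^ 5 * (pm.q ^ K * b)" by (intro mult_le_mono q5 K1 order_refl)
    also have "\<dots> = pm.q ^ (5 + K + E' + (2 * (K * K) + lam S 1 * n)) * G" by (simp add: b_def power_add mult_ac)
    also have "\<dots> \<le> pm.q ^ E * G"
      unfolding EE' using R_ge n_ge KK_ge K_le_KK i by (intro mult_le_mono1 q_power_mono) linarith
    also have "\<dots> = 1 * main_term i" by (simp add: main_term_def E_def G_def)
    also have "\<dots> \<le> num_missing i * main_term i" by (rule mult_le_mono1[OF num_missing_pos[OF i]])
    finally show ?thesis .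
  qed
  have S1: "20 * \<bar>S1\<bar> \<le> int (num_missing i * main_term i)"
  proof -
    have "20 * \<bar>S1\<bar> \<le> 20 * int (K * b)" using S1K by (rule mult_left_mono) simp
    also have "\<dots> = int (20 * (K * b))" by simp
    also have "\<dots> \<le> int (num_missing i * main_term i)" using Kb by (simp only: of_nat_le_iff)
    finally show ?thesis .
  qed
  define S2 where "S2 = (\<Sum>T\<in>pm.subs VV. pm.middle_corr T i)"
  have S2: "20 * \<bar>int pm.q ^ E * S2\<bar> \<le> int (num_missing i * main_term i)"
  proof (cases "i = 0")
    case True
    then have "S2 = 0" unfolding S2_def using middle_corr_0 by (intro sum.neutral) auto
    then show ?thesis by simp
  next
    case False
    have "\<bar>S2\<bar> \<le> int (num_missing i * h * pm.q ^ ((K + lam S 1 * n) * i) * pm.q ^ (K * K))"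
      unfolding S2_def num_missing_def by (rule order_trans[OF sum_abs sum_middle_corr_bound])
    then have "20 * \<bar>int pm.q ^ E * S2\<bar> \<le> 20 * (int pm.q ^ E * int (num_missing i * h * pm.q ^ ((K + lam S 1 * n) * i) * pm.q ^ (K * K)))"
      unfolding abs_mult by (intro mult_left_mono mult_mono) auto
    also have "\<dots> = int (num_missing i * (pm.q ^ E * (20 * h * pm.q ^ ((K + lam S 1 * n) * i) * pm.q ^ (K * K))))"
      by simp
    also have "\<dots> \<le> int (num_missing i * (pm.q ^ E * G))"
      unfolding of_nat_le_iff
    proof (intro mult_le_mono2)
      have "20 * h * pm.q ^ ((K + lam S 1 * n) * i) * pm.q ^ (K * K) \<le>
          pm.q ^ 5 * pm.q ^ K * pm.q ^ ((K + lam S 1 * n) * i) * pm.q ^ (K * K)"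
        using K1 h_bounds(2) by (intro mult_le_mono q5 order_refl) linarith
      also have "\<dots> = pm.q ^ (5 + K + (K + lam S 1 * n) * i + K * K)" by (simp add: power_add)
      also have "\<dots> \<le> pm.q ^ (i * (R - 2 * i - 1))"
      proof (rule q_power_mono)
        \<comment> \<open>The surplus of R - 2i - 1 over K + lambda_1 n. It is gained i times but
          needed once, which is why i = 0 is treated apart.\<close>
        define z where "z = n - 2 * i - 1"
        have z: "5 + K + K * K \<le> z" unfolding z_def using n_ge KK_ge K_le_KK i by linarith
        have "(K + lam S 1 * n) + z \<le> R - 2 * i - 1"
          unfolding z_def using R_ge n_ge KK_ge K_le_KK i by linarith
        then have le: "i * ((K + lam S 1 * n) + z) \<le> i * (R - 2 * i - 1)" by (rule mult_le_mono2)
        have "(K + lam S 1 * n) * i + z \<le> (K + lam S 1 * n) * i + i * z" using False by simp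
        also have "\<dots> = i * ((K + lam S 1 * n) + z)" by (simp add: algebra_simps)
        also note le
        finally show "5 + K + (K + lam S 1 * n) * i + K * K \<le> i * (R - 2 * i - 1)"
          using z by linarith
      qed
      also note G1
      finally show "20 * h * pm.q ^ ((K + lam S 1 * n) * i) * pm.q ^ (K * K) \<le> G" .
    qed
    also have "num_missing i * (pm.q ^ E * G) = num_missing i * main_term i" by (simp add: main_term_def E_def G_def)
    finally show ?thesis .
  qed
  have "ikl_coeff i - int (num_missing i * main_term i) = S1 + int pm.q ^ E * S2"
    unfolding coeff_formula[OF Rl(1)] S1_def S2_def E_def main_term_def by simp
  then have "\<bar>ikl_coeff i - int (num_missing i * main_term i)\<bar> \<le> \<bar>S1\<bar> + \<bar>int pm.q ^ E * S2\<bar>"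
    by (simp only: abs_triangle_ineq)
  then have "10 * \<bar>ikl_coeff i - int (num_missing i * main_term i)\<bar> \<le> 10 * (\<bar>S1\<bar> + \<bar>int pm.q ^ E * S2\<bar>)"
    by (rule mult_left_mono) simp
  moreover have "2 * (10 * (x + y)) \<le> 2 * z" if "20 * x \<le> z" "20 * y \<le> z" for x y z :: int
    using that by simp
  from this[OF S1 S2] have "10 * (\<bar>S1\<bar> + \<bar>int pm.q ^ E * S2\<bar>) \<le> int (num_missing i * main_term i)"
    by (simp only: mult_le_cancel_left_pos zero_less_numeral)
  ultimately show ?thesis by (rule order_trans)
qed

text \<open>
  The power of \<open>q\<close> in \<open>growth\<close> is geometric in \<open>i\<close> by \<open>choose_two_shift\<close>, so only the bounded factor
  \<open>qprod\<close> contributes to \<open>growth i ^ 2 / (growth (i - 1) * growth (i + 1))\<close>.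
\<close>

definition growth :: "nat \<Rightarrow> real" where
  "growth i = real pm.q ^ (R choose 2) / (real pm.q ^ (i * R) * qprod (real pm.q) i)"

definition qfactor :: "nat \<Rightarrow> real" where "qfactor i = 1 - 1 / real pm.q ^ i"

lemma qfactor_bounds: "1 \<le> i \<Longrightarrow> 1 / 2 \<le> qfactor i" "qfactor i \<le> 1"
proof -
  assume "1 \<le> i"
  then have "2 \<le> pm.q ^ i" using q_power_mono[of 1 i] q_ge_2 by simp
  then have "real 2 \<le> real (pm.q ^ i)" by (simp only: of_nat_le_iff)
  then have "2 \<le> real pm.q ^ i" by simp
  then have "1 / real pm.q ^ i \<le> 1 / 2" by (intro frac_le) auto
  then show "1 / 2 \<le> qfactor i" unfolding qfactor_def by linarith
next
  show "qfactor i \<le> 1" by (simp add: qfactor_def)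
qed

lemma qfactor_mono: "qfactor i \<le> qfactor (Suc i)"
proof -
  have "real pm.q ^ i \<le> real pm.q ^ Suc i" using q_ge_2 by (intro power_increasing) auto
  then show ?thesis using q_ge_2 unfolding qfactor_def by (intro diff_left_mono frac_le) auto
qed

lemma qprod_pos: "0 < qprod (real pm.q) i"
  unfolding qprod_def
proof (rule prod_pos)
  fix t assume "t \<in> {..<i}"
  have "1 / 2 \<le> qfactor (Suc t)" by (rule qfactor_bounds) simp
  then show "0 < 1 - 1 / real pm.q ^ Suc t" unfolding qfactor_def by linarith
qed

lemma growth_pos: "0 < growth i"
  using qprod_pos[of i] q_ge_2 by (simp add: growth_def)

lemma growth_Suc: "growth (Suc i) * (real pm.q ^ R * qfactor (Suc i)) = growth i"
proof -
  have "qfactor (Suc i) \<noteq> 0" using qfactor_bounds(1)[of "Suc i"] by simp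
  then show ?thesis using qprod_pos[of i] q_ge_2
    by (simp add: growth_def qprod_Suc qfactor_def[symmetric] power_add field_simps del: power_Suc)
qed

text \<open>By \<open>growth_Suc\<close> the quotient of the two products is qfactor (i+2) / qfactor
  (i+1). It is at least 1 by monotonicity and at most 2 as \<open>qfactor\<close> lies between 1/2
  and 1.\<close>

lemma growth_square: "growth i * growth (Suc (Suc i)) \<le> growth (Suc i) * growth (Suc i)" "growth (Suc i) * growth (Suc i) \<le> 2 * (growth i * growth (Suc (Suc i)))"
proof -
  have e: "growth i * growth (Suc (Suc i)) * qfactor (Suc (Suc i)) = growth (Suc i) * growth (Suc i) * qfactor (Suc i)"
  proof -
    have "growth i * growth (Suc (Suc i)) * qfactor (Suc (Suc i)) =
        growth (Suc i) * qfactor (Suc i) * (growth (Suc (Suc i)) * (real pm.q ^ R * qfactor (Suc (Suc i))))"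
      unfolding growth_Suc[of i, symmetric] by (simp only: mult_ac)
    also have "\<dots> = growth (Suc i) * qfactor (Suc i) * growth (Suc i)" unfolding growth_Suc ..
    finally show ?thesis by (simp only: mult_ac)
  qed
  have p: "0 < growth i * growth (Suc (Suc i))" "0 < growth (Suc i) * growth (Suc i)" using growth_pos by simp_all
  have v: "1 / 2 \<le> qfactor (Suc i)" "qfactor (Suc i) \<le> qfactor (Suc (Suc i))" "qfactor (Suc (Suc i)) \<le> 1" "0 < qfactor (Suc (Suc i))"
    using qfactor_bounds[of "Suc i"] qfactor_mono[of "Suc i"] qfactor_bounds[of "Suc (Suc i)"] by simp_all
  have "growth i * growth (Suc (Suc i)) * qfactor (Suc (Suc i)) \<le> growth (Suc i) * growth (Suc i) * qfactor (Suc (Suc i))"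
    unfolding e using p v by (intro mult_left_mono) auto
  then show "growth i * growth (Suc (Suc i)) \<le> growth (Suc i) * growth (Suc i)" using v(4) by (simp add: mult_le_cancel_right)
  have "growth (Suc i) * growth (Suc i) * (1 / 2) \<le> growth (Suc i) * growth (Suc i) * qfactor (Suc i)" using p v by (intro mult_left_mono) auto
  also have "\<dots> = growth i * growth (Suc (Suc i)) * qfactor (Suc (Suc i))" by (rule e[symmetric])
  also have "\<dots> \<le> growth i * growth (Suc (Suc i)) * 1" using p v by (intro mult_left_mono) auto
  finally show "growth (Suc i) * growth (Suc i) \<le> 2 * (growth i * growth (Suc (Suc i)))" by simp
qed

text \<open>By \<open>gbin_qprod\<close> the two sides differ by the product D alone, and 1 - D
  \<le> i / q^(R - 2i) \<le> 1/9.\<close>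

lemma main_term_bounds:
  assumes i: "i \<le> K"
  shows "8 / 9 * (real (num_missing i) * growth i) \<le> real (num_missing i * main_term i)" "real (num_missing i * main_term i) \<le> real (num_missing i) * growth i"
proof -
  note Rl = R_large[OF i]
  define D where "D = (\<Prod>t<i. 1 - 1 / real pm.q ^ (R - i - 1 - t))"
  have ik: "i \<le> R - i - 1" using Rl by simp
  have d1: "R - i - 1 - i = R - 2 * i - 1" "R - i - 1 - i + 1 = R - 2 * i" using Rl by auto
  have D: "1 - real i / real pm.q ^ (R - 2 * i) \<le> D" "D \<le> 1"
    using prod_one_minus_bounds[OF q_ge_2 ik] unfolding D_def d1(2) by blast+
  have "9 * i \<le> pm.q ^ 4 * pm.q ^ K"
    using power_mono[OF q_ge_2, of 4] less_power_nat[OF q_ge_2, of K] i by (intro mult_le_mono) auto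
  also have "\<dots> = pm.q ^ (4 + K)" by (simp add: power_add)
  also have "\<dots> \<le> pm.q ^ (R - 2 * i)" using Rl(3) KK_ge K_le_KK by (intro q_power_mono) linarith
  finally have "real (9 * i) \<le> real (pm.q ^ (R - 2 * i))" by (simp only: of_nat_le_iff)
  then have "real i / real pm.q ^ (R - 2 * i) \<le> 1 / 9" using q_ge_2 by (simp add: field_simps)
  then have D9: "8 / 9 \<le> D" using D(1) by simp
  have "real (main_term i) * qprod (real pm.q) i = real pm.q ^ ((R - 2 * i) choose 2) * (real pm.q ^ (i * (R - 2 * i - 1)) * D)"
    using gbin_qprod[OF q_ge_2 ik] unfolding main_term_def D_def d1 by (simp add: mult_ac)
  then have "real (main_term i) * qprod (real pm.q) i * real pm.q ^ (i * R) =
      real pm.q ^ (((R - 2 * i) choose 2) + i * (R - 2 * i - 1) + i * R) * D"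
    by (simp add: power_add mult_ac)
  then have "real (main_term i) * qprod (real pm.q) i * real pm.q ^ (i * R) = real pm.q ^ (R choose 2) * D"
    unfolding choose_two_shift[OF Rl(1)] .
  then have AY: "real (main_term i) = growth i * D" using qprod_pos[of i] q_ge_2 by (simp add: growth_def field_simps)
  have p: "0 \<le> real (num_missing i) * growth i" using growth_pos[of i] by simp
  have e: "real (num_missing i * main_term i) = real (num_missing i) * growth i * D" by (simp add: AY)
  have "real (num_missing i) * growth i * (8 / 9) \<le> real (num_missing i) * growth i * D" using p D9 by (rule mult_left_mono[rotated])
  then show "8 / 9 * (real (num_missing i) * growth i) \<le> real (num_missing i * main_term i)" unfolding e by simp
  have "real (num_missing i) * growth i * D \<le> real (num_missing i) * growth i * 1" using p D(2) by (intro mult_left_mono)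
  then show "real (num_missing i * main_term i) \<le> real (num_missing i) * growth i" unfolding e by simp
qed

text \<open>The constant 4/5 is 9/10 from \<open>coeff_estimate\<close> times 8/9 from
  \<open>main_term_bounds\<close>.\<close>

lemma ikl_coeff_bounds:
  assumes i: "i \<le> K"
  shows "4 / 5 * (real (num_missing i) * growth i) \<le> ikl_coeff i" "ikl_coeff i \<le> 11 / 10 * (real (num_missing i) * growth i)"
proof -
  have "real_of_int (10 * \<bar>ikl_coeff i - int (num_missing i * main_term i)\<bar>) \<le> real_of_int (int (num_missing i * main_term i))"
    using coeff_estimate[OF i] by (simp only: of_int_le_iff)
  then have "10 * \<bar>real_of_int (ikl_coeff i) - real (num_missing i * main_term i)\<bar> \<le> real (num_missing i * main_term i)" by simp
  moreover have "4 / 5 * y \<le> a \<and> a \<le> 11 / 10 * y"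
    if "10 * \<bar>a - x\<bar> \<le> x" "8 / 9 * y \<le> x" "x \<le> y" for a x y :: real
    using that by (cases "a \<le> x") auto
  ultimately show "4 / 5 * (real (num_missing i) * growth i) \<le> ikl_coeff i" "ikl_coeff i \<le> 11 / 10 * (real (num_missing i) * growth i)"
    using main_term_bounds[OF i] by blast+
qed

section \<open>Shape of the coefficient sequence\<close>

lemma ikl_coeff_pos: "i \<le> K \<Longrightarrow> 0 < ikl_coeff i"
proof -
  assume i: "i \<le> K"
  have "0 < real (num_missing i) * growth i" using num_missing_pos[OF i] growth_pos[of i] by simp
  then show ?thesis using ikl_coeff_bounds(1)[OF i] by linarith
qed

text \<open>\<open>growth\<close> falls by at least q^R / 2 in each step, more than the number of
  missing subspaces can make up for.\<close>

lemma ikl_coeff_decreasing: assumes j: "j < K" shows "ikl_coeff (j + 1) < ikl_coeff j"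
proof -
  have "4 * num_missing (Suc j) \<le> pm.q ^ 2 * pm.q ^ (2 * (K * K) + lam S 1 * n)"
    using power_mono[OF q_ge_2, of 2] by (intro mult_le_mono num_missing_upper) auto
  also have "\<dots> = pm.q ^ (2 + (2 * (K * K) + lam S 1 * n))" by (simp only: power_add)
  also have "\<dots> \<le> pm.q ^ R" using R_ge n_ge KK_ge by (intro q_power_mono) linarith
  finally have "real (4 * num_missing (Suc j)) \<le> real (pm.q ^ R)" by (simp only: of_nat_le_iff)
  then have NR: "4 * real (num_missing (Suc j)) \<le> real pm.q ^ R" by simp
  have "4 * real (num_missing (Suc j)) * growth (Suc j) * (1 / 2) \<le> real pm.q ^ R * growth (Suc j) * qfactor (Suc j)"
    using NR growth_pos[of "Suc j"] qfactor_bounds(1)[of "Suc j"] by (intro mult_mono mult_right_mono) auto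
  also have "\<dots> = growth j" using growth_Suc[of j] by (simp add: mult_ac)
  finally have a: "2 * (real (num_missing (Suc j)) * growth (Suc j)) \<le> growth j" by (simp add: mult_ac)
  have b: "1 * growth j \<le> real (num_missing j) * growth j" using num_missing_pos[of j] j growth_pos[of j] by (intro mult_right_mono) auto
  have c: "real_of_int (ikl_coeff (Suc j)) \<le> 11 / 10 * (real (num_missing (Suc j)) * growth (Suc j))"
    "4 / 5 * (real (num_missing j) * growth j) \<le> real_of_int (ikl_coeff j)"
    using ikl_coeff_bounds(2)[of "Suc j"] ikl_coeff_bounds(1)[of j] j by simp_all
  have "real_of_int (ikl_coeff (Suc j)) < real_of_int (ikl_coeff j)"
    using a b c growth_pos[of j] by linarith
  then show ?thesis by simp
qed

text \<open>The factor 2 of \<open>num_missing_log_concave\<close> outweighs the inaccuracy of the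
  bounds: (11/10)^2 / 2 < (4/5)^2.\<close>

lemma ikl_coeff_log_concave:
  assumes j: "1 \<le> j" "j < K" "j \<notin> S"
  shows "ikl_coeff (j - 1) * ikl_coeff (j + 1) < (ikl_coeff j)\<^sup>2"
proof -
  obtain i where i: "j = Suc i" using j by (cases j) auto
  define Z where "Z = (real (num_missing j) * growth j) * (real (num_missing j) * growth j)"
  have Zp: "0 < Z" using num_missing_pos[of j] growth_pos[of j] j by (simp add: Z_def)
  have "real (2 * (num_missing i * num_missing (Suc j))) \<le> real (num_missing j * num_missing j)"
    using num_missing_log_concave[OF j] by (simp only: of_nat_le_iff i) simp
  then have NN: "real (num_missing i) * real (num_missing (Suc j)) \<le> (real (num_missing j) * real (num_missing j)) / 2" by simp
  have "real_of_int (ikl_coeff i) * real_of_int (ikl_coeff (Suc j)) \<le>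
      (11 / 10 * (real (num_missing i) * growth i)) * (11 / 10 * (real (num_missing (Suc j)) * growth (Suc j)))"
    using ikl_coeff_bounds(2)[of i] ikl_coeff_bounds(2)[of "Suc j"] ikl_coeff_pos[of "Suc j"] j i growth_pos[of i]
    by (intro mult_mono) auto
  also have "\<dots> = 121 / 100 * ((real (num_missing i) * real (num_missing (Suc j))) * (growth i * growth (Suc j)))" by simp
  also have "\<dots> \<le> 121 / 100 * ((real (num_missing j) * real (num_missing j)) / 2 * (growth j * growth j))"
  proof (rule mult_left_mono[OF mult_mono[OF NN]])
    show "growth i * growth (Suc j) \<le> growth j * growth j" using growth_square(1)[of i] by (simp add: i)
  qed (use growth_pos[of i] growth_pos[of "Suc j"] in simp_all)
  also have "\<dots> = 121 / 200 * Z" by (simp add: Z_def)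
  also have "\<dots> < 16 / 25 * Z" using Zp by simp
  also have "\<dots> = (4 / 5 * (real (num_missing j) * growth j)) * (4 / 5 * (real (num_missing j) * growth j))" by (simp add: Z_def)
  also have "\<dots> \<le> real_of_int (ikl_coeff j) * real_of_int (ikl_coeff j)"
    using ikl_coeff_bounds(1)[of j] ikl_coeff_pos[of j] j growth_pos[of j] by (intro mult_mono) auto
  finally have "real_of_int (ikl_coeff i * ikl_coeff (Suc j)) < real_of_int ((ikl_coeff j)\<^sup>2)"
    by (simp add: power2_eq_square)
  then show ?thesis unfolding of_int_less_iff using i by simp
qed

text \<open>The constant 4 is (11/10)^2 * 2 / (4/5)^2 = 121/32 rounded up, the 2 coming from
  \<open>growth_square\<close>.\<close>

lemma ikl_coeff_convex:
  assumes jS: "j \<in> S"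
  shows "(real_of_int (ikl_coeff j))\<^sup>2 \<le> 4 * real pm.q ^ (4 * (K * K) + 2) / real pm.q ^ n * (real_of_int (ikl_coeff (j - 1)) * real_of_int (ikl_coeff (j + 1)))"
proof -
  have j: "1 \<le> j" "j < K" using jS S_subset by fastforce+
  obtain i where i: "j = Suc i" using j by (cases j) auto
  define t where "t = real pm.q ^ (4 * (K * K) + 2) / real pm.q ^ n"
  have tp: "0 \<le> t" by (simp add: t_def)
  have "real (num_missing j * num_missing j * pm.q ^ n) \<le> real (pm.q ^ (4 * (K * K) + 2) * (num_missing i * num_missing (Suc j)))"
    using num_missing_convex[OF jS] unfolding of_nat_le_iff by (simp add: i)
  then have NN: "real (num_missing j) * real (num_missing j) \<le> t * (real (num_missing i) * real (num_missing (Suc j)))"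
    using q_ge_2 by (simp add: t_def field_simps)
  have "(real_of_int (ikl_coeff j))\<^sup>2 \<le> (11 / 10 * (real (num_missing j) * growth j)) * (11 / 10 * (real (num_missing j) * growth j))"
    unfolding power2_eq_square using ikl_coeff_bounds(2)[of j] ikl_coeff_pos[of j] j growth_pos[of j] by (intro mult_mono) auto
  also have "\<dots> = 121 / 100 * ((real (num_missing j) * real (num_missing j)) * (growth j * growth j))" by simp
  also have "\<dots> \<le> 121 / 100 * ((t * (real (num_missing i) * real (num_missing (Suc j)))) * (2 * (growth i * growth (Suc j))))"
  proof (rule mult_left_mono[OF mult_mono[OF NN]])
    show "growth j * growth j \<le> 2 * (growth i * growth (Suc j))" using growth_square(2)[of i] by (simp add: i)
  qed (use growth_pos[of j] tp in simp_all)
  also have "\<dots> = 121 / 32 * t * ((4 / 5 * (real (num_missing i) * growth i)) * (4 / 5 * (real (num_missing (Suc j)) * growth (Suc j))))" by simp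
  also have "\<dots> \<le> 4 * t * (real_of_int (ikl_coeff i) * real_of_int (ikl_coeff (Suc j)))"
    using ikl_coeff_bounds(1)[of i] ikl_coeff_bounds(1)[of "Suc j"] ikl_coeff_pos[of i] ikl_coeff_pos[of "Suc j"] j i tp growth_pos
    by (intro mult_mono mult_nonneg_nonneg) (auto simp: less_imp_le)
  finally show ?thesis by (simp add: t_def i)
qed

lemma ikl_coeff_convex_strict:
  assumes jS: "j \<in> S"
  shows "(ikl_coeff j)\<^sup>2 < ikl_coeff (j - 1) * ikl_coeff (j + 1)"
proof -
  have j: "1 \<le> j" "j < K" using jS S_subset by fastforce+
  have "4 * pm.q ^ (4 * (K * K) + 2) \<le> pm.q ^ 2 * pm.q ^ (4 * (K * K) + 2)"
    using power_mono[OF q_ge_2, of 2] by (intro mult_le_mono1) auto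
  also have "\<dots> = pm.q ^ (2 + (4 * (K * K) + 2))" by (simp only: power_add)
  also have "\<dots> < pm.q ^ n" using q_ge_2 n_ge KK_ge by (intro power_strict_increasing) auto
  finally have "real (4 * pm.q ^ (4 * (K * K) + 2)) < real (pm.q ^ n)" by (simp only: of_nat_less_iff)
  then have "4 * real pm.q ^ (4 * (K * K) + 2) / real pm.q ^ n < 1" using q_ge_2 by (simp add: field_simps)
  moreover have "0 < real_of_int (ikl_coeff (j - 1)) * real_of_int (ikl_coeff (j + 1))"
    using ikl_coeff_pos[of "j - 1"] ikl_coeff_pos[of "j + 1"] j by simp
  ultimately have "4 * real pm.q ^ (4 * (K * K) + 2) / real pm.q ^ n * (real_of_int (ikl_coeff (j - 1)) * real_of_int (ikl_coeff (j + 1)))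
      < 1 * (real_of_int (ikl_coeff (j - 1)) * real_of_int (ikl_coeff (j + 1)))"
    by (rule mult_strict_right_mono)
  then have "real_of_int ((ikl_coeff j)\<^sup>2) < real_of_int (ikl_coeff (j - 1) * ikl_coeff (j + 1))" using ikl_coeff_convex[OF jS] by simp
  then show ?thesis by (simp only: of_int_less_iff)
qed

lemma ikl_coeff_ratio_bound:
  assumes jS: "j \<in> S"
  shows "0 \<le> (real_of_int (ikl_coeff j))\<^sup>2 / (real_of_int (ikl_coeff (j - 1)) * real_of_int (ikl_coeff (j + 1)))"
    and "(real_of_int (ikl_coeff j))\<^sup>2 / (real_of_int (ikl_coeff (j - 1)) * real_of_int (ikl_coeff (j + 1))) \<le>
      4 * real pm.q ^ (4 * (K * K) + 2) / real pm.q ^ n"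
proof -
  have j: "1 \<le> j" "j < K" using jS S_subset by fastforce+
  have p: "0 < real_of_int (ikl_coeff (j - 1)) * real_of_int (ikl_coeff (j + 1))"
    using ikl_coeff_pos[of "j - 1"] ikl_coeff_pos[of "j + 1"] j by simp
  show "0 \<le> (real_of_int (ikl_coeff j))\<^sup>2 / (real_of_int (ikl_coeff (j - 1)) * real_of_int (ikl_coeff (j + 1)))"
    using p by (intro divide_nonneg_pos) auto
  show "(real_of_int (ikl_coeff j))\<^sup>2 / (real_of_int (ikl_coeff (j - 1)) * real_of_int (ikl_coeff (j + 1))) \<le>
      4 * real pm.q ^ (4 * (K * K) + 2) / real pm.q ^ n"
    using ikl_coeff_convex[OF jS] p by (simp only: pos_divide_le_eq)
qed

lemma degree_inv_kl: "degree (inv_kl_poly (matroid_M S K n :: (label \<Rightarrow> 'f) set pre_matroid)) = K"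
proof (rule antisym)
  show "degree (inv_kl_poly (matroid_M S K n :: (label \<Rightarrow> 'f) set pre_matroid)) \<le> K"
    using coeff_zero by (intro degree_le) (simp add: ikl_coeff_def)
  show "K \<le> degree (inv_kl_poly (matroid_M S K n :: (label \<Rightarrow> 'f) set pre_matroid))"
    using ikl_coeff_pos[of K] by (intro le_degree) (simp add: ikl_coeff_def)
qed

section \<open>Simplicity, connectivity and representability\<close>

lemma simple_matroid_M: "simple_matroid (matroid_M S K n :: (label \<Rightarrow> 'f) set pre_matroid)"
  unfolding simple_matroid_def Mat_eq[symmetric] pm.ground_Mat pm.rk_Mat
proof (intro conjI ballI impI)
  fix e assume "e \<in> EE"
  then show "fvec.dim (\<Union>{e}) = 1" by (simp add: pm.dim_point)
next
  fix e f assume ef: "e \<in> EE" "f \<in> EE" "e \<noteq> f"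
  have sub: "{e, f} \<subseteq> EE" using ef by simp
  have "fvec.dim (\<Union>{e, f}) \<le> card {e, f}"
  proof -
    have "\<forall>A. A \<subseteq> EE \<longrightarrow> fvec.dim (\<Union>A) \<le> card A"
      using pm.matroid_Mat unfolding matroid_def pm.ground_Mat pm.rk_Mat by (elim conjE)
    then show ?thesis using sub by blast
  qed
  also have "\<dots> = 2" using ef by simp
  finally have le: "fvec.dim (\<Union>{e, f}) \<le> 2" .
  have es: "fvec.subspace e" "fvec.subspace f"
    using pm.points[OF ef(1)] pm.points[OF ef(2)] fvec.subspace_span by auto
  have el: "e \<subseteq> pm.lspan {e, f}" "f \<subseteq> pm.lspan {e, f}" by (auto intro: pm.subset_lspan[THEN subsetD])
  have "e \<noteq> pm.lspan {e, f}"
  proof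
    assume "e = pm.lspan {e, f}"
    then have "f \<subseteq> e" using el by simp
    moreover have "finite e" using pm.finite_V pm.point_subset_V[OF ef(1)] finite_subset by blast
    ultimately have "f = e" using es pm.dim_point[OF ef(1)] pm.dim_point[OF ef(2)]
      by (intro fq.subspace_dim_eq) auto
    then show False using ef by simp
  qed
  then have "fvec.dim e < fvec.dim (pm.lspan {e, f})"
    using el(1) es(1) pm.finite_lspan[OF sub]
    by (intro fq.subspace_dim_less) (auto simp: pm.lspan_def fvec.subspace_span)
  then show "fvec.dim (\<Union>{e, f}) = 2" using le pm.dim_point[OF ef(1)] pm.dim_lspan[of "{e, f}"] by simp
qed

lemma rank_M: "matroid_rank (matroid_M S K n :: (label \<Rightarrow> 'f) set pre_matroid) = R"
  using rank_VV unfolding Mat_eq[symmetric] pm.ground_Mat pm.rk_Mat fl_VV dim_VV .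

lemma good_XI_0: "v (XI 0 j) \<noteq> 0 \<Longrightarrow> \<not> bad v"
proof
  assume v: "v (XI 0 j) \<noteq> 0" "bad v"
  then consider "inW v" | a where "a \<in> {1..h}" "inX a v" by (auto simp: bad_def in_cone_def)
  then have "v (XI 0 j) = 0"
  proof cases
    case 2
    then have "0 \<noteq> a" by simp
    then show ?thesis using 2(2) unfolding inX_def by blast
  qed (simp add: inW_def)
  then show False using v by simp
qed

text \<open>No space is a union of two proper subspaces, so some x lies outside both U1 and U2. It
  is bad and thus has no X_0-part, while vectors with an X_0-part are all covered. Translation by x
  plays these facts against each other.\<close>

lemma proper_cover_contradiction:
  assumes U: "U1 \<in> pm.subs VV" "U2 \<in> pm.subs VV" "U1 \<noteq> VV" "U2 \<noteq> VV"
    and cov: "\<And>v. v \<in> VV \<Longrightarrow> \<not> bad v \<Longrightarrow> v \<in> U1 \<or> v \<in> U2"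
  shows False
proof -
  have U1: "fvec.subspace U1" "U1 \<subseteq> VV" and U2: "fvec.subspace U2" "U2 \<subseteq> VV" using U pm.subsD by blast+
  have sum_out: "x + y \<notin> T" if "fvec.subspace T" "x \<notin> T" "y \<in> T" for T and x y :: "label \<Rightarrow> 'f"
    using fvec.subspace_diff[OF that(1), of "x + y" y] that by auto
  obtain x where x: "x \<in> VV" "x \<notin> U1" "x \<notin> U2"
  proof -
    obtain a b where ab: "a \<in> VV" "a \<notin> U1" "b \<in> VV" "b \<notin> U2" using U U1 U2 by blast
    show ?thesis
    proof (cases "a \<in> U2")
      case aU: True
      show ?thesis
      proof (cases "b \<in> U1")
        case True
        have "a + b \<in> VV" using ab fvec.subspace_add[OF pm.subspace_V] by blast
        moreover have "a + b \<notin> U1" by (rule sum_out[OF U1(1) ab(2) True])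
        moreover have "b + a \<notin> U2" by (rule sum_out[OF U2(1) ab(4) aU])
        ultimately show ?thesis using that by (simp add: add.commute)
      qed (use that ab in blast)
    qed (use that ab in blast)
  qed
  have cov0: "v \<in> U1 \<or> v \<in> U2" if "v \<in> VV" "v (XI 0 j) \<noteq> 0" for v j
    using cov good_XI_0 that by blast
  have x0: "x (XI 0 j) = 0" for j using cov0[OF x(1), of j] x(2,3) by blast
  \<comment> \<open>Since x + y and x + z are outside T1, they lie in T2, so y - z is in T1 and T2.
    As it has an X_0-part, x + (y - z) is covered too, which puts x into T1 or T2.\<close>
  have key: False
    if T: "fvec.subspace T1" "fvec.subspace T2" "T1 \<subseteq> VV" "x \<notin> T1" "x \<notin> T2"
      and c: "\<And>v j. v \<in> VV \<Longrightarrow> v (XI 0 j) \<noteq> 0 \<Longrightarrow> v \<in> T1 \<or> v \<in> T2"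
      and y: "y \<in> T1" "y (XI 0 j) \<noteq> 0" and z: "z \<in> T1" "z (XI 0 k) \<noteq> 0"
      and d: "(y - z) (XI 0 l) \<noteq> 0" for T1 T2 y z j k l
  proof -
    have V: "x + w \<in> VV" if "w \<in> T1" for w using x(1) that T(3) fvec.subspace_add[OF pm.subspace_V] by blast
    have "x + y \<in> T2" "x + z \<in> T2"
      using c[OF V[OF y(1)], of j] c[OF V[OF z(1)], of k] sum_out[OF T(1,4)] y z x0 by auto
    then have "(x + y) - (x + z) \<in> T2" by (intro fvec.subspace_diff[OF T(2)])
    then have d2: "y - z \<in> T2" by simp
    have d1: "y - z \<in> T1" by (intro fvec.subspace_diff[OF T(1)] y z)
    have "x + (y - z) \<in> T1 \<or> x + (y - z) \<in> T2" using c[OF V[OF d1], of l] d x0 by simp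
    then show False using sum_out[OF T(1,4) d1] sum_out[OF T(2,5) d2] by blast
  qed
  \<comment> \<open>Among three independent vectors of X_0, two lie in the same one of U1 and U2,
    and their difference still has an X_0-part.\<close>
  define e :: "nat \<Rightarrow> label \<Rightarrow> 'f" where "e = (\<lambda>j. unit_fun (XI 0 j))"
  have ev: "e j (XI 0 j) = 1" "j \<noteq> k \<Longrightarrow> e k (XI 0 j) = 0" for j k by (auto simp: e_def unit_fun_def)
  have eV: "e j \<in> VV" if "j \<in> {1, 2, 3}" for j
    using that n_ge KK_ge by (auto simp: VV_eq coord_space_iff e_def unit_fun_def dim_X_def)
  have n1: "\<not> (e j \<in> U1 \<and> e k \<in> U1)" if "j \<noteq> k" for j k
    using key[OF U1(1) U2(1) U1(2) x(2,3) cov0, where y = "e j" and j = j and z = "e k" and k = k and l = j] ev that by auto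
  have n2: "\<not> (e j \<in> U2 \<and> e k \<in> U2)" if "j \<noteq> k" for j k
    using key[OF U2(1) U1(1) U2(2) x(3,2), where y = "e j" and j = j and z = "e k" and k = k and l = j] cov0 ev that by auto
  have m: "e j \<in> U1 \<or> e j \<in> U2" if "j \<in> {1, 2, 3}" for j
    using cov0[OF eV[OF that], of j] ev by simp
  show False using m[of 1] m[of 2] m[of 3] n1[of 1 2] n1[of 1 3] n1[of 2 3] n2[of 1 2] n2[of 1 3] n2[of 2 3] by (simp; blast)
qed

text \<open>By simplicity both sides of a k-separation have rank at least k. Neither side can then
  span, so two proper subspaces would cover all elements.\<close>

lemma three_connected_M: "three_connected (matroid_M S K n :: (label \<Rightarrow> 'f) set pre_matroid)"
  unfolding three_connected_def
proof (intro ballI notI, elim exE)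
  fix k :: nat and A assume k: "k \<in> {1, 2}" and sep: "separation k (matroid_M S K n :: (label \<Rightarrow> 'f) set pre_matroid) A"
  define B where "B = EE - A"
  have A: "A \<subseteq> EE" "k \<le> card A" "k \<le> card B" "fvec.dim (\<Union>A) + fvec.dim (\<Union>B) < R + k"
    using sep unfolding separation_def rank_M unfolding Mat_eq[symmetric] pm.ground_Mat pm.rk_Mat B_def by auto
  have B: "B \<subseteq> EE" by (auto simp: B_def)
  have big: "k \<le> fvec.dim (\<Union>D)" if D: "D \<subseteq> EE" "k \<le> card D" for D
  proof -
    have finD: "finite D" using D(1) pm.finite_points finite_subset by blast
    obtain D' where D': "D' \<subseteq> D" "card D' = k" using obtain_subset_with_card_n[OF D(2)] by blast
    have "fvec.dim (\<Union>D') = k"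
    proof (cases "k = 1")
      case True
      then obtain e where "D' = {e}" using D'(2) card_1_singletonE by blast
      then show ?thesis using True D' D pm.dim_point[of e] by auto
    next
      case False
      then have "card D' = 2" using k D' by simp
      then obtain e f where ef: "D' = {e, f}" "e \<noteq> f" by (meson card_2_iff)
      then have "e \<in> EE" "f \<in> EE" using D' D by auto
      then have "fvec.dim (\<Union>{e, f}) = 2"
        using simple_matroid_M ef(2) unfolding simple_matroid_def Mat_eq[symmetric] pm.ground_Mat pm.rk_Mat by blast
      then show ?thesis using ef False k by simp
    qed
    then show ?thesis using pm.rank_mono[OF D'(1) D(1)] by simp
  qed
  have ne: "pm.lspan A \<noteq> VV"
  proof
    assume "pm.lspan A = VV"
    then have "fvec.dim (\<Union>A) = R" using pm.dim_lspan[of A] dim_VV by simp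
    then show False using big[OF B A(3)] A(4) by simp
  qed
  have ne': "pm.lspan B \<noteq> VV"
  proof
    assume "pm.lspan B = VV"
    then have "fvec.dim (\<Union>B) = R" using pm.dim_lspan[of B] dim_VV by simp
    then show False using big[OF A(1,2)] A(4) by simp
  qed
  show False
  proof (rule proper_cover_contradiction[OF pm.lspan_subs[OF A(1)] pm.lspan_subs[OF B] ne ne'])
    fix v assume v: "v \<in> VV" "\<not> bad v"
    then have "v \<noteq> 0" using bad_0 by blast
    then have "fvec.span {v} \<in> EE" using EE_iff[OF v(1)] v(2) by simp
    then have "fvec.span {v} \<subseteq> pm.lspan A \<or> fvec.span {v} \<subseteq> pm.lspan B"
      using pm.subset_lspan by (cases "fvec.span {v} \<in> A") (auto simp: B_def)
    then show "v \<in> pm.lspan A \<or> v \<in> pm.lspan B" using fvec.span_base[of v "{v}"] by blast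
  qed
qed

lemma representable_M: "representable_over TYPE('f) (matroid_M S K n :: (label \<Rightarrow> 'f) set pre_matroid)"
proof -
  obtain \<iota> where "bij_betw \<iota> {0..<card IV} IV"
    using ex_bij_betw_nat_finite[of IV] by auto
  then have im: "\<iota> ` {0..<card IV} = IV" by (simp add: bij_betw_def)
  \<comment> \<open>Numbers the coordinate labels of V as matrix rows; being linear and injective on
    V, this preserves the dimension of spans.\<close>
  define \<tau> :: "(label \<Rightarrow> 'f) \<Rightarrow> nat \<Rightarrow> 'f" where "\<tau> = (\<lambda>v m. if m < card IV then v (\<iota> m) else 0)"
  interpret lin: Vector_Spaces.linear "scale_fun :: 'f \<Rightarrow> (label \<Rightarrow> 'f) \<Rightarrow> label \<Rightarrow> 'f" "scale_fun :: 'f \<Rightarrow> (nat \<Rightarrow> 'f) \<Rightarrow> nat \<Rightarrow> 'f" \<tau>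
    by unfold_locales (auto simp: \<tau>_def fun_eq_iff scale_fun_def)
  have inj: "inj_on \<tau> VV"
  proof (rule inj_onI)
    fix v w assume v: "v \<in> VV" and w: "w \<in> VV" and eq: "\<tau> v = \<tau> w"
    show "v = w"
    proof
      fix l
      show "v l = w l"
      proof (cases "l \<in> IV")
        case True
        then obtain m where "l = \<iota> m" "m < card IV" using im by force
        then show ?thesis using fun_cong[OF eq, of m] by (simp add: \<tau>_def)
      next
        case False
        then show ?thesis using v w by (simp add: VV_eq coord_space_iff)
      qed
    qed
  qed
  have "\<forall>e\<in>EE. \<exists>v. v \<noteq> 0 \<and> e = fvec.span {v}" using pm.point_nonzero by blast
  then obtain f where f: "\<And>e. e \<in> EE \<Longrightarrow> e = fvec.span {f e}" by metis
  have "fvec.dim (\<Union>A) = fvec.dim ((\<lambda>e. \<tau> (f e)) ` A)" if A: "A \<subseteq> EE" for A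
  proof -
    have sp: "fvec.span (f ` A) = pm.lspan A"
    proof
      have "f e \<in> pm.lspan A" if "e \<in> A" for e
      proof -
        have "f e \<in> e" using f[of e] A that fvec.span_base[of "f e" "{f e}"] by auto
        then show ?thesis using pm.subset_lspan[OF that] by blast
      qed
      then show "fvec.span (f ` A) \<subseteq> pm.lspan A"
        unfolding pm.lspan_def by (intro fvec.span_minimal fvec.subspace_span) auto
      have "e \<subseteq> fvec.span (f ` A)" if "e \<in> A" for e
      proof -
        have "fvec.span {f e} \<subseteq> fvec.span (f ` A)" using that by (intro fvec.span_mono) auto
        then show ?thesis using f[of e] A that by auto
      qed
      then show "pm.lspan A \<subseteq> fvec.span (f ` A)"
        by (simp add: pm.lspan_subset_iff fvec.subspace_span)
    qed
    have "fvec.span (\<tau> ` (f ` A)) = \<tau> ` pm.lspan A"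
      unfolding sp[symmetric] by (rule lin.span_image)
    then have spt: "fvec.span ((\<lambda>e. \<tau> (f e)) ` A) = \<tau> ` pm.lspan A" by (simp add: image_image)
    have LV: "pm.lspan A \<subseteq> VV" using pm.subsD(2)[OF pm.lspan_subs[OF A]] .
    have fin: "finite (pm.lspan A)" by (rule pm.finite_lspan[OF A])
    have "pm.q ^ fvec.dim ((\<lambda>e. \<tau> (f e)) ` A) = card (\<tau> ` pm.lspan A)"
      using fq.card_span[of "(\<lambda>e. \<tau> (f e)) ` A"] fin unfolding spt by simp
    also have "\<dots> = card (pm.lspan A)" by (rule card_image[OF inj_on_subset[OF inj LV]])
    also have "\<dots> = pm.q ^ fvec.dim (pm.lspan A)"
      using pm.subsD(1)[OF pm.lspan_subs[OF A]] fin by (rule fq.card_subspace)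
    finally have "pm.q ^ fvec.dim ((\<lambda>e. \<tau> (f e)) ` A) = pm.q ^ fvec.dim (pm.lspan A)" .
    then have "fvec.dim ((\<lambda>e. \<tau> (f e)) ` A) = fvec.dim (pm.lspan A)"
      using q_ge_2 by (simp add: power_inject_exp)
    then show ?thesis using pm.dim_lspan[of A] by simp
  qed
  then show ?thesis
    unfolding representable_over_def Mat_eq[symmetric] pm.ground_Mat pm.rk_Mat
    by (intro exI[of _ "card IV"] exI[of _ "\<lambda>e. \<tau> (f e)"]) (auto simp: \<tau>_def)
qed

end

theorem theoremC:
  fixes S :: "nat set" and K :: nat
  assumes "finite S" and "S \<noteq> {}" and "\<forall>s\<in>S. 2 \<le> s" and "K \<ge> Max S + 1"
  shows
    "(\<forall>n \<ge> 20 * K\<^sup>2.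
        let M = (matroid_M S K n :: (label \<Rightarrow> 'f::{field, finite}) set pre_matroid);
            h = card S;
            Q = inv_kl_poly M;
            c = coeff Q;
            \<Delta> = (\<lambda>j. (c j)\<^sup>2 - c (j - 1) * c (j + 1))
        in matroid M \<and> simple_matroid M \<and> three_connected M \<and>
           representable_over TYPE('f) M \<and>
           matroid_rank M = K + n * (1 + ((h + 2) choose 3)) \<and>
           degree Q = K \<and>
           (\<forall>j<K. c j > c (j + 1)) \<and> c K > 0 \<and>
           (\<forall>j. 1 \<le> j \<and> j < K \<longrightarrow> (\<Delta> j < 0 \<longleftrightarrow> j \<in> S) \<and> (j \<notin> S \<longrightarrow> \<Delta> j > 0)))
     \<and> (\<forall>j\<in>S.
          (\<lambda>n. let c = coeff (inv_kl_poly
                     (matroid_M S K n :: (label \<Rightarrow> 'f::{field, finite}) set pre_matroid))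
               in (real_of_int (c j))\<^sup>2 / (real_of_int (c (j - 1)) * real_of_int (c (j + 1))))
          \<longlonglongrightarrow> 0)"
proof (intro conjI allI impI ballI)
  have constr: "construction S K n" if "20 * K\<^sup>2 \<le> n" for n
    by unfold_locales (use assms that in auto)
  {
    fix n assume "20 * K\<^sup>2 \<le> n"
    then interpret c: construction "TYPE('f)" S K n by (rule constr)
    have coeffs: "coeff (inv_kl_poly (matroid_M S K n :: (label \<Rightarrow> 'f) set pre_matroid)) = c.ikl_coeff"
      by (simp add: fun_eq_iff c.ikl_coeff_def)
    have "(c.ikl_coeff j)\<^sup>2 - c.ikl_coeff (j - 1) * c.ikl_coeff (j + 1) < 0 \<longleftrightarrow> j \<in> S"
      "j \<notin> S \<Longrightarrow> 0 < (c.ikl_coeff j)\<^sup>2 - c.ikl_coeff (j - 1) * c.ikl_coeff (j + 1)" if "1 \<le> j" "j < K" for j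
      using c.ikl_coeff_log_concave[OF that] c.ikl_coeff_convex_strict[of j] by fastforce+
    then show "let M = (matroid_M S K n :: (label \<Rightarrow> 'f) set pre_matroid);
            h = card S;
            Q = inv_kl_poly M;
            c = coeff Q;
            \<Delta> = (\<lambda>j. (c j)\<^sup>2 - c (j - 1) * c (j + 1))
        in matroid M \<and> simple_matroid M \<and> three_connected M \<and>
           representable_over TYPE('f) M \<and>
           matroid_rank M = K + n * (1 + ((h + 2) choose 3)) \<and>
           degree Q = K \<and>
           (\<forall>j<K. c j > c (j + 1)) \<and> c K > 0 \<and>
           (\<forall>j. 1 \<le> j \<and> j < K \<longrightarrow> (\<Delta> j < 0 \<longleftrightarrow> j \<in> S) \<and> (j \<notin> S \<longrightarrow> \<Delta> j > 0))"
      unfolding Let_def coeffs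
      using c.pm.matroid_Mat[unfolded c.Mat_eq] c.simple_matroid_M c.three_connected_M c.representable_M
        c.rank_M[unfolded c.R_def] c.degree_inv_kl c.ikl_coeff_decreasing c.ikl_coeff_pos[of K]
      by blast
  }
  fix j assume j: "j \<in> S"
  define q where "q = real (card (UNIV :: 'f set))"
  define f where "f = (\<lambda>n. let c = coeff (inv_kl_poly
                     (matroid_M S K n :: (label \<Rightarrow> 'f) set pre_matroid))
               in (real_of_int (c j))\<^sup>2 / (real_of_int (c (j - 1)) * real_of_int (c (j + 1))))"
  have bounds: "0 \<le> f n \<and> f n \<le> 4 * q ^ (4 * (K * K) + 2) * inverse (q ^ n)" if n: "20 * K\<^sup>2 \<le> n" for n
  proof -
    interpret c: construction "TYPE('f)" S K n using n by (rule constr)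
    have "f n = (real_of_int (c.ikl_coeff j))\<^sup>2 / (real_of_int (c.ikl_coeff (j - 1)) * real_of_int (c.ikl_coeff (j + 1)))"
      by (simp add: f_def Let_def c.ikl_coeff_def)
    then show ?thesis using c.ikl_coeff_ratio_bound[OF j] by (simp add: q_def fq.q_def divide_inverse)
  qed
  have "1 < q" using fq.q_ge_2[where 'f = 'f] by (simp add: q_def fq.q_def)
  then have "(\<lambda>n. inverse (q ^ n)) \<longlonglongrightarrow> 0" by (rule LIMSEQ_inverse_realpow_zero)
  then have lim: "(\<lambda>n. 4 * q ^ (4 * (K * K) + 2) * inverse (q ^ n)) \<longlonglongrightarrow> 0"
    by (rule tendsto_mult_right_zero)
  have "f \<longlonglongrightarrow> 0"
  proof (rule tendsto_sandwich[OF _ _ tendsto_const lim])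
    show "\<forall>\<^sub>F n in sequentially. 0 \<le> f n"
      and "\<forall>\<^sub>F n in sequentially. f n \<le> 4 * q ^ (4 * (K * K) + 2) * inverse (q ^ n)"
      using bounds by (auto intro: eventually_sequentiallyI[of "20 * K\<^sup>2"])
  qed
  then show "(\<lambda>n. let c = coeff (inv_kl_poly
                     (matroid_M S K n :: (label \<Rightarrow> 'f) set pre_matroid))
               in (real_of_int (c j))\<^sup>2 / (real_of_int (c (j - 1)) * real_of_int (c (j + 1))))
          \<longlonglongrightarrow> 0"
    unfolding f_def .
qed

end
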